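(* Let $n\ge 2$ and let $0\le \ell<n$ with $n-\ell$ even. For each $\mathfrak{t}\in \mathcal{T}_n(\ell)\cap \mathrm{Im}(\mathrm{Sp})$ choose a pair partition $A_{\mathfrak t}\in\mathbf{J}_n$ with $\mathrm{Sp}(A_{\mathfrak t})=\mathfrak t$, and let $D_{\mathfrak t}=\sum_{B\in A_{\mathfrak t}^{\mathfrak{S}_n}}B$ be the sum of the elements of its $\mathfrak{S}_n$-conjugation orbit. For scalars $c_{\mathfrak t}\in K$ set $$X_n(\ell)=\sum_{\mathfrak t\in\mathcal{T}_n(\ell)\cap \mathrm{Im}(\mathrm{Sp})}c_{\mathfrak t}D_{\mathfrak t},$$ and let $\overline{u}=\overline{u_1}\,\overline{u_3}\cdots\overline{u_{n-\ell-1}}$. Then the equation $$\overline{u}\,X_n(\ell)=-\overline{u}$$ is always solvable in the $c_{\mathfrak t}\in K$. Moreover, for such a solution, $\phi_n(\ell)=1+X_n(\ell)$ is the splitting idempotent corresponding to the short exact sequence of $B_n$-bimodules $$0\rightarrow \overline{J_n}(\ell)\rightarrow B_n\rightarrow B_n/\overline{J_n}(\ell)\rightarrow 0.$$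
   Context: Brauer diagrams. Let $\underline{n}=\{1,\dots,n\}$, $\underline{n'}=\{1',\dots,n'\}$, and let $\mathbf{J}_n$ be the set of pair partitions of $\underline n\cup\underline{n'}$ (partitions into $n$ two-element subsets), drawn as diagrams with the nodes $1,\dots,n$ in a top row and $1',\dots,n'$ in a bottom row. Let $\mathrm{op}$ be the involution exchanging $x$ and $x'$. The type $\mathrm{tp}(a)$ of a pair $a\in A$ is $N$ if $a\subset\underline n$ (northern arc), $S$ if $a\subset\underline{n'}$ (southern arc), and $P$ otherwise (propagating line). Let $\mathbf{J}_n[\ell]$ (resp. $\mathbf{J}_n(\ell)$) be the set of $A\in\mathbf{J}_n$ with exactly (resp. at most) $\ell$ propagating lines. Algebra. Let $\delta$ be an indeterminate. For $A,B\in\mathbf{J}_n$, put $A$ on top of $B$, identifying the node $i'$ of $A$ with the node $i$ of $B$; let $v(A,B)$ be the number of connected components lying only in the middle row and $\pi(A\circ B)\in\mathbf{J}_n$ the pair partition given by the connected components of the top and bottom nodes. The product is $AB=\delta^{v(A,B)}\pi(A\circ B)$. This defines the Brauer algebra over $\mathbb{Q}(\delta)$, with basis $\mathbf{J}_n$ and identity $1=\{\{1,1'\},\dots,\{n,n'\}\}$. Let $u_i$ (resp. $\sigma_i$) be obtained from $1$ by replacing $\{i,i'\},\{i+1,(i+1)'\}$ by $\{i,i+1\},\{i',(i+1)'\}$ (resp. by $\{i,(i+1)'\},\{i+1,i'\}$). Integral form. Let $K=\{f/g : f,g\in\mathbb{Z}[\delta],\ g\text{ monic},\ \deg f\le\deg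 g\}\subset\mathbb{Q}(\delta)$ and $\overline{u_i}=\delta^{-1}u_i$. Here $B_n$ denotes the $K$-subalgebra of the Brauer algebra over $\mathbb{Q}(\delta)$ generated by the $\sigma_i$ and $\overline{u_i}$ ($1\le i\le n-1$). It has $K$-basis $\overline{\mathbf{J}_n}=\{\overline A: A\in\mathbf{J}_n\}$, where $\overline A=\delta^{-h}A$ with $h$ the number of northern arcs of $A$. Let $\overline{J_n}(\ell)$ be the two-sided ideal of $B_n$ generated by $\{\overline A: A\in\mathbf{J}_n(\ell)\}$. The sums $D_{\mathfrak t}$ and $X_n(\ell)$ are formed in the Brauer algebra over $\mathbb{Q}(\delta)$. Conjugation. $\mathfrak{S}_n$ acts on $\mathbf{J}_n$ by conjugation, i.e. $\sigma$ relabels $x\mapsto\sigma x$, $x'\mapsto(\sigma x)'$; $A^{\mathfrak{S}_n}$ is the orbit of $A$. Tableaux. For fillings $\mathfrak s,\mathfrak t$ of the boxes of a Young diagram of a partition $\lambda=(\lambda_1,\dots,\lambda_m)$, $\lambda_m\ne0$, by symbols from $\{N,S,P\}$, write $\mathfrak s\sim\mathfrak t$ if there is $\sigma\in\mathfrak{S}_m$ such that for every $i$ the $\sigma(i)$-th row of $\mathfrak t$ is obtained from the $i$-th row of $\mathfrak s$ by cyclically rotating and/or reversing its entries. $\mathcal{T}_n$ is the set of $\sim$-classes of such fillings over all partitions $\lambda$ of $n$, and $\mathcal{T}_n(\ell)\subset\mathcal{T}_n$ is the subset with at most $\ell$ entries equal to $P$. Spore function $\mathrm{Sp}:\mathbf{J}_n\to\mathcal{T}_n$.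 Given $A\in\mathbf{J}_n$, decompose $A=A_1\sqcup\dots\sqcup A_m$ into non-empty sets of pairs, with $m$ maximal, such that for $a\in A_i$, $b\in A_j$, $i\ne j$, $x\in a$ implies $\mathrm{op}(x)\notin b$; order so that $|A_1|\ge\dots\ge|A_m|$ and let $\lambda_i=|A_i|$. For each $i$ choose $a_1\in A_i$ and $x_1\in a_1$; inductively let $a_{j+1}\in A_i$ be the pair containing $\mathrm{op}(x_j)$ and $x_{j+1}$ the other element of $a_{j+1}$, stopping on returning to $a_1$. Fill the $j$-th box of row $i$ of the Young diagram of $\lambda$ with $\mathrm{tp}(a_j)$. $\mathrm{Sp}(A)$ is the $\sim$-class of the result (independent of choices). Splitting idempotent. For a two-sided ideal $J$ of a unital algebra $\Lambda$, the splitting idempotent of $0\to J\to\Lambda\to\Lambda/J\to0$ is the element $\phi_J\in\Lambda$ (unique if it exists, and then a central idempotent) with $\phi_J\equiv1\bmod J$ and $\phi_JJ=J\phi_J=0$. *)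

theory Defs
  imports
    "HOL-Library.Poly_Mapping"
    "HOL-Library.Disjoint_Sets"
    "HOL-Computational_Algebra.Polynomial_Factorial"
    "HOL-Combinatorics.Permutations"
    "HOL-Algebra.Subrings"
    "HOL-Algebra.Ideal"
begin

section \<open>Pair partitions\<close>

text \<open>\<open>Top i\<close> is the node \<open>i\<close> and \<open>Bot i\<close> the node \<open>i'\<close>.\<close>

datatype node = Top nat | Bot nat

fun opp :: "node \<Rightarrow> node" where
  "opp (Top i) = Bot i"
| "opp (Bot i) = Top i"

type_synonym diagram = "node set set"

definition nodes :: "nat \<Rightarrow> node set" where
  "nodes n = Top ` {1..n} \<union> Bot ` {1..n}"

definition pair_partitions :: "nat \<Rightarrow> diagram set" where
  "pair_partitions n = {A. partition_on (nodes n) A \<and> (\<forall>a\<in>A. card a = 2)}"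

datatype pair_type = Northern | Southern | Propagating

definition tp :: "node set \<Rightarrow> pair_type" where
  "tp a = (if a \<subseteq> range Top then Northern else if a \<subseteq> range Bot then Southern else Propagating)"

definition pair_partitions_le :: "nat \<Rightarrow> nat \<Rightarrow> diagram set" where
  "pair_partitions_le n l = {A \<in> pair_partitions n. card {a \<in> A. tp a = Propagating} \<le> l}"

definition id_diagram :: "nat \<Rightarrow> diagram" where
  "id_diagram n = {{Top i, Bot i} | i. i \<in> {1..n}}"

definition u_diagram :: "nat \<Rightarrow> nat \<Rightarrow> diagram" where
  "u_diagram n i =
    (id_diagram n - {{Top i, Bot i}, {Top (i + 1), Bot (i + 1)}})
      \<union> {{Top i, Top (i + 1)}, {Bot i, Bot (i + 1)}}"

definition sigma_diagram :: "nat \<Rightarrow> nat \<Rightarrow> diagram" where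
  "sigma_diagram n i =
    (id_diagram n - {{Top i, Bot i}, {Top (i + 1), Bot (i + 1)}})
      \<union> {{Top i, Bot (i + 1)}, {Top (i + 1), Bot i}}"


section \<open>Composition of diagrams\<close>

text \<open>
  Stacking \<open>A\<close> on top of \<open>B\<close> gives a graph with three rows of nodes; the bottom row of \<open>A\<close>
  and the top row of \<open>B\<close> both become the middle row.
\<close>

datatype stack_node = Upper nat | Middle nat | Lower nat

fun upper_embed :: "node \<Rightarrow> stack_node" where
  "upper_embed (Top i) = Upper i"
| "upper_embed (Bot i) = Middle i"

fun lower_embed :: "node \<Rightarrow> stack_node" where
  "lower_embed (Top i) = Middle i"
| "lower_embed (Bot i) = Lower i"

fun outer_embed :: "node \<Rightarrow> stack_node" where
  "outer_embed (Top i) = Upper i"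
| "outer_embed (Bot i) = Lower i"

definition stack_nodes :: "nat \<Rightarrow> stack_node set" where
  "stack_nodes n = Upper ` {1..n} \<union> Middle ` {1..n} \<union> Lower ` {1..n}"

definition stack_edges :: "diagram \<Rightarrow> diagram \<Rightarrow> (stack_node \<times> stack_node) set" where
  "stack_edges A B =
    {(upper_embed x, upper_embed y) | x y. \<exists>a\<in>A. x \<in> a \<and> y \<in> a}
    \<union> {(lower_embed x, lower_embed y) | x y. \<exists>b\<in>B. x \<in> b \<and> y \<in> b}"

definition stack_components :: "nat \<Rightarrow> diagram \<Rightarrow> diagram \<Rightarrow> stack_node set set" where
  "stack_components n A B = stack_nodes n // (stack_edges A B)\<^sup>*"

definition loops :: "nat \<Rightarrow> diagram \<Rightarrow> diagram \<Rightarrow> nat" where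
  "loops n A B = card {C \<in> stack_components n A B. C \<subseteq> range Middle}"

definition compose :: "nat \<Rightarrow> diagram \<Rightarrow> diagram \<Rightarrow> diagram" where
  "compose n A B = (\<lambda>C. outer_embed -` C) ` {C \<in> stack_components n A B. \<not> C \<subseteq> range Middle}"


section \<open>The Brauer algebra over \<open>\<rat>(\<delta>)\<close> and its integral form\<close>

type_synonym ratfun = "rat poly fract"

definition delta :: ratfun where
  "delta = Fract [:0, 1:] 1"

text \<open>
  Elements of the algebra are finitely supported functions on diagrams, so the additive structure
  is that of the type; the scalar action and the product are defined here.
\<close>

type_synonym brauer_elem = "diagram \<Rightarrow>\<^sub>0 ratfun"

definition scale :: "ratfun \<Rightarrow> brauer_elem \<Rightarrow> brauer_elem" where
  "scale c x = Poly_Mapping.map (\<lambda>a. c * a) x"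

definition basis_elem :: "diagram \<Rightarrow> brauer_elem" where
  "basis_elem A = Poly_Mapping.single A 1"

definition brauer_mult :: "nat \<Rightarrow> brauer_elem \<Rightarrow> brauer_elem \<Rightarrow> brauer_elem" where
  "brauer_mult n x y =
    (\<Sum>A\<in>Poly_Mapping.keys x. \<Sum>B\<in>Poly_Mapping.keys y.
      scale (Poly_Mapping.lookup x A * Poly_Mapping.lookup y B * delta ^ loops n A B)
        (basis_elem (compose n A B)))"

definition brauer :: "nat \<Rightarrow> brauer_elem ring" where
  "brauer n =
    \<lparr>carrier = {x. Poly_Mapping.keys x \<subseteq> pair_partitions n},
     mult = brauer_mult n, one = basis_elem (id_diagram n), zero = 0, add = (+)\<rparr>"

definition integral_scalars :: "ratfun set" where
  "integral_scalars =
    {Fract (map_poly of_int f) (map_poly of_int g) | (f :: int poly) (g :: int poly).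
      lead_coeff g = 1 \<and> degree f \<le> degree g}"

definition sigma :: "nat \<Rightarrow> nat \<Rightarrow> brauer_elem" where
  "sigma n i = basis_elem (sigma_diagram n i)"

definition u_bar :: "nat \<Rightarrow> nat \<Rightarrow> brauer_elem" where
  "u_bar n i = scale (inverse delta) (basis_elem (u_diagram n i))"

definition bar :: "diagram \<Rightarrow> brauer_elem" where
  "bar A = scale (inverse delta ^ card {a \<in> A. tp a = Northern}) (basis_elem A)"

definition integral_subalgebra :: "nat \<Rightarrow> brauer_elem set \<Rightarrow> bool" where
  "integral_subalgebra n S \<longleftrightarrow>
    subring S (brauer n) \<and> (\<forall>c\<in>integral_scalars. \<forall>x\<in>S. scale c x \<in> S)"

definition integral_brauer :: "nat \<Rightarrow> brauer_elem ring" where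
  "integral_brauer n = (brauer n)
    \<lparr>carrier := \<Inter>{S. integral_subalgebra n S \<and> sigma n ` {1..n - 1} \<union> u_bar n ` {1..n - 1} \<subseteq> S}\<rparr>"

text \<open>
  The scalars act through multiples of the identity, which lie in the algebra, so ring ideals are
  the same as algebra ideals.
\<close>

definition integral_ideal :: "nat \<Rightarrow> nat \<Rightarrow> brauer_elem set" where
  "integral_ideal n l = Idl\<^bsub>integral_brauer n\<^esub> (bar ` pair_partitions_le n l)"


section \<open>Conjugation\<close>

fun relabel :: "(nat \<Rightarrow> nat) \<Rightarrow> node \<Rightarrow> node" where
  "relabel \<sigma> (Top i) = Top (\<sigma> i)"
| "relabel \<sigma> (Bot i) = Bot (\<sigma> i)"

definition conj_orbit :: "nat \<Rightarrow> diagram \<Rightarrow> diagram set" where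
  "conj_orbit n A = {(\<lambda>a. relabel \<sigma> ` a) ` A | \<sigma>. \<sigma> permutes {1..n}}"

definition orbit_sum :: "nat \<Rightarrow> diagram \<Rightarrow> brauer_elem" where
  "orbit_sum n A = (\<Sum>B\<in>conj_orbit n A. basis_elem B)"


section \<open>Tableaux and the spore function\<close>

text \<open>A filling of a Young diagram is the list of its rows, and the row lengths are the partition.\<close>

type_synonym filling = "pair_type list list"

definition fillings :: "nat \<Rightarrow> filling set" where
  "fillings n = {s. [] \<notin> set s \<and> sorted_wrt (\<ge>) (map length s) \<and> sum_list (map length s) = n}"

definition filling_sim :: "nat \<Rightarrow> (filling \<times> filling) set" where
  "filling_sim n = {(s, t). s \<in> fillings n \<and> t \<in> fillings n \<and> length s = length t \<and>
    (\<exists>\<sigma>. \<sigma> permutes {..<length s} \<and>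
      (\<forall>i<length s. \<exists>k. t ! \<sigma> i = rotate k (s ! i) \<or> t ! \<sigma> i = rotate k (rev (s ! i))))}"

definition tableaux :: "nat \<Rightarrow> filling set set" where
  "tableaux n = fillings n // filling_sim n"

definition tableaux_le :: "nat \<Rightarrow> nat \<Rightarrow> filling set set" where
  "tableaux_le n l = {T \<in> tableaux n. \<exists>s\<in>T. count_list (concat s) Propagating \<le> l}"

definition separated_decomposition :: "diagram \<Rightarrow> diagram list \<Rightarrow> bool" where
  "separated_decomposition A As \<longleftrightarrow>
    {} \<notin> set As \<and> \<Union>(set As) = A \<and>
    (\<forall>i<length As. \<forall>j<length As. i \<noteq> j \<longrightarrow>
      As ! i \<inter> As ! j = {} \<and> (\<forall>a\<in>As ! i. \<forall>b\<in>As ! j. \<forall>x\<in>a. opp x \<notin> b))"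

definition spore_decomposition :: "diagram \<Rightarrow> diagram list \<Rightarrow> bool" where
  "spore_decomposition A As \<longleftrightarrow>
    separated_decomposition A As \<and>
    (\<forall>Bs. separated_decomposition A Bs \<longrightarrow> length Bs \<le> length As) \<and>
    sorted_wrt (\<ge>) (map card As)"

text \<open>
  \<open>as\<close> and \<open>xs\<close> are the complete sequences of pairs and of nodes chosen in the part \<open>A\<close>: the pair
  following the last one would be \<open>as ! 0\<close> again, and no earlier return takes place. Since pairs
  have two distinct elements, the equation for \<open>as ! Suc j\<close> says that it is the pair containing
  \<open>opp (xs ! j)\<close> and that \<open>xs ! Suc j\<close> is its other element.
\<close>

definition spore_walk :: "diagram \<Rightarrow> node set list \<Rightarrow> node list \<Rightarrow> bool" where
  "spore_walk A as xs \<longleftrightarrow>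
    as \<noteq> [] \<and> length xs = length as \<and> set as \<subseteq> A \<and> xs ! 0 \<in> as ! 0 \<and>
    (\<forall>j. Suc j < length as \<longrightarrow>
      as ! Suc j = {opp (xs ! j), xs ! Suc j} \<and> as ! Suc j \<noteq> as ! 0) \<and>
    opp (last xs) \<in> as ! 0"

text \<open>The possible outcomes of the construction, over all choices made on the way.\<close>

definition spore_filling :: "diagram \<Rightarrow> filling \<Rightarrow> bool" where
  "spore_filling A s \<longleftrightarrow>
    (\<exists>As. spore_decomposition A As \<and> length s = length As \<and>
      (\<forall>i<length As. \<exists>as xs. spore_walk (As ! i) as xs \<and> s ! i = map tp as))"

definition Sp :: "nat \<Rightarrow> diagram \<Rightarrow> filling set" where
  "Sp n A = filling_sim n `` {SOME s. spore_filling A s}"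


section \<open>The idempotent\<close>

definition spore_classes :: "nat \<Rightarrow> nat \<Rightarrow> filling set set" where
  "spore_classes n l = tableaux_le n l \<inter> Sp n ` pair_partitions n"

definition X_elem ::
  "nat \<Rightarrow> nat \<Rightarrow> (filling set \<Rightarrow> diagram) \<Rightarrow> (filling set \<Rightarrow> ratfun) \<Rightarrow> brauer_elem" where
  "X_elem n l A c = (\<Sum>t\<in>spore_classes n l. scale (c t) (orbit_sum n (A t)))"

definition u_bar_prod :: "nat \<Rightarrow> nat \<Rightarrow> brauer_elem" where
  "u_bar_prod n l =
    foldr (\<lambda>j x. u_bar n (2 * j + 1) \<otimes>\<^bsub>brauer n\<^esub> x) [0..<(n - l) div 2] \<one>\<^bsub>brauer n\<^esub>"

definition splitting_idempotent :: "('a, 'm) ring_scheme \<Rightarrow> 'a set \<Rightarrow> 'a \<Rightarrow> bool" where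
  "splitting_idempotent R J \<phi> \<longleftrightarrow>
    ideal J R \<and> \<phi> \<in> carrier R \<and> \<phi> \<ominus>\<^bsub>R\<^esub> \<one>\<^bsub>R\<^esub> \<in> J \<and>
    (\<forall>x\<in>J. \<phi> \<otimes>\<^bsub>R\<^esub> x = \<zero>\<^bsub>R\<^esub> \<and> x \<otimes>\<^bsub>R\<^esub> \<phi> = \<zero>\<^bsub>R\<^esub>)"

lemma splitting_idempotent_unique:
  assumes \<phi>: "splitting_idempotent R J \<phi>" and \<psi>: "splitting_idempotent R J \<psi>"
  shows "\<phi> = \<psi>"
proof -
  interpret ideal J R using \<phi> by (simp add: splitting_idempotent_def)
  have c: "\<phi> \<in> carrier R" "\<psi> \<in> carrier R"
    using \<phi> \<psi> by (simp_all add: splitting_idempotent_def)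
  have "\<psi> \<otimes>\<^bsub>R\<^esub> (\<phi> \<ominus>\<^bsub>R\<^esub> \<one>\<^bsub>R\<^esub>) = \<zero>\<^bsub>R\<^esub>" "(\<psi> \<ominus>\<^bsub>R\<^esub> \<one>\<^bsub>R\<^esub>) \<otimes>\<^bsub>R\<^esub> \<phi> = \<zero>\<^bsub>R\<^esub>"
    using \<phi> \<psi> by (simp_all add: splitting_idempotent_def)
  then have "\<psi> \<otimes>\<^bsub>R\<^esub> \<phi> \<ominus>\<^bsub>R\<^esub> \<psi> = \<zero>\<^bsub>R\<^esub>" "\<psi> \<otimes>\<^bsub>R\<^esub> \<phi> \<ominus>\<^bsub>R\<^esub> \<phi> = \<zero>\<^bsub>R\<^esub>"
    using c by (simp_all add: a_minus_def l_distr r_distr l_minus r_minus)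
  then show ?thesis using c by (metis m_closed r_right_minus_eq)
qed

end

theory Submission
  imports Defs
begin

text \<open>
  A diagram \<open>A\<close> acts on the colourings of its \<open>2n\<close> nodes by two colours: the 0-1 matrix of \<open>A\<close>
  records which colourings of the top and of the bottom row are compatible with its pairs. Stacking
  becomes matrix multiplication up to the factor \<open>2\<close> for each loop, and the matrix determines the
  diagram. Hence identities for composites and numbers of loops, such as associativity, reduce
  to counting colourings.

  Gluing \<open>A\<close> and \<open>B\<close> along all their nodes and counting components gives the symmetric associative
  form \<open>\<langle>A, B\<rangle> = \<delta>\<^bsup>c(A, B*)\<^esup>\<close>, where \<open>B*\<close> exchanges the rows of \<open>B\<close>. Since \<open>c(A, B) < n\<close> unless
  \<open>A = B\<close>, its Gram matrix is \<open>\<delta>\<^sup>n\<close> times a matrix that is the identity at \<open>\<delta> = \<infinity>\<close>. So the form is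
  nondegenerate on the span \<open>J\<close> of the diagrams with at most \<open>l\<close> propagating lines, and the
  orthogonal projection \<open>e\<close> of 1 to \<open>J\<close> is a two-sided unit of \<open>J\<close>. Rescaling by
  \<open>\<delta>\<^bsup>-h\<^esup>\<close> keeps the Gram matrix integral and makes it unitriangular at \<open>\<delta> = \<infinity>\<close>, so \<open>e\<close> is an integral
  combination of the elements \<open>bar A\<close>, and \<open>1 - e\<close> is the splitting idempotent.

  Being unique, \<open>e\<close> is invariant under conjugation; as diagrams with the same spore are conjugate,
  \<open>- e\<close> is one of the elements \<open>X\<close> and solves the equation. Conversely every diagram in \<open>J\<close> has the
  form \<open>y u \<sigma>\<close>, so a conjugation invariant solution \<open>X\<close> satisfies \<open>z (- X) = z\<close> for all \<open>z\<close> in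
  \<open>J\<close>, which forces \<open>- X = e\<close>.
\<close>

text \<open>Two colours suffice because the empty colouring is compatible with every diagram:
  evaluating there isolates the power of 2, hence the number of loops.

  The obstacle is integrality. In the basis \<open>bar B\<close>, with row A divided by
  \<open>\<delta>^(n - h(A))\<close>, h counting northern arcs, the Gram entry is
  \<open>\<delta>^(-k)\<close> with k = n + h(B) - h(A) - c(A, B). That k is nonnegative comes from
  a count in each component, but k can vanish off the diagonal: for n = 2, A =
  \<open>u_diagram 2 1\<close> and B the identity, c = 1 and k = 0. This happens only if h(A) >
  h(B), which is why the system is triangular in h and not just a perturbation of the identity.
  Elimination stays inside the integral scalars because 1 plus a fraction of negative degree is a
  quotient of two monic polynomials of equal degree, hence a unit there.

  \<open>Sp\<close> is defined by choosing a filling, so different members of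
  \<open>spore_classes\<close> might a priori have representatives in one orbit; the coefficients of
  the solution are placed on one member for each orbit.\<close>

section \<open>Pair partitions as fixed-point-free involutions of the nodes\<close>

lemma pp_blockD:
  assumes "A \<in> pair_partitions n" "a \<in> A"
  shows "card a = 2" "a \<subseteq> nodes n"
  using assms by (auto simp: pair_partitions_def partition_on_def)

lemma pp_block_unique:
  assumes "A \<in> pair_partitions n" "a \<in> A" "b \<in> A" "x \<in> a" "x \<in> b"
  shows "a = b"
  using assms unfolding pair_partitions_def partition_on_def disjoint_def by blast

lemma pp_Union: "A \<in> pair_partitions n \<Longrightarrow> \<Union>A = nodes n"
  by (auto simp: pair_partitions_def partition_on_def)

text \<open>The fallback \<open>x\<close> makes this an involution of all nodes and not only of
  \<open>nodes n\<close>, so that cycle arguments can use \<open>partner_partner\<close> without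
  side conditions.\<close>

definition partner :: "diagram \<Rightarrow> node \<Rightarrow> node" where
  "partner A x = (if \<exists>y. {x, y} \<in> A then SOME y. {x, y} \<in> A else x)"

lemma partner_eqI:
  assumes A: "A \<in> pair_partitions n" and xy: "{x, y} \<in> A"
  shows "partner A x = y"
proof -
  have "{x, partner A x} \<in> A"
    using xy someI[of "\<lambda>y. {x, y} \<in> A" y] by (auto simp: partner_def)
  with pp_block_unique[OF A xy this, of x] have "{x, y} = {x, partner A x}" by simp
  moreover have "card {x, y} = 2" using pp_blockD[OF A xy] by simp
  ultimately show ?thesis by (auto simp: doubleton_eq_iff)
qed

lemma pp_block_eq:
  assumes A: "A \<in> pair_partitions n" and "a \<in> A" "x \<in> a"
  shows "a = {x, partner A x}"
proof -
  obtain y where "a = {x, y}"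
    using pp_blockD(1)[OF A \<open>a \<in> A\<close>] \<open>x \<in> a\<close> by (auto simp: card_2_iff)
  with partner_eqI[OF A, of x y] \<open>a \<in> A\<close> show ?thesis by simp
qed

lemma
  assumes A: "A \<in> pair_partitions n" and x: "x \<in> nodes n"
  shows partner_block: "{x, partner A x} \<in> A"
    and partner_nodes: "partner A x \<in> nodes n"
    and partner_neq: "partner A x \<noteq> x"
proof -
  obtain a where a: "a \<in> A" "x \<in> a" using pp_Union[OF A] x by auto
  show *: "{x, partner A x} \<in> A" using pp_block_eq[OF A a] a by simp
  show "partner A x \<in> nodes n" using pp_blockD(2)[OF A *] by simp
  show "partner A x \<noteq> x" using pp_blockD(1)[OF A *] by (auto simp: card_insert_if split: if_splits)
qed

lemma partner_outside:
  assumes A: "A \<in> pair_partitions n" and x: "x \<notin> nodes n"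
  shows "partner A x = x"
  using pp_blockD(2)[OF A] x by (auto simp: partner_def)

lemma partner_partner:
  assumes A: "A \<in> pair_partitions n"
  shows "partner A (partner A x) = x"
proof (cases "x \<in> nodes n")
  case True
  then show ?thesis using partner_block[OF A True] partner_eqI[OF A, of "partner A x" x]
    by (simp add: insert_commute)
qed (simp add: partner_outside[OF A])

lemma pp_blocks_eq:
  assumes A: "A \<in> pair_partitions n"
  shows "A = (\<lambda>x. {x, partner A x}) ` nodes n"
proof
  show "A \<subseteq> (\<lambda>x. {x, partner A x}) ` nodes n"
  proof
    fix a assume a: "a \<in> A"
    then obtain x where "x \<in> a" using pp_blockD(1)[OF A a] by fastforce
    then show "a \<in> (\<lambda>x. {x, partner A x}) ` nodes n"
      using pp_block_eq[OF A a] pp_blockD(2)[OF A a] by blast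
  qed
  show "(\<lambda>x. {x, partner A x}) ` nodes n \<subseteq> A" using partner_block[OF A] by auto
qed

text \<open>One inclusion is enough: every node lies in a pair of \<open>A\<close>, and a shared
  pair already determines the partners of its two nodes.\<close>

lemma pair_partitions_eqI:
  assumes A: "A \<in> pair_partitions n" and B: "B \<in> pair_partitions n" and "A \<subseteq> B"
  shows "A = B"
proof -
  have "partner A x = partner B x" if "x \<in> nodes n" for x
    using partner_eqI[OF B, of x "partner A x"] partner_block[OF A that] \<open>A \<subseteq> B\<close> by auto
  then show ?thesis by (subst pp_blocks_eq[OF A], subst pp_blocks_eq[OF B]) auto
qed

lemma finite_nodes [simp]: "finite (nodes n)"
  by (simp add: nodes_def)

lemma card_nodes: "card (nodes n) = 2 * n"
  unfolding nodes_def by (subst card_Un_disjoint) (auto simp: card_image inj_on_def)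

lemma finite_diagram: "A \<in> pair_partitions n \<Longrightarrow> finite A"
  using pp_Union[of A n] finite_UnionD[of A] by simp

lemma finite_pair_partitions [simp]: "finite (pair_partitions n)"
proof (rule finite_subset)
  show "pair_partitions n \<subseteq> Pow (Pow (nodes n))" using pp_blockD(2) by blast
qed simp

lemma card_diagram: assumes A: "A \<in> pair_partitions n" shows "card A = n"
proof -
  have "2 * card A = card (\<Union>A)"
    by (rule card_partition) (use A pp_block_unique[OF A] pp_blockD[OF A] finite_diagram[OF A]
        in \<open>auto simp: pp_Union[OF A]\<close>)
  then show ?thesis by (simp add: pp_Union[OF A] card_nodes)
qed

lemma nodes_iff [simp]: "Top i \<in> nodes n \<longleftrightarrow> i \<in> {1..n}" "Bot i \<in> nodes n \<longleftrightarrow> i \<in> {1..n}"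
  by (auto simp: nodes_def)

section \<open>Orbits of two involutions\<close>

text \<open>The length of the cycle of \<open>x\<close>. The value is meaningful wherever some
  positive power of \<open>r\<close> fixes \<open>x\<close>, as happens for an injective map of a
  finite set into itself.\<close>

definition period :: "('a \<Rightarrow> 'a) \<Rightarrow> 'a \<Rightarrow> nat" where
  "period r x = (LEAST m. 0 < m \<and> (r ^^ m) x = x)"

lemma funpow_closed: "(\<And>x. x \<in> V \<Longrightarrow> r x \<in> V) \<Longrightarrow> x \<in> V \<Longrightarrow> (r ^^ k) x \<in> V"
  by (induction k) auto

lemma funpow_diff_fixed:
  assumes "inj r" "a \<le> b" "(r ^^ a) x = (r ^^ b) x" shows "(r ^^ (b - a)) x = x"
proof -
  have "(r ^^ a) ((r ^^ (b - a)) x) = (r ^^ a) x"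
    using assms funpow_add[of a "b - a" r] by (metis le_add_diff_inverse comp_apply)
  then show ?thesis using inj_fn[OF \<open>inj r\<close>, of a] by (simp add: inj_eq)
qed

lemma
  assumes r: "inj r" and V: "finite V" "\<And>x. x \<in> V \<Longrightarrow> r x \<in> V" and x: "x \<in> V"
  shows period_pos: "0 < period r x" and funpow_period: "(r ^^ period r x) x = x"
proof -
  have "\<not> inj_on (\<lambda>k. (r ^^ k) x) UNIV"
  proof
    assume "inj_on (\<lambda>k. (r ^^ k) x) UNIV"
    moreover have "finite (range (\<lambda>k. (r ^^ k) x))"
      by (rule finite_subset[OF _ V(1)]) (use funpow_closed[of V r, OF V(2) x] in auto)
    ultimately show False using finite_imageD[of "\<lambda>k. (r ^^ k) x" UNIV] by simp
  qed
  then obtain a b where "a < b" "(r ^^ a) x = (r ^^ b) x"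
    by (auto simp: inj_on_def) (metis linorder_neq_iff)
  then have "0 < b - a \<and> (r ^^ (b - a)) x = x" using funpow_diff_fixed[OF r] by simp
  then have "0 < period r x \<and> (r ^^ period r x) x = x"
    unfolding period_def by (rule LeastI)
  then show "0 < period r x" "(r ^^ period r x) x = x" by auto
qed

lemma period_le: "0 < k \<Longrightarrow> (r ^^ k) x = x \<Longrightarrow> period r x \<le> k"
  unfolding period_def by (rule Least_le) simp

lemma funpow_neq_within_period:
  assumes "inj r" "a < b" "b < a + period r x" shows "(r ^^ a) x \<noteq> (r ^^ b) x"
proof
  assume "(r ^^ a) x = (r ^^ b) x"
  then have "(r ^^ (b - a)) x = x" using assms by (intro funpow_diff_fixed) auto
  then show False using period_le[of "b - a" r x] assms by auto
qed

lemma funpow_mod_period: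
  assumes "(r ^^ period r x) x = x" shows "(r ^^ (k mod period r x)) x = (r ^^ k) x"
  using assms by (rule funpow_mod_eq)

context
  fixes p q :: "'a \<Rightarrow> 'a"
  assumes p: "\<And>x. p (p x) = x" and q: "\<And>x. q (q x) = x"
begin

lemma inj_involutions: "inj (p \<circ> q)"
  by (rule injI) (metis comp_apply p q)

text \<open>The dihedral relation: conjugating the rotation \<open>p \<circ> q\<close> by
  \<open>q\<close> inverts it, so the rotations before and after \<open>q\<close> cancel.\<close>

lemma reflect_funpow: "((p \<circ> q) ^^ k) (q (((p \<circ> q) ^^ k) x)) = q x"
proof (induction k arbitrary: x)
  case (Suc k)
  have "((p \<circ> q) ^^ Suc k) (q (((p \<circ> q) ^^ Suc k) x))
      = (p \<circ> q) (((p \<circ> q) ^^ k) (q (((p \<circ> q) ^^ k) ((p \<circ> q) x))))"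
    by (simp add: funpow_swap1)
  also have "\<dots> = (p \<circ> q) (q ((p \<circ> q) x))" by (simp only: Suc.IH)
  also have "\<dots> = q x" by (simp add: p q)
  finally show ?case .
qed simp

text \<open>Since \<open>q\<close> fixes \<open>x\<close>, the cycle of \<open>x\<close> under the
  rotation already is its orbit under both involutions. With m the length of the cycle,
  \<open>q\<close> acts on exponents as k \<mapsto> m - k and \<open>p\<close> as k \<mapsto> m + 1
  - k, modulo m. For m > 1 these reflections have exactly two fixed exponents between them, so the
  orbit is a path with ends \<open>x\<close> and \<open>y\<close>.\<close>

lemma two_ends:
  assumes V: "finite V" "\<And>x. x \<in> V \<Longrightarrow> p x \<in> V" "\<And>x. x \<in> V \<Longrightarrow> q x \<in> V" and x: "x \<in> V"
    and qx: "q x = x" and px: "p x \<noteq> x"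
  defines "O' \<equiv> range (\<lambda>k. ((p \<circ> q) ^^ k) x)"
  shows "\<forall>y\<in>O'. p y \<in> O' \<and> q y \<in> O'"
    and "\<exists>y\<in>O'. y \<noteq> x \<and> (\<forall>z\<in>O'. p z = z \<or> q z = z \<longleftrightarrow> z = x \<or> z = y)"
proof -
  define r where "r = p \<circ> q"
  define m where "m = period r x"
  have inj: "inj r" unfolding r_def by (rule inj_involutions)
  have rV: "y \<in> V \<Longrightarrow> r y \<in> V" for y unfolding r_def using V by auto
  have m0: "0 < m" and rm: "(r ^^ m) x = x"
    unfolding m_def using period_pos[OF inj V(1) rV x] funpow_period[OF inj V(1) rV x] by auto
  have q_pow: "q ((r ^^ k) x) = (r ^^ (m - k)) x" if "k \<le> m" for k
  proof -
    have "(r ^^ k) (q ((r ^^ k) x)) = q x" unfolding r_def by (rule reflect_funpow)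
    also have "\<dots> = (r ^^ (k + (m - k))) x" using that rm qx by simp
    also have "\<dots> = (r ^^ k) ((r ^^ (m - k)) x)" by (simp only: funpow_add comp_apply)
    finally have "(r ^^ k) (q ((r ^^ k) x)) = (r ^^ k) ((r ^^ (m - k)) x)" .
    then show ?thesis using inj_fn[OF inj, of k] by (simp add: inj_eq)
  qed
  have p_pow: "p ((r ^^ k) x) = (r ^^ (m - k + 1)) x" if "1 \<le> k" "k \<le> m" for k
  proof -
    have "p ((r ^^ k) x) = q ((r ^^ (k - 1)) x)"
      using that p by (cases k) (auto simp: r_def)
    also have "\<dots> = (r ^^ (m - (k - 1))) x" using that by (intro q_pow) auto
    also have "m - (k - 1) = m - k + 1" using that by auto
    finally show ?thesis .
  qed
  \<comment> \<open>Exponents run from 1 to m, with \<open>x\<close> itself at m, because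
    \<open>p_pow\<close> refers to the exponent k - 1.\<close>
  have O_eq: "O' = (\<lambda>k. (r ^^ k) x) ` {1..m}"
  proof
    show "O' \<subseteq> (\<lambda>k. (r ^^ k) x) ` {1..m}"
    proof
      fix y assume "y \<in> O'"
      then obtain k where y: "y = (r ^^ (k mod m)) x"
        using funpow_mod_period[of r x] rm unfolding O'_def m_def r_def by auto
      show "y \<in> (\<lambda>k. (r ^^ k) x) ` {1..m}"
      proof (cases "k mod m = 0")
        case True then show ?thesis using y rm m0 by (intro image_eqI[of _ _ m]) auto
      next
        case False then show ?thesis using y m0 by (intro image_eqI[of _ _ "k mod m"]) (auto simp: less_imp_le)
      qed
    qed
  qed (auto simp: O'_def r_def)
  have distinct: "a = b" if "(r ^^ a) x = (r ^^ b) x" "a \<in> {1..m}" "b \<in> {1..m}" for a b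
    using that funpow_neq_within_period[OF inj, of a b x] funpow_neq_within_period[OF inj, of b a x]
    unfolding m_def[symmetric] by (cases a b rule: linorder_cases) auto
  have O_mem: "(r ^^ k) x \<in> O'" for k by (auto simp: O'_def r_def)
  show "\<forall>y\<in>O'. p y \<in> O' \<and> q y \<in> O'"
    using p_pow q_pow O_mem unfolding O_eq by (auto simp del: funpow.simps)
  have q_fix: "q ((r ^^ k) x) = (r ^^ k) x \<longleftrightarrow> k = m \<or> 2 * k = m" if "k \<in> {1..m}" for k
  proof (cases "k = m")
    case True then show ?thesis using rm qx by simp
  next
    case False
    then have "(r ^^ (m - k)) x = (r ^^ k) x \<longleftrightarrow> m - k = k"
      using distinct[of "m - k" k] that by auto
    then show ?thesis using q_pow[of k] that False by auto
  qed
  have p_fix: "p ((r ^^ k) x) = (r ^^ k) x \<longleftrightarrow> 2 * k = m + 1" if "k \<in> {1..m}" for k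
  proof -
    have "(r ^^ (m - k + 1)) x = (r ^^ k) x \<longleftrightarrow> m - k + 1 = k"
      using distinct[of "m - k + 1" k] that by (auto simp del: funpow.simps)
    moreover have "p ((r ^^ k) x) = (r ^^ (m - k + 1)) x" using p_pow[of k] that by simp
    ultimately show ?thesis using that by auto
  qed
  \<comment> \<open>The parity of m decides which involution fixes the far end, \<open>q\<close> for
    even m and \<open>p\<close> for odd m; both cases give (m + 1) div 2.\<close>
  have fixed: "p ((r ^^ k) x) = (r ^^ k) x \<or> q ((r ^^ k) x) = (r ^^ k) x \<longleftrightarrow> k = m \<or> k = (m + 1) div 2"
    if "k \<in> {1..m}" for k
    using p_fix[OF that] q_fix[OF that] by presburger
  have "m \<noteq> 1"
  proof
    assume "m = 1"
    then have "p (q x) = x" using rm by (simp add: r_def)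
    then show False using qx px by simp
  qed
  then have k: "(m + 1) div 2 \<in> {1..m}" "(m + 1) div 2 \<noteq> m" using m0 by auto
  let ?y = "(r ^^ ((m + 1) div 2)) x"
  have eq_x: "(r ^^ k) x = x \<longleftrightarrow> k = m" if "k \<in> {1..m}" for k
    using distinct[of k m] that rm m0 by auto
  have "?y \<noteq> x" using eq_x k by blast
  moreover have "\<forall>z\<in>O'. p z = z \<or> q z = z \<longleftrightarrow> z = x \<or> z = ?y"
  proof
    fix z assume "z \<in> O'"
    then obtain k' where k': "k' \<in> {1..m}" "z = (r ^^ k') x" unfolding O_eq by auto
    have "z = x \<longleftrightarrow> k' = m" using eq_x k' by auto
    moreover have "z = ?y \<longleftrightarrow> k' = (m + 1) div 2" using distinct[of k'] k k' by auto
    ultimately show "p z = z \<or> q z = z \<longleftrightarrow> z = x \<or> z = ?y" using fixed[OF k'(1)] k'(2) by simp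
  qed
  ultimately show "\<exists>y\<in>O'. y \<noteq> x \<and> (\<forall>z\<in>O'. p z = z \<or> q z = z \<longleftrightarrow> z = x \<or> z = y)"
    using O_mem by blast
qed

end

section \<open>Saturated sets\<close>

definition saturated :: "('a \<times> 'a) set \<Rightarrow> 'a set \<Rightarrow> bool" where
  "saturated r S \<longleftrightarrow> (\<forall>(x, y)\<in>r. x \<in> S \<longleftrightarrow> y \<in> S)"

text \<open>A saturated set is a union of classes. Classes meeting \<open>W\<close> are in or out
  according to \<open>W0\<close>, which is possible exactly if \<open>W0\<close> is consistent along
  \<open>r\<close>; each class disjoint from \<open>W\<close> is a free binary choice.\<close>

lemma card_saturated_extensions:
  assumes V: "finite V" and r: "equiv V r" and W: "W0 \<subseteq> W" "W \<subseteq> V"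
  shows "card {S. S \<subseteq> V \<and> saturated r S \<and> S \<inter> W = W0} =
    (if \<forall>(x, y)\<in>r. x \<in> W \<longrightarrow> y \<in> W \<longrightarrow> (x \<in> W0 \<longleftrightarrow> y \<in> W0) then 2 ^ card {C \<in> V // r. C \<inter> W = {}} else 0)"
proof (cases "\<forall>(x, y)\<in>r. x \<in> W \<longrightarrow> y \<in> W \<longrightarrow> (x \<in> W0 \<longleftrightarrow> y \<in> W0)")
  case False
  then have "{S. S \<subseteq> V \<and> saturated r S \<and> S \<inter> W = W0} = {}" unfolding saturated_def by blast
  then show ?thesis using False by (simp only: if_False) simp
next
  case True
  define F where "F = {C \<in> V // r. C \<inter> W = {}}"
  \<comment> \<open>The classes forced into the set; every solution is \<open>S0\<close> together
    with an arbitrary family of classes from \<open>F\<close>.\<close>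
  define S0 where "S0 = r `` W0"
  have sym: "(x, y) \<in> r \<Longrightarrow> (y, x) \<in> r" for x y using r by (meson equivE symD)
  have trans: "(x, y) \<in> r \<Longrightarrow> (y, z) \<in> r \<Longrightarrow> (x, z) \<in> r" for x y z using r by (meson equivE transD)
  have refl: "x \<in> V \<Longrightarrow> (x, x) \<in> r" for x using r by (meson equivE refl_onD)
  have rV: "(x, y) \<in> r \<Longrightarrow> x \<in> V \<and> y \<in> V" for x y using r equiv_type[OF r] by auto
  have FV: "\<Union>T \<subseteq> V" if "T \<subseteq> F" for T
    using that unfolding F_def by (auto simp: quotient_def dest: rV)
  have F_closed: "y \<in> \<Union>T" if t: "T \<subseteq> F" "(x, y) \<in> r" "x \<in> \<Union>T" for T x y
  proof -
    obtain C where C: "C \<in> T" "x \<in> C" using t(3) by blast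
    then obtain z where "C = r `` {z}" using t(1) unfolding F_def quotient_def by blast
    then have "y \<in> C" using C(2) t(2) trans by blast
    then show ?thesis using C(1) by blast
  qed
  have F_S0: "\<Union>T \<inter> S0 = {}" if "T \<subseteq> F" for T
  proof (rule ccontr)
    assume "\<Union>T \<inter> S0 \<noteq> {}"
    then obtain x w where "x \<in> \<Union>T" "w \<in> W0" "(w, x) \<in> r" by (auto simp: S0_def)
    then have "w \<in> \<Union>T" using F_closed[OF that sym] by blast
    then show False using \<open>w \<in> W0\<close> W that unfolding F_def by blast
  qed
  have S0W: "S0 \<inter> W = W0"
    using True W refl unfolding S0_def by blast
  have S0_closed: "y \<in> S0" if "(x, y) \<in> r" "x \<in> S0" for x y
    using that trans unfolding S0_def by blast
  have "bij_betw (\<lambda>T. S0 \<union> \<Union>T) (Pow F) {S. S \<subseteq> V \<and> saturated r S \<and> S \<inter> W = W0}"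
  proof (rule bij_betwI[where g = "\<lambda>S. {C \<in> F. C \<subseteq> S}"])
    show "(\<lambda>T. S0 \<union> \<Union>T) \<in> Pow F \<rightarrow> {S. S \<subseteq> V \<and> saturated r S \<and> S \<inter> W = W0}"
    proof (intro funcsetI CollectI conjI)
      fix T assume "T \<in> Pow F"
      then have T: "T \<subseteq> F" by simp
      show "S0 \<union> \<Union>T \<subseteq> V" using FV[OF T] rV unfolding S0_def by auto
      show "saturated r (S0 \<union> \<Union>T)"
        unfolding saturated_def using S0_closed F_closed[OF T] sym by blast
      show "(S0 \<union> \<Union>T) \<inter> W = W0" using S0W T unfolding F_def by blast
    qed
    show "(\<lambda>S. {C \<in> F. C \<subseteq> S}) \<in> {S. S \<subseteq> V \<and> saturated r S \<and> S \<inter> W = W0} \<rightarrow> Pow F" by auto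
    fix T assume "T \<in> Pow F"
    then have T: "T \<subseteq> F" by simp
    have "C \<in> T" if C: "C \<in> F" "C \<subseteq> S0 \<union> \<Union>T" for C
    proof -
      have "C \<noteq> {}" using C(1) r unfolding F_def by (auto dest: in_quotient_imp_non_empty)
      then obtain x where x: "x \<in> C" by blast
      then have "x \<notin> S0" using F_S0[of "{C}"] C(1) by auto
      then obtain D where D: "D \<in> T" "x \<in> D" using x C(2) by auto
      then have "C = D" using quotient_disj[OF r, of C D] C(1) T x unfolding F_def by blast
      then show ?thesis using D by simp
    qed
    then show "{C \<in> F. C \<subseteq> S0 \<union> \<Union>T} = T" using T by blast
  next
    fix S assume "S \<in> {S. S \<subseteq> V \<and> saturated r S \<and> S \<inter> W = W0}"
    then have S: "S \<subseteq> V" "saturated r S" "S \<inter> W = W0" by auto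
    have S_closed: "(x, y) \<in> r \<Longrightarrow> x \<in> S \<Longrightarrow> y \<in> S" for x y using S(2) unfolding saturated_def by blast
    have "S0 \<subseteq> S" using S(3) S_closed unfolding S0_def by blast
    moreover have "x \<in> S0 \<or> (\<exists>C\<in>F. C \<subseteq> S \<and> x \<in> C)" if "x \<in> S" for x
    proof (cases "r `` {x} \<inter> W = {}")
      case True
      then have "r `` {x} \<in> F" using that S(1) by (auto simp: F_def quotient_def)
      moreover have "r `` {x} \<subseteq> S" "x \<in> r `` {x}" using S_closed that S(1) refl by auto
      ultimately show ?thesis by blast
    next
      case False
      then obtain w where "w \<in> W" "(x, w) \<in> r" by auto
      then have "w \<in> W0" "(w, x) \<in> r" using S_closed[of x w] that S(3) sym by auto
      then show ?thesis unfolding S0_def by blast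
    qed
    ultimately show "S0 \<union> \<Union>{C \<in> F. C \<subseteq> S} = S" by blast
  qed
  then have "card {S. S \<subseteq> V \<and> saturated r S \<and> S \<inter> W = W0} = card (Pow F)"
    by (rule bij_betw_same_card[symmetric])
  also have "\<dots> = 2 ^ card F"
  proof (rule card_Pow)
    show "finite F" unfolding F_def using finite_quotient[OF V equiv_type[OF r]] by simp
  qed
  finally show ?thesis unfolding F_def if_P[OF True] .
qed

lemma saturated_rtrancl:
  "saturated (R\<^sup>*) S \<longleftrightarrow> saturated R S"
proof
  assume *: "saturated R S"
  have "x \<in> S \<longleftrightarrow> y \<in> S" if "(x, y) \<in> R\<^sup>*" for x y
    using that by (induction rule: rtrancl_induct) (use * in \<open>auto simp: saturated_def\<close>)
  then show "saturated (R\<^sup>*) S" unfolding saturated_def by blast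
qed (auto simp: saturated_def)

text \<open>\<open>R\<^sup>*\<close> relates every element to itself, also outside \<open>V\<close>,
  so it has to be cut down to \<open>V \<times> V\<close> to be an equivalence there. The classes of
  elements of \<open>V\<close> stay the same.\<close>

lemma
  assumes R: "R \<subseteq> V \<times> V" "sym R"
  shows equiv_components: "equiv V (R\<^sup>* \<inter> V \<times> V)"
    and quotient_components: "V // (R\<^sup>* \<inter> V \<times> V) = V // R\<^sup>*"
proof -
  have sym: "sym (R\<^sup>*)" using R(2) by (rule sym_rtrancl)
  show "equiv V (R\<^sup>* \<inter> V \<times> V)"
    by (rule equivI) (use sym in \<open>auto simp: refl_on_def sym_def trans_def intro: rtrancl_trans\<close>)
  have in_V: "y \<in> V" if "(x, y) \<in> R\<^sup>*" "x \<in> V" for x y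
    using that by (induction rule: rtrancl_induct) (use R(1) in auto)
  then show "V // (R\<^sup>* \<inter> V \<times> V) = V // R\<^sup>*" unfolding quotient_def by blast
qed

lemma saturated_components:
  assumes R: "R \<subseteq> V \<times> V"
  shows "saturated (R\<^sup>* \<inter> V \<times> V) S \<longleftrightarrow> saturated R S"
proof -
  have "saturated (R\<^sup>* \<inter> V \<times> V) S \<Longrightarrow> saturated R S"
    using R unfolding saturated_def by blast
  moreover have "saturated (R\<^sup>*) S \<Longrightarrow> saturated (R\<^sup>* \<inter> V \<times> V) S"
    unfolding saturated_def by blast
  ultimately show ?thesis using saturated_rtrancl[of R S] by blast
qed

section \<open>Composition of pair partitions\<close>

text \<open>The lower row is fixed because \<open>A\<close> has no nodes there, and
  \<open>lower_step\<close> fixes the upper row likewise. The outer nodes thus become the fixed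
  points of the two involutions, which is what \<open>two_ends\<close> detects.\<close>

fun upper_step :: "diagram \<Rightarrow> stack_node \<Rightarrow> stack_node" where
  "upper_step A (Upper i) = upper_embed (partner A (Top i))"
| "upper_step A (Middle i) = upper_embed (partner A (Bot i))"
| "upper_step A (Lower i) = Lower i"

fun lower_step :: "diagram \<Rightarrow> stack_node \<Rightarrow> stack_node" where
  "lower_step B (Upper i) = Upper i"
| "lower_step B (Middle i) = lower_embed (partner B (Top i))"
| "lower_step B (Lower i) = lower_embed (partner B (Bot i))"

lemma upper_step_embed [simp]: "upper_step A (upper_embed x) = upper_embed (partner A x)"
  by (cases x) auto

lemma lower_step_embed [simp]: "lower_step B (lower_embed x) = lower_embed (partner B x)"
  by (cases x) auto

lemma upper_embed_eq_iff [simp]: "upper_embed x = upper_embed y \<longleftrightarrow> x = y"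
  by (cases x; cases y) auto

lemma lower_embed_eq_iff [simp]: "lower_embed x = lower_embed y \<longleftrightarrow> x = y"
  by (cases x; cases y) auto

lemma outer_embed_eq_iff [simp]: "outer_embed x = outer_embed y \<longleftrightarrow> x = y"
  by (cases x; cases y) auto

lemma embed_in_stack_nodes [simp]:
  "upper_embed x \<in> stack_nodes n \<longleftrightarrow> x \<in> nodes n"
  "lower_embed x \<in> stack_nodes n \<longleftrightarrow> x \<in> nodes n"
  "outer_embed x \<in> stack_nodes n \<longleftrightarrow> x \<in> nodes n"
  by (cases x; auto simp: stack_nodes_def)+

lemma stack_nodes_iff [simp]:
  "Upper i \<in> stack_nodes n \<longleftrightarrow> i \<in> {1..n}"
  "Middle i \<in> stack_nodes n \<longleftrightarrow> i \<in> {1..n}"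
  "Lower i \<in> stack_nodes n \<longleftrightarrow> i \<in> {1..n}"
  by (auto simp: stack_nodes_def)

lemma finite_stack_nodes [simp]: "finite (stack_nodes n)"
  by (simp add: stack_nodes_def)

context
  fixes n :: nat and A B :: diagram
  assumes A: "A \<in> pair_partitions n" and B: "B \<in> pair_partitions n"
begin

lemma stack_steps_involutive:
  "upper_step A (upper_step A s) = s" "lower_step B (lower_step B s) = s"
  by (cases s; simp add: partner_partner[OF A] partner_partner[OF B])+

lemma stack_edge_iff:
  "(s, t) \<in> stack_edges A B \<longleftrightarrow>
    (\<exists>x\<in>nodes n. s = upper_embed x \<and> (t = s \<or> t = upper_step A s)) \<or>
    (\<exists>x\<in>nodes n. s = lower_embed x \<and> (t = s \<or> t = lower_step B s))"
proof -
  have *: "(\<exists>a\<in>D. x \<in> a \<and> y \<in> a) \<longleftrightarrow> x \<in> nodes n \<and> (y = x \<or> y = partner D x)"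
    if D: "D \<in> pair_partitions n" for D x y
  proof
    assume "\<exists>a\<in>D. x \<in> a \<and> y \<in> a"
    then obtain a where "a \<in> D" "x \<in> a" "y \<in> a" by blast
    then show "x \<in> nodes n \<and> (y = x \<or> y = partner D x)"
      using pp_block_eq[OF D, of a x] pp_blockD(2)[OF D, of a] by auto
  qed (use partner_block[OF D] in blast)
  have "(s, t) \<in> stack_edges A B \<longleftrightarrow>
    (\<exists>x y. s = upper_embed x \<and> t = upper_embed y \<and> x \<in> nodes n \<and> (y = x \<or> y = partner A x)) \<or>
    (\<exists>x y. s = lower_embed x \<and> t = lower_embed y \<and> x \<in> nodes n \<and> (y = x \<or> y = partner B x))"
    unfolding stack_edges_def by (simp add: *[OF A] *[OF B])
  then show ?thesis by auto
qed

lemma stack_edges_subset: "stack_edges A B \<subseteq> stack_nodes n \<times> stack_nodes n"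
  using partner_nodes[OF A] partner_nodes[OF B] by (auto simp: stack_edge_iff)

lemma sym_stack_edges: "sym (stack_edges A B)"
  unfolding sym_def stack_edges_def by blast

lemma upper_step_edge: "s \<in> stack_nodes n \<Longrightarrow> (s, upper_step A s) \<in> (stack_edges A B)\<^sup>*"
proof (cases s)
  case (Upper i)
  then show "s \<in> stack_nodes n \<Longrightarrow> ?thesis"
    by (intro r_into_rtrancl) (auto simp: stack_edge_iff intro!: bexI[of _ "Top i"])
next
  case (Middle i)
  then show "s \<in> stack_nodes n \<Longrightarrow> ?thesis"
    by (intro r_into_rtrancl) (auto simp: stack_edge_iff intro!: bexI[of _ "Bot i"])
qed simp

lemma lower_step_edge: "s \<in> stack_nodes n \<Longrightarrow> (s, lower_step B s) \<in> (stack_edges A B)\<^sup>*"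
proof (cases s)
  case (Lower i)
  then show "s \<in> stack_nodes n \<Longrightarrow> ?thesis"
    by (intro r_into_rtrancl) (auto simp: stack_edge_iff intro!: bexI[of _ "Bot i"])
next
  case (Middle i)
  then show "s \<in> stack_nodes n \<Longrightarrow> ?thesis"
    by (intro r_into_rtrancl) (auto simp: stack_edge_iff intro!: bexI[of _ "Top i"])
qed simp

lemma stack_steps_closed:
  assumes "s \<in> stack_nodes n"
  shows "upper_step A s \<in> stack_nodes n" "lower_step B s \<in> stack_nodes n"
  using assms partner_nodes[OF A] partner_nodes[OF B] by (cases s; simp)+

lemma stack_steps_fixed:
  assumes "s \<in> stack_nodes n"
  shows "upper_step A s = s \<longleftrightarrow> s \<in> range Lower" "lower_step B s = s \<longleftrightarrow> s \<in> range Upper"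
proof -
  have ne: "upper_embed (partner A x) \<noteq> upper_embed x" "lower_embed (partner B x) \<noteq> lower_embed x"
    if "x \<in> nodes n" for x
    using partner_neq[OF A that] partner_neq[OF B that] by auto
  show "upper_step A s = s \<longleftrightarrow> s \<in> range Lower"
  proof (cases s)
    case (Upper i) then show ?thesis using assms ne(1)[of "Top i"] by auto
  next
    case (Middle i) then show ?thesis using assms ne(1)[of "Bot i"] by auto
  qed auto
  show "lower_step B s = s \<longleftrightarrow> s \<in> range Upper"
  proof (cases s)
    case (Middle i) then show ?thesis using assms ne(2)[of "Top i"] by auto
  next
    case (Lower i) then show ?thesis using assms ne(2)[of "Bot i"] by auto
  qed auto
qed

text \<open>The orbit of an outer node under the two steps is closed under all edges, hence is its
  whole component; by \<open>two_ends\<close> it is a path, so it has exactly one other outer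
  node.\<close>

lemma component_two_ends:
  assumes s: "s \<in> stack_nodes n" "s \<notin> range Middle"
  shows "\<exists>t. t \<noteq> s \<and> {u \<in> (stack_edges A B)\<^sup>* `` {s}. u \<notin> range Middle} = {s, t}"
proof -
  let ?C = "(stack_edges A B)\<^sup>* `` {s}"
  have end_iff: "upper_step A u = u \<or> lower_step B u = u \<longleftrightarrow> u \<notin> range Middle" if "u \<in> stack_nodes n" for u
    using stack_steps_fixed[OF that] by (cases u) auto
  \<comment> \<open>The steps enter symmetrically: a start in the upper row is fixed by
    \<open>lower_step\<close>, one in the lower row by \<open>upper_step\<close>, and
    \<open>q\<close> stands for whichever fixes \<open>s\<close>.\<close>
  have ex: "\<exists>O'. s \<in> O' \<and> O' \<subseteq> ?C \<and> O' \<subseteq> stack_nodes n \<and> (\<forall>y\<in>O'. upper_step A y \<in> O' \<and> lower_step B y \<in> O') \<and>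
     (\<exists>t\<in>O'. t \<noteq> s \<and> (\<forall>u\<in>O'. upper_step A u = u \<or> lower_step B u = u \<longleftrightarrow> u = s \<or> u = t))"
    if pq: "(p = upper_step A \<and> q = lower_step B) \<or> (p = lower_step B \<and> q = upper_step A)"
      and "q s = s" "p s \<noteq> s" for p q
  proof -
    let ?O = "range (\<lambda>k. ((p \<circ> q) ^^ k) s)"
    have inv: "p (p x) = x" "q (q x) = x" for x using pq stack_steps_involutive by auto
    have cl: "x \<in> stack_nodes n \<Longrightarrow> p x \<in> stack_nodes n" "x \<in> stack_nodes n \<Longrightarrow> q x \<in> stack_nodes n" for x
      using pq stack_steps_closed by auto
    have edges: "(x, p x) \<in> (stack_edges A B)\<^sup>*" "(x, q x) \<in> (stack_edges A B)\<^sup>*"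
      if "x \<in> stack_nodes n" for x
      using pq upper_step_edge[OF that] lower_step_edge[OF that] by blast+
    note ends = two_ends[of p q, OF inv finite_stack_nodes cl s(1) \<open>q s = s\<close> \<open>p s \<noteq> s\<close>]
    have pow: "((p \<circ> q) ^^ k) s \<in> ?C \<and> ((p \<circ> q) ^^ k) s \<in> stack_nodes n" for k
    proof (induction k)
      case (Suc k)
      define y where "y = ((p \<circ> q) ^^ k) s"
      have y: "(s, y) \<in> (stack_edges A B)\<^sup>*" "y \<in> stack_nodes n" using Suc unfolding y_def by blast+
      have "(y, q y) \<in> (stack_edges A B)\<^sup>*" "(q y, p (q y)) \<in> (stack_edges A B)\<^sup>*"
        using edges cl y(2) by blast+
      then have "(s, p (q y)) \<in> (stack_edges A B)\<^sup>*" using y(1) by (meson rtrancl_trans)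
      moreover have eq: "((p \<circ> q) ^^ Suc k) s = p (q y)" by (simp add: y_def)
      ultimately show ?case unfolding eq using y(2) cl by blast
    qed (use s in simp)
    have "s \<in> ?O" by (rule range_eqI[of _ _ 0]) simp
    moreover have "\<forall>y\<in>?O. upper_step A y \<in> ?O \<and> lower_step B y \<in> ?O" using ends(1) pq by blast
    moreover have "\<exists>t\<in>?O. t \<noteq> s \<and> (\<forall>u\<in>?O. upper_step A u = u \<or> lower_step B u = u \<longleftrightarrow> u = s \<or> u = t)"
      using ends(2) pq by blast
    ultimately show ?thesis using pow by (intro exI[of _ ?O]) blast
  qed
  have "\<exists>O'. s \<in> O' \<and> O' \<subseteq> ?C \<and> O' \<subseteq> stack_nodes n \<and> (\<forall>y\<in>O'. upper_step A y \<in> O' \<and> lower_step B y \<in> O') \<and>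
     (\<exists>t\<in>O'. t \<noteq> s \<and> (\<forall>u\<in>O'. upper_step A u = u \<or> lower_step B u = u \<longleftrightarrow> u = s \<or> u = t))"
  proof (cases "s \<in> range Upper")
    case True
    then show ?thesis using ex[of "upper_step A" "lower_step B"] stack_steps_fixed[OF s(1)] by blast
  next
    case False
    then have "s \<in> range Lower" using s(2) by (cases s) auto
    then show ?thesis using ex[of "lower_step B" "upper_step A"] stack_steps_fixed[OF s(1)] False by blast
  qed
  then obtain O' t where O': "s \<in> O'" "O' \<subseteq> ?C" "O' \<subseteq> stack_nodes n"
    "\<And>y. y \<in> O' \<Longrightarrow> upper_step A y \<in> O' \<and> lower_step B y \<in> O'"
    and t: "t \<in> O'" "t \<noteq> s" "\<And>u. u \<in> O' \<Longrightarrow> upper_step A u = u \<or> lower_step B u = u \<longleftrightarrow> u = s \<or> u = t"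
    by blast
  have "u \<in> O'" if "(s, u) \<in> (stack_edges A B)\<^sup>*" for u
    using that by (induction rule: rtrancl_induct) (use O'(1,4) in \<open>auto simp: stack_edge_iff\<close>)
  then have C: "?C = O'" using O'(2) by auto
  have "u \<notin> range Middle \<longleftrightarrow> u = s \<or> u = t" if "u \<in> O'" for u
    using end_iff[of u] t(3)[OF that] O'(3) that by blast
  then have "{u \<in> ?C. u \<notin> range Middle} = {s, t}"
    unfolding C using t(1) O'(1) by blast
  then show ?thesis using t(2) by blast
qed

lemma equiv_stack: "equiv (stack_nodes n) ((stack_edges A B)\<^sup>* \<inter> stack_nodes n \<times> stack_nodes n)"
  by (rule equiv_components[OF stack_edges_subset sym_stack_edges])

lemma stack_components_eq:
  "stack_components n A B = stack_nodes n // ((stack_edges A B)\<^sup>* \<inter> stack_nodes n \<times> stack_nodes n)"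
  unfolding stack_components_def
  by (rule quotient_components[OF stack_edges_subset sym_stack_edges, symmetric])

text \<open>A component with a node outside the middle row is the class of that node, so the blocks
  can be indexed by outer nodes instead of elements of a quotient.\<close>

lemma compose_block_iff:
  "a \<in> compose n A B \<longleftrightarrow>
    (\<exists>x\<in>nodes n. a = {y. (outer_embed x, outer_embed y) \<in> (stack_edges A B)\<^sup>*})"
proof
  assume "a \<in> compose n A B"
  then obtain C where C: "C \<in> stack_components n A B" "\<not> C \<subseteq> range Middle" "a = outer_embed -` C"
    unfolding compose_def by blast
  then obtain s where s: "s \<in> C" "s \<notin> range Middle" by blast
  then obtain x where x: "s = outer_embed x" by (cases s) (auto intro: that[of "Top _"] that[of "Bot _"])
  have sub: "C \<subseteq> stack_nodes n" using C(1) in_quotient_imp_subset[OF equiv_stack] by (simp add: stack_components_eq)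
  then have "x \<in> nodes n" using s(1) x by auto
  moreover have "C = (stack_edges A B)\<^sup>* `` {s}"
  proof -
    obtain v where v: "v \<in> stack_nodes n" "C = (stack_edges A B)\<^sup>* `` {v}"
      using C(1) unfolding stack_components_def by (rule quotientE)
    then have "(v, s) \<in> (stack_edges A B)\<^sup>*" "(s, v) \<in> (stack_edges A B)\<^sup>*"
      using s(1) sym_rtrancl[OF sym_stack_edges] by (auto dest: symD)
    then show ?thesis using v(2) by (auto intro: rtrancl_trans)
  qed
  ultimately show "\<exists>x\<in>nodes n. a = {y. (outer_embed x, outer_embed y) \<in> (stack_edges A B)\<^sup>*}"
    using x C(3) by (intro bexI[of _ x]) auto
next
  assume "\<exists>x\<in>nodes n. a = {y. (outer_embed x, outer_embed y) \<in> (stack_edges A B)\<^sup>*}"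
  then obtain x where x: "x \<in> nodes n" "a = outer_embed -` ((stack_edges A B)\<^sup>* `` {outer_embed x})" by auto
  have "outer_embed x \<notin> range Middle" by (cases x) auto
  then have "\<not> (stack_edges A B)\<^sup>* `` {outer_embed x} \<subseteq> range Middle" by auto
  moreover have "(stack_edges A B)\<^sup>* `` {outer_embed x} \<in> stack_components n A B"
    unfolding stack_components_def by (rule quotientI) (use x in simp)
  ultimately show "a \<in> compose n A B" unfolding compose_def using x(2) by blast
qed

lemma compose_pair_partitions: "compose n A B \<in> pair_partitions n"
proof -
  let ?R = "(stack_edges A B)\<^sup>*"
  let ?blk = "\<lambda>x. {y. (outer_embed x, outer_embed y) \<in> ?R}"
  have compose_eq: "compose n A B = ?blk ` nodes n" using compose_block_iff by blast
  have sym: "(s, t) \<in> ?R \<Longrightarrow> (t, s) \<in> ?R" for s t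
    using sym_rtrancl[OF sym_stack_edges] by (auto dest: symD)
  have in_nodes: "t \<in> stack_nodes n" if "(s, t) \<in> ?R" "s \<in> stack_nodes n" for s t
    using that by (induction rule: rtrancl_induct) (use stack_edges_subset in auto)
  have blk_sub: "?blk x \<subseteq> nodes n" if "x \<in> nodes n" for x
    using in_nodes[of "outer_embed x" "outer_embed _"] that by auto
  have blk_card: "card (?blk x) = 2" if "x \<in> nodes n" for x
  proof -
    have nm: "outer_embed z \<notin> range Middle" for z by (cases z) auto
    have "outer_embed x \<in> stack_nodes n" using that by simp
    from component_two_ends[OF this nm] obtain t
      where t: "t \<noteq> outer_embed x" "{u \<in> ?R `` {outer_embed x}. u \<notin> range Middle} = {outer_embed x, t}"
      by blast
    then have "t \<notin> range Middle" by blast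
    then obtain y where y: "t = outer_embed y" by (cases t) (auto intro: that[of "Top _"] that[of "Bot _"])
    have "?blk x = {x, y}"
    proof -
      have "z \<in> ?blk x \<longleftrightarrow> outer_embed z \<in> {outer_embed x, t}" for z
        unfolding t(2)[symmetric] using nm by auto
      then show ?thesis unfolding y by auto
    qed
    then show ?thesis using t(1) y by auto
  qed
  have "partition_on (nodes n) (compose n A B)"
  proof (rule partition_onI)
    show "\<Union> (compose n A B) = nodes n" unfolding compose_eq using blk_sub by blast
    show "{} \<notin> compose n A B" unfolding compose_eq using blk_card by fastforce
    fix p q assume pq: "p \<in> compose n A B" "q \<in> compose n A B" "p \<noteq> q"
    then obtain x y where xy: "p = ?blk x" "q = ?blk y" unfolding compose_eq by blast
    show "disjnt p q"
    proof (rule ccontr)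
      assume "\<not> disjnt p q"
      then obtain z where "(outer_embed x, outer_embed z) \<in> ?R" "(outer_embed y, outer_embed z) \<in> ?R"
        unfolding disjnt_def xy by blast
      then have "(outer_embed x, outer_embed y) \<in> ?R" "(outer_embed y, outer_embed x) \<in> ?R"
        using sym by (meson rtrancl_trans)+
      then have "p = q" unfolding xy by (auto intro: rtrancl_trans)
      then show False using pq(3) by simp
    qed
  qed
  then show ?thesis unfolding pair_partitions_def using compose_eq blk_card by auto
qed

end

section \<open>Counting compatible colourings\<close>

text \<open>
  A set \<open>c\<close> of nodes is a 2-colouring. The 0-1 matrix \<open>compat_ind A\<close> is the action of \<open>A\<close> on
  \<open>V\<^sup>\<otimes>\<^sup>n\<close> with \<open>dim V = 2\<close>, so that composition of diagrams becomes matrix multiplication.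
\<close>

definition compat :: "diagram \<Rightarrow> node set \<Rightarrow> bool" where
  "compat A c \<longleftrightarrow> (\<forall>a\<in>A. \<forall>x\<in>a. \<forall>y\<in>a. x \<in> c \<longleftrightarrow> y \<in> c)"

definition colouring :: "nat set \<Rightarrow> nat set \<Rightarrow> node set" where
  "colouring f g = Top ` f \<union> Bot ` g"

definition compat_ind :: "diagram \<Rightarrow> nat set \<Rightarrow> nat set \<Rightarrow> nat" where
  "compat_ind A f g = of_bool (compat A (colouring f g))"

lemma colouring_iff [simp]:
  "Top i \<in> colouring f g \<longleftrightarrow> i \<in> f" "Bot i \<in> colouring f g \<longleftrightarrow> i \<in> g"
  by (auto simp: colouring_def)

text \<open>A colouring \<open>m\<close> compatible with both diagrams is the same as a saturated
  set in the stack whose trace on the outer nodes is given by \<open>f\<close> and \<open>g\<close>.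
  Components through outer nodes leave no choice, and every loop doubles the count.\<close>

lemma card_middle_colourings:
  assumes A: "A \<in> pair_partitions n" and B: "B \<in> pair_partitions n"
    and f: "f \<subseteq> {1..n}" and g: "g \<subseteq> {1..n}"
  shows "card {m. m \<subseteq> {1..n} \<and> compat A (colouring f m) \<and> compat B (colouring m g)} =
    2 ^ loops n A B * compat_ind (compose n A B) f g"
proof -
  define V where "V = stack_nodes n"
  define E where "E = stack_edges A B"
  define r where "r = E\<^sup>* \<inter> V \<times> V"
  define W where "W = outer_embed ` nodes n"
  define F where "F = outer_embed ` colouring f g"
  define S where "S m = F \<union> Middle ` m" for m
  define M where "M = {m. m \<subseteq> {1..n} \<and> compat A (colouring f m) \<and> compat B (colouring m g)}"
  define T where "T = {T. T \<subseteq> V \<and> saturated r T \<and> T \<inter> W = F}"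
  have equiv: "equiv V r" unfolding V_def r_def E_def by (rule equiv_stack[OF A B])
  have "colouring f g \<subseteq> nodes n" using f g by (auto simp: colouring_def nodes_def)
  then have FW: "F \<subseteq> W" unfolding F_def W_def by blast
  have W_V: "W \<subseteq> V" by (auto simp: W_def V_def)
  have W_middle: "W \<inter> range Middle = {}"
  proof -
    have "outer_embed x \<notin> range Middle" for x by (cases x) auto
    then show ?thesis unfolding W_def by blast
  qed
  have V_cover: "s \<in> W" if "s \<in> V" "s \<notin> range Middle" for s
  proof (cases s)
    case (Upper i) then show ?thesis using that by (auto simp: V_def W_def intro!: image_eqI[of _ _ "Top i"])
  next
    case (Lower i) then show ?thesis using that by (auto simp: V_def W_def intro!: image_eqI[of _ _ "Bot i"])
  qed (use that in auto)
  have F_iff: "outer_embed x \<in> F \<longleftrightarrow> x \<in> colouring f g" for x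
    unfolding F_def by (auto simp: image_iff)
  have emb: "upper_embed x \<in> S m \<longleftrightarrow> x \<in> colouring f m" "lower_embed x \<in> S m \<longleftrightarrow> x \<in> colouring m g" for x m
  proof -
    have "Upper i \<in> F \<longleftrightarrow> i \<in> f" "Lower i \<in> F \<longleftrightarrow> i \<in> g" "Middle i \<notin> F" for i
      using F_iff[of "Top i"] F_iff[of "Bot i"] FW W_middle by auto
    then show "upper_embed x \<in> S m \<longleftrightarrow> x \<in> colouring f m" "lower_embed x \<in> S m \<longleftrightarrow> x \<in> colouring m g"
      by (cases x; auto simp: S_def)+
  qed
  have sat: "saturated r (S m) \<longleftrightarrow> compat A (colouring f m) \<and> compat B (colouring m g)" for m
  proof -
    have "saturated r (S m) \<longleftrightarrow> saturated E (S m)"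
      unfolding r_def E_def V_def by (rule saturated_components[OF stack_edges_subset[OF A B]])
    also have "\<dots> \<longleftrightarrow> (\<forall>x y. (\<exists>a\<in>A. x \<in> a \<and> y \<in> a) \<longrightarrow> (upper_embed x \<in> S m \<longleftrightarrow> upper_embed y \<in> S m))
       \<and> (\<forall>x y. (\<exists>a\<in>B. x \<in> a \<and> y \<in> a) \<longrightarrow> (lower_embed x \<in> S m \<longleftrightarrow> lower_embed y \<in> S m))"
      unfolding saturated_def E_def stack_edges_def by blast
    also have "\<dots> \<longleftrightarrow> compat A (colouring f m) \<and> compat B (colouring m g)"
      unfolding emb compat_def by (intro arg_cong2[where f = "(\<and>)"]) blast+
    finally show ?thesis .
  qed
  have fibre: "S (Middle -` U) = U" if "U \<subseteq> V" "U \<inter> W = F" for U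
  proof
    show "S (Middle -` U) \<subseteq> U" unfolding S_def using that by blast
    show "U \<subseteq> S (Middle -` U)" unfolding S_def using that V_cover by blast
  qed
  have "bij_betw S M T"
  proof (rule bij_betwI[where g = "\<lambda>U. Middle -` U"])
    show "S \<in> M \<rightarrow> T"
    proof
      fix m assume m: "m \<in> M"
      have "S m \<subseteq> V" using m FW W_V unfolding S_def M_def by (auto simp: V_def)
      moreover have "S m \<inter> W = F" using FW W_middle unfolding S_def by blast
      ultimately show "S m \<in> T" using m sat unfolding T_def M_def by blast
    qed
    show "S (Middle -` U) = U" if "U \<in> T" for U
      using that fibre unfolding T_def by blast
    show "(\<lambda>U. Middle -` U) \<in> T \<rightarrow> M"
    proof
      fix U assume U: "U \<in> T"
      have "S (Middle -` U) = U" using U fibre unfolding T_def by blast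
      then have "saturated r (S (Middle -` U))" using U unfolding T_def by simp
      moreover have "Middle -` U \<subseteq> {1..n}" using U unfolding T_def V_def by auto
      ultimately show "Middle -` U \<in> M" using sat unfolding M_def by blast
    qed
    show "Middle -` S m = m" for m
      using FW W_middle unfolding S_def by auto
  qed
  then have "card M = card T" by (rule bij_betw_same_card)
  also have "\<dots> = (if \<forall>(x, y)\<in>r. x \<in> W \<longrightarrow> y \<in> W \<longrightarrow> (x \<in> F \<longleftrightarrow> y \<in> F)
      then 2 ^ card {C \<in> V // r. C \<inter> W = {}} else 0)"
    unfolding T_def by (rule card_saturated_extensions[OF _ equiv FW W_V]) (simp add: V_def)
  \<comment> \<open>Both sides say that the prescribed colours are constant on the outer nodes of
    every component.\<close>
  also have "(\<forall>(x, y)\<in>r. x \<in> W \<longrightarrow> y \<in> W \<longrightarrow> (x \<in> F \<longleftrightarrow> y \<in> F)) \<longleftrightarrow>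
      compat (compose n A B) (colouring f g)" (is "?L \<longleftrightarrow> ?R")
  proof
    assume L: ?L
    have L': "s \<in> F \<longleftrightarrow> t \<in> F" if "(s, t) \<in> r" "s \<in> W" "t \<in> W" for s t
      using bspec[OF L that(1)] that(2,3) by simp
    show ?R unfolding compat_def
    proof (intro ballI)
      fix a x y assume a: "a \<in> compose n A B" "x \<in> a" "y \<in> a"
      then obtain z where z: "z \<in> nodes n" "a = {y. (outer_embed z, outer_embed y) \<in> E\<^sup>*}"
        using compose_block_iff[OF A B] unfolding E_def by blast
      have "x \<in> nodes n" "y \<in> nodes n"
        using a pp_blockD(2)[OF compose_pair_partitions[OF A B]] by blast+
      then have "outer_embed v \<in> W" "outer_embed v \<in> V" if "v \<in> {x, y, z}" for v
        using that z(1) unfolding W_def V_def by auto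
      then have "(outer_embed z, outer_embed x) \<in> r" "(outer_embed z, outer_embed y) \<in> r"
        using z(2) a(2,3) unfolding r_def by auto
      then have "outer_embed z \<in> F \<longleftrightarrow> outer_embed x \<in> F" "outer_embed z \<in> F \<longleftrightarrow> outer_embed y \<in> F"
        using L'[of "outer_embed z" "outer_embed x"] L'[of "outer_embed z" "outer_embed y"]
          \<open>\<And>v. v \<in> {x, y, z} \<Longrightarrow> outer_embed v \<in> W\<close> by simp_all
      then have "outer_embed x \<in> F \<longleftrightarrow> outer_embed y \<in> F" by simp
      then show "x \<in> colouring f g \<longleftrightarrow> y \<in> colouring f g" unfolding F_iff .
    qed
  next
    assume R: ?R
    have outer: "outer_embed x \<in> F \<longleftrightarrow> outer_embed y \<in> F"
      if "x \<in> nodes n" "(outer_embed x, outer_embed y) \<in> E\<^sup>*" for x y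
    proof -
      have blk: "{y. (outer_embed x, outer_embed y) \<in> E\<^sup>*} \<in> compose n A B"
        by (intro iffD2[OF compose_block_iff[OF A B]] bexI[OF _ that(1)]) (simp add: E_def)
      then have "x \<in> colouring f g \<longleftrightarrow> y \<in> colouring f g"
        using R[unfolded compat_def, rule_format, OF blk, of x y] that(2) by simp
      then show ?thesis unfolding F_iff .
    qed
    have "s \<in> F \<longleftrightarrow> t \<in> F" if st: "(s, t) \<in> r" "s \<in> W" "t \<in> W" for s t
    proof -
      obtain x where x: "x \<in> nodes n" "s = outer_embed x" using st(2) unfolding W_def by blast
      obtain y where y: "t = outer_embed y" using st(3) unfolding W_def by blast
      have "(outer_embed x, outer_embed y) \<in> E\<^sup>*" using st(1) x y unfolding r_def by simp
      from outer[OF x(1) this] show ?thesis unfolding x(2) y .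
    qed
    then show ?L by auto
  qed
  also have "{C \<in> V // r. C \<inter> W = {}} = {C \<in> stack_components n A B. C \<subseteq> range Middle}"
  proof -
    have "C \<inter> W = {} \<longleftrightarrow> C \<subseteq> range Middle" if "C \<subseteq> V" for C
      using that V_cover W_middle by blast
    moreover have "stack_components n A B = V // r"
      unfolding V_def r_def E_def by (rule stack_components_eq[OF A B])
    ultimately show ?thesis using in_quotient_imp_subset[OF equiv] by auto
  qed
  finally show ?thesis unfolding M_def by (simp add: loops_def compat_ind_def)
qed

lemma compat_ind_compose:
  assumes "A \<in> pair_partitions n" "B \<in> pair_partitions n" "f \<subseteq> {1..n}" "g \<subseteq> {1..n}"
  shows "(\<Sum>m\<in>Pow {1..n}. compat_ind A f m * compat_ind B m g) =
    2 ^ loops n A B * compat_ind (compose n A B) f g"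
proof -
  have "(\<Sum>m\<in>Pow {1..n}. compat_ind A f m * compat_ind B m g) =
      (\<Sum>m\<in>Pow {1..n}. of_bool (compat A (colouring f m) \<and> compat B (colouring m g)))"
    by (intro sum.cong) (auto simp: compat_ind_def)
  also have "\<dots> = card {m. m \<subseteq> {1..n} \<and> compat A (colouring f m) \<and> compat B (colouring m g)}"
    by (simp add: sum_of_bool_eq Int_def)
  finally show ?thesis using card_middle_colourings[OF assms] by simp
qed

lemma compat_ind_empty [simp]: "compat_ind A {} {} = 1"
  by (simp add: compat_ind_def compat_def colouring_def)

text \<open>The empty colouring compares the powers of 2. A pair of \<open>B\<close>, taken as a
  colouring, is compatible with \<open>B\<close>; being compatible with \<open>A\<close> as well, it
  contains the \<open>A\<close>-partner of each of its nodes.\<close>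

lemma compat_ind_scaled_eq:
  assumes A: "A \<in> pair_partitions n" and B: "B \<in> pair_partitions n"
    and eq: "\<And>f g. f \<subseteq> {1..n} \<Longrightarrow> g \<subseteq> {1..n} \<Longrightarrow> 2 ^ a * compat_ind A f g = 2 ^ b * compat_ind B f g"
  shows "a = b \<and> A = B"
proof -
  have ab: "a = b" using eq[of "{}" "{}"] by simp
  have "compat A c \<longleftrightarrow> compat B c" if "c \<subseteq> nodes n" for c
  proof -
    have c: "c = colouring (Top -` c) (Bot -` c)"
    proof -
      have "x \<in> c \<longleftrightarrow> x \<in> colouring (Top -` c) (Bot -` c)" for x by (cases x) auto
      then show ?thesis by blast
    qed
    have "compat_ind A (Top -` c) (Bot -` c) = compat_ind B (Top -` c) (Bot -` c)"
      using eq[of "Top -` c" "Bot -` c"] that ab by (auto simp: nodes_def)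
    then show ?thesis unfolding compat_ind_def c[symmetric] by (simp add: of_bool_def split: if_splits)
  qed
  have "A \<subseteq> B"
  proof
    fix a assume "a \<in> A"
    then obtain x where x: "x \<in> nodes n" "a = {x, partner A x}" by (subst (asm) pp_blocks_eq[OF A]) auto
    let ?b = "{x, partner B x}"
    have b: "?b \<in> B" "?b \<subseteq> nodes n" using partner_block[OF B x(1)] pp_blockD(2)[OF B] by auto
    have "compat B ?b" unfolding compat_def
    proof (intro ballI)
      fix b' y z assume "b' \<in> B" "y \<in> b'" "z \<in> b'"
      then show "y \<in> ?b \<longleftrightarrow> z \<in> ?b" using pp_block_unique[OF B b(1), of b'] by blast
    qed
    then have "compat A ?b" using \<open>\<And>c. c \<subseteq> nodes n \<Longrightarrow> compat A c \<longleftrightarrow> compat B c\<close> b(2) by blast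
    then have "x \<in> ?b \<longleftrightarrow> partner A x \<in> ?b"
      unfolding compat_def using \<open>a \<in> A\<close> unfolding x(2) by (metis insertI1 insertCI)
    then have "partner A x \<in> ?b" by simp
    then have "partner A x = partner B x" using partner_neq[OF A x(1)] by simp
    then show "a \<in> B" using b(1) x(2) by simp
  qed
  then show ?thesis using ab pair_partitions_eqI[OF A B] by simp
qed

text \<open>From here on composites are computed through their matrices: it suffices to guess
  \<open>D\<close> and \<open>k\<close> and to verify the matrix product.\<close>

lemma compose_eqI:
  assumes "A \<in> pair_partitions n" "B \<in> pair_partitions n" "D \<in> pair_partitions n"
    and "\<And>f g. f \<subseteq> {1..n} \<Longrightarrow> g \<subseteq> {1..n} \<Longrightarrow>
      (\<Sum>m\<in>Pow {1..n}. compat_ind A f m * compat_ind B m g) = 2 ^ k * compat_ind D f g"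
  shows "compose n A B = D" "loops n A B = k"
  using compat_ind_scaled_eq[OF compose_pair_partitions[OF assms(1,2)] assms(3), of "loops n A B" k]
    compat_ind_compose[OF assms(1,2)] assms(4) by auto

text \<open>Both identities are read off from one triple matrix product, evaluated with the two
  bracketings.\<close>

lemma
  assumes A: "A \<in> pair_partitions n" and B: "B \<in> pair_partitions n" and C: "C \<in> pair_partitions n"
  shows compose_assoc: "compose n (compose n A B) C = compose n A (compose n B C)"
    and loops_assoc: "loops n A B + loops n (compose n A B) C = loops n B C + loops n A (compose n B C)"
proof -
  let ?P = "Pow {1..n}"
  note AB = compose_pair_partitions[OF A B] and BC = compose_pair_partitions[OF B C]
  have eq: "2 ^ (loops n A B + loops n (compose n A B) C) * compat_ind (compose n (compose n A B) C) f g =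
      2 ^ (loops n B C + loops n A (compose n B C)) * compat_ind (compose n A (compose n B C)) f g"
    if f: "f \<subseteq> {1..n}" and g: "g \<subseteq> {1..n}" for f g
  proof -
    have "2 ^ (loops n A B + loops n (compose n A B) C) * compat_ind (compose n (compose n A B) C) f g =
        2 ^ loops n A B * (\<Sum>k\<in>?P. compat_ind (compose n A B) f k * compat_ind C k g)"
      by (simp only: compat_ind_compose[OF AB C f g] power_add mult.assoc)
    also have "\<dots> = (\<Sum>k\<in>?P. (2 ^ loops n A B * compat_ind (compose n A B) f k) * compat_ind C k g)"
      by (simp only: sum_distrib_left mult.assoc)
    also have "\<dots> = (\<Sum>k\<in>?P. (\<Sum>m\<in>?P. compat_ind A f m * compat_ind B m k) * compat_ind C k g)"
      by (intro sum.cong refl) (simp only: compat_ind_compose[OF A B f] Pow_iff)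
    also have "\<dots> = (\<Sum>m\<in>?P. \<Sum>k\<in>?P. compat_ind A f m * compat_ind B m k * compat_ind C k g)"
      unfolding sum_distrib_right by (rule sum.swap)
    also have "\<dots> = (\<Sum>m\<in>?P. compat_ind A f m * (2 ^ loops n B C * compat_ind (compose n B C) m g))"
      by (intro sum.cong refl)
        (simp only: sum_distrib_left mult.assoc compat_ind_compose[OF B C _ g, symmetric] Pow_iff)
    also have "\<dots> = 2 ^ loops n B C * (\<Sum>m\<in>?P. compat_ind A f m * compat_ind (compose n B C) m g)"
      by (simp only: sum_distrib_left mult.assoc mult.left_commute)
    also have "\<dots> = 2 ^ (loops n B C + loops n A (compose n B C)) * compat_ind (compose n A (compose n B C)) f g"
      by (simp only: compat_ind_compose[OF A BC f g] power_add mult.assoc)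
    finally show ?thesis .
  qed
  show "compose n (compose n A B) C = compose n A (compose n B C)"
    "loops n A B + loops n (compose n A B) C = loops n B C + loops n A (compose n B C)"
    using compat_ind_scaled_eq[OF compose_pair_partitions[OF AB C] compose_pair_partitions[OF A BC] eq] by auto
qed

section \<open>The Brauer algebra is a ring\<close>

abbreviation (input) pp :: "nat \<Rightarrow> diagram set" where "pp \<equiv> pair_partitions"

lemma lookup_scale [simp]: "Poly_Mapping.lookup (scale c x) A = c * Poly_Mapping.lookup x A"
  unfolding scale_def by (cases "Poly_Mapping.lookup x A = 0") (simp_all add: Poly_Mapping.map.rep_eq when_def)

lemma lookup_basis [simp]: "Poly_Mapping.lookup (basis_elem A) B = of_bool (A = B)"
  by (simp add: basis_elem_def lookup_single when_def)

lemma scale_simps [simp]: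
  "scale c 0 = 0" "scale 0 x = 0" "scale 1 x = x" "scale a (scale b x) = scale (a * b) x"
  "scale c (- x) = - scale c x" "scale (- c) x = - scale c x"
  by (auto intro!: poly_mapping_eqI simp: mult.assoc)

lemma scale_add_right: "scale c (x + y) = scale c x + scale c y"
  and scale_add_left: "scale (a + b) x = scale a x + scale b x"
  by (auto intro!: poly_mapping_eqI simp: lookup_add lookup_minus algebra_simps)

lemma scale_sum_right: "scale c (sum f S) = (\<Sum>i\<in>S. scale c (f i))"
  by (induction S rule: infinite_finite_induct) (auto simp: scale_add_right)

lemma keys_scale: "Poly_Mapping.keys (scale c x) \<subseteq> Poly_Mapping.keys x"
  by (auto simp: in_keys_iff)

lemma keys_basis [simp]: "Poly_Mapping.keys (basis_elem A) = {A}"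
  by (simp add: basis_elem_def)

lemma lookup_eq_0: "Poly_Mapping.keys x \<subseteq> S \<Longrightarrow> A \<notin> S \<Longrightarrow> Poly_Mapping.lookup x A = 0"
  by (auto simp: in_keys_iff)

lemma basis_expansion:
  assumes "finite S" "Poly_Mapping.keys x \<subseteq> S"
  shows "x = (\<Sum>A\<in>S. scale (Poly_Mapping.lookup x A) (basis_elem A))"
proof (rule poly_mapping_eqI)
  fix B
  have "Poly_Mapping.lookup (\<Sum>A\<in>S. scale (Poly_Mapping.lookup x A) (basis_elem A)) B =
      (\<Sum>A\<in>S. if A = B then Poly_Mapping.lookup x B else 0)"
    unfolding lookup_sum by (intro sum.cong) auto
  also have "\<dots> = Poly_Mapping.lookup x B"
    using assms lookup_eq_0[of x S B] by (simp add: sum.delta)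
  finally show "Poly_Mapping.lookup x B =
      Poly_Mapping.lookup (\<Sum>A\<in>S. scale (Poly_Mapping.lookup x A) (basis_elem A)) B" by simp
qed

text \<open>Cancellation can make the support of a sum smaller than the union of the supports, so
  bilinearity needs the product written over larger finite sets, where the extra terms
  vanish.\<close>

lemma brauer_mult_superset:
  assumes "finite S" "Poly_Mapping.keys x \<subseteq> S" "finite T" "Poly_Mapping.keys y \<subseteq> T"
  shows "brauer_mult n x y = (\<Sum>A\<in>S. \<Sum>B\<in>T.
      scale (Poly_Mapping.lookup x A * Poly_Mapping.lookup y B * delta ^ loops n A B)
        (basis_elem (compose n A B)))"
proof -
  have "brauer_mult n x y = (\<Sum>A\<in>Poly_Mapping.keys x. \<Sum>B\<in>T.
      scale (Poly_Mapping.lookup x A * Poly_Mapping.lookup y B * delta ^ loops n A B)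
        (basis_elem (compose n A B)))"
    unfolding brauer_mult_def
    by (intro sum.cong refl sum.mono_neutral_left) (use assms in \<open>auto simp: in_keys_iff\<close>)
  also have "\<dots> = (\<Sum>A\<in>S. \<Sum>B\<in>T.
      scale (Poly_Mapping.lookup x A * Poly_Mapping.lookup y B * delta ^ loops n A B)
        (basis_elem (compose n A B)))"
    by (intro sum.mono_neutral_left) (use assms in \<open>auto simp: in_keys_iff\<close>)
  finally show ?thesis .
qed

lemma brauer_mult_add_left: "brauer_mult n (x + y) z = brauer_mult n x z + brauer_mult n y z"
proof -
  let ?S = "Poly_Mapping.keys x \<union> Poly_Mapping.keys y"
  have "Poly_Mapping.keys (x + y) \<subseteq> ?S" by (rule Poly_Mapping.keys_add)
  then show ?thesis
    by (simp add: brauer_mult_superset[of ?S _ "Poly_Mapping.keys z"] lookup_add distrib_right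
        scale_add_left sum.distrib)
qed

lemma brauer_mult_add_right: "brauer_mult n z (x + y) = brauer_mult n z x + brauer_mult n z y"
proof -
  let ?S = "Poly_Mapping.keys x \<union> Poly_Mapping.keys y"
  have "Poly_Mapping.keys (x + y) \<subseteq> ?S" by (rule Poly_Mapping.keys_add)
  then show ?thesis
    by (simp add: brauer_mult_superset[of "Poly_Mapping.keys z" _ ?S] lookup_add distrib_left distrib_right
        scale_add_left sum.distrib)
qed

lemma brauer_mult_scale_left: "brauer_mult n (scale c x) y = scale c (brauer_mult n x y)"
  by (simp add: brauer_mult_superset[of "Poly_Mapping.keys x" _ "Poly_Mapping.keys y"] keys_scale
      scale_sum_right mult.assoc)

lemma brauer_mult_scale_right: "brauer_mult n x (scale c y) = scale c (brauer_mult n x y)"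
  by (simp add: brauer_mult_superset[of "Poly_Mapping.keys x" _ "Poly_Mapping.keys y"] keys_scale
      scale_sum_right mult.assoc mult.left_commute)

lemma brauer_mult_zero [simp]: "brauer_mult n 0 x = 0" "brauer_mult n x 0 = 0"
  by (simp_all add: brauer_mult_def)

lemma brauer_mult_minus: "brauer_mult n (- x) y = - brauer_mult n x y" "brauer_mult n x (- y) = - brauer_mult n x y"
  using brauer_mult_scale_left[of n "- 1" x y] brauer_mult_scale_right[of n x "- 1" y] by simp_all

lemma brauer_mult_basis:
  "brauer_mult n (basis_elem A) (basis_elem B) = scale (delta ^ loops n A B) (basis_elem (compose n A B))"
  by (simp add: brauer_mult_def)

definition span_of :: "diagram set \<Rightarrow> brauer_elem set" where
  "span_of S = {x. Poly_Mapping.keys x \<subseteq> S}"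

lemma span_of_zero [simp]: "0 \<in> span_of S"
  and span_of_basis [simp]: "basis_elem A \<in> span_of S \<longleftrightarrow> A \<in> S"
  and span_of_add: "x \<in> span_of S \<Longrightarrow> y \<in> span_of S \<Longrightarrow> x + y \<in> span_of S"
  and span_of_scale: "x \<in> span_of S \<Longrightarrow> scale c x \<in> span_of S"
  and span_of_minus: "x \<in> span_of S \<Longrightarrow> - x \<in> span_of S"
  and span_of_mono: "x \<in> span_of S \<Longrightarrow> S \<subseteq> T \<Longrightarrow> x \<in> span_of T"
  using Poly_Mapping.keys_add[of x y] keys_scale[of c x] by (auto simp: span_of_def)

lemma span_of_diff: "x \<in> span_of S \<Longrightarrow> y \<in> span_of S \<Longrightarrow> x - y \<in> span_of S"
  using span_of_add[of x S "- y"] span_of_minus by simp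

lemma span_of_sum: "(\<And>i. i \<in> I \<Longrightarrow> f i \<in> span_of S) \<Longrightarrow> sum f I \<in> span_of S"
  by (induction I rule: infinite_finite_induct) (auto intro: span_of_add)

lemma span_of_induct [consumes 1, case_names basis zero add scale]:
  assumes x: "x \<in> span_of S"
    and basis: "\<And>A. A \<in> S \<Longrightarrow> P (basis_elem A)" and zero: "P 0"
    and add: "\<And>x y. P x \<Longrightarrow> P y \<Longrightarrow> P (x + y)" and scale: "\<And>c x. P x \<Longrightarrow> P (scale c x)"
  shows "P x"
proof -
  have P_sum: "P (sum f T)" if "\<And>i. i \<in> T \<Longrightarrow> P (f i)" for f :: "diagram \<Rightarrow> brauer_elem" and T
    using that by (induction T rule: infinite_finite_induct) (auto intro: zero add)
  have "P (\<Sum>A\<in>Poly_Mapping.keys x. scale (Poly_Mapping.lookup x A) (basis_elem A))"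
    by (rule P_sum) (use x in \<open>auto intro!: scale basis simp: span_of_def\<close>)
  then show ?thesis using basis_expansion[of "Poly_Mapping.keys x" x] by simp
qed

lemma brauer_mult_span:
  assumes "x \<in> span_of S" "y \<in> span_of T" "\<And>A B. A \<in> S \<Longrightarrow> B \<in> T \<Longrightarrow> compose n A B \<in> U"
  shows "brauer_mult n x y \<in> span_of U"
  using assms(1)
proof (induction x rule: span_of_induct)
  case (basis A)
  show ?case using assms(2)
  proof (induction y rule: span_of_induct)
    case (basis B)
    then show ?case using assms(3) \<open>A \<in> S\<close> by (simp add: brauer_mult_basis span_of_scale)
  qed (simp_all add: brauer_mult_add_right brauer_mult_scale_right span_of_add span_of_scale)
qed (simp_all add: brauer_mult_add_left brauer_mult_scale_left span_of_add span_of_scale)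

lemma brauer_mult_closed:
  "x \<in> span_of (pp n) \<Longrightarrow> y \<in> span_of (pp n) \<Longrightarrow> brauer_mult n x y \<in> span_of (pp n)"
  using brauer_mult_span compose_pair_partitions by blast

lemma brauer_mult_assoc:
  assumes "x \<in> span_of (pp n)" "y \<in> span_of (pp n)" "z \<in> span_of (pp n)"
  shows "brauer_mult n (brauer_mult n x y) z = brauer_mult n x (brauer_mult n y z)"
  using assms(1)
proof (induction x rule: span_of_induct)
  case (basis A)
  show ?case using assms(2)
  proof (induction y rule: span_of_induct)
    case (basis B)
    show ?case using assms(3)
    proof (induction z rule: span_of_induct)
      case (basis C)
      note ABC = \<open>A \<in> pp n\<close> \<open>B \<in> pp n\<close> \<open>C \<in> pp n\<close>
      show ?case
        by (simp add: brauer_mult_basis brauer_mult_scale_left brauer_mult_scale_right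
            compose_assoc[OF ABC] power_add[symmetric] loops_assoc[OF ABC])
    qed (simp_all add: brauer_mult_add_right brauer_mult_scale_right)
  qed (simp_all add: brauer_mult_add_left brauer_mult_scale_left brauer_mult_add_right brauer_mult_scale_right)
qed (simp_all add: brauer_mult_add_left brauer_mult_scale_left)

subsection \<open>Permuting the rows of a diagram\<close>

fun relabel_top :: "(nat \<Rightarrow> nat) \<Rightarrow> node \<Rightarrow> node" where
  "relabel_top \<sigma> (Top i) = Top (\<sigma> i)"
| "relabel_top \<sigma> (Bot i) = Bot i"

fun relabel_bot :: "(nat \<Rightarrow> nat) \<Rightarrow> node \<Rightarrow> node" where
  "relabel_bot \<sigma> (Top i) = Top i"
| "relabel_bot \<sigma> (Bot i) = Bot (\<sigma> i)"

text \<open>The map need not respect rows: besides row permutations it is used with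
  \<open>opp\<close> and with transpositions of a top and a bottom node.\<close>

definition map_diagram :: "(node \<Rightarrow> node) \<Rightarrow> diagram \<Rightarrow> diagram" where
  "map_diagram \<pi> A = (\<lambda>a. \<pi> ` a) ` A"

lemma map_diagram_pp:
  assumes A: "A \<in> pp n" and \<pi>: "bij_betw \<pi> (nodes n) (nodes n)"
  shows "map_diagram \<pi> A \<in> pp n"
proof -
  have sub: "\<And>a. a \<in> A \<Longrightarrow> a \<subseteq> nodes n" using pp_blockD(2)[OF A] .
  have inj: "inj_on \<pi> (nodes n)" and img: "\<pi> ` nodes n = nodes n" using \<pi> by (auto simp: bij_betw_def)
  have "partition_on (nodes n) (map_diagram \<pi> A)"
  proof (rule partition_onI)
    show "\<Union> (map_diagram \<pi> A) = nodes n"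
      using pp_Union[OF A] img by (simp add: map_diagram_def image_UN[symmetric] flip: image_Union)
    show "{} \<notin> map_diagram \<pi> A" using pp_blockD(1)[OF A] by (fastforce simp: map_diagram_def)
    fix p q assume "p \<in> map_diagram \<pi> A" "q \<in> map_diagram \<pi> A" "p \<noteq> q"
    then obtain a b where ab: "a \<in> A" "b \<in> A" "p = \<pi> ` a" "q = \<pi> ` b" "a \<noteq> b" by (auto simp: map_diagram_def)
    then have "a \<inter> b = {}" using pp_block_unique[OF A] by blast
    then show "disjnt p q"
      using ab sub inj unfolding disjnt_def by (metis inj_on_image_Int image_empty)
  qed
  moreover have "card (\<pi> ` a) = 2" if "a \<in> A" for a
    using pp_blockD[OF A that] inj by (metis card_image inj_on_subset)
  ultimately show ?thesis by (auto simp: pair_partitions_def map_diagram_def)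
qed

lemma compat_map_diagram: "compat (map_diagram \<pi> A) c \<longleftrightarrow> compat A (\<pi> -` c)"
  by (auto simp: compat_def map_diagram_def)

lemma bij_relabel_top: "\<sigma> permutes {1..n} \<Longrightarrow> bij_betw (relabel_top \<sigma>) (nodes n) (nodes n)"
proof (rule bij_betwI[where g = "relabel_top (Hilbert_Choice.inv \<sigma>)"])
  assume \<sigma>: "\<sigma> permutes {1..n}"
  note p = permutes_in_image[OF \<sigma>] permutes_in_image[OF permutes_inv[OF \<sigma>]]
  show "relabel_top \<sigma> \<in> nodes n \<rightarrow> nodes n" "relabel_top (Hilbert_Choice.inv \<sigma>) \<in> nodes n \<rightarrow> nodes n"
    using p by (auto simp: nodes_def)
  show "relabel_top (Hilbert_Choice.inv \<sigma>) (relabel_top \<sigma> x) = x" "relabel_top \<sigma> (relabel_top (Hilbert_Choice.inv \<sigma>) x) = x" for x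
    using permutes_inverses[OF \<sigma>] by (cases x; simp)+
qed

lemma bij_relabel_bot: "\<sigma> permutes {1..n} \<Longrightarrow> bij_betw (relabel_bot \<sigma>) (nodes n) (nodes n)"
proof (rule bij_betwI[where g = "relabel_bot (Hilbert_Choice.inv \<sigma>)"])
  assume \<sigma>: "\<sigma> permutes {1..n}"
  note p = permutes_in_image[OF \<sigma>] permutes_in_image[OF permutes_inv[OF \<sigma>]]
  show "relabel_bot \<sigma> \<in> nodes n \<rightarrow> nodes n" "relabel_bot (Hilbert_Choice.inv \<sigma>) \<in> nodes n \<rightarrow> nodes n"
    using p by (auto simp: nodes_def)
  show "relabel_bot (Hilbert_Choice.inv \<sigma>) (relabel_bot \<sigma> x) = x" "relabel_bot \<sigma> (relabel_bot (Hilbert_Choice.inv \<sigma>) x) = x" for x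
    using permutes_inverses[OF \<sigma>] by (cases x; simp)+
qed

lemma id_diagram_image: "id_diagram n = (\<lambda>i. {Top i, Bot i}) ` {1..n}"
  by (auto simp: id_diagram_def)

lemma id_diagram_pp: "id_diagram n \<in> pp n"
proof -
  have "partition_on (nodes n) (id_diagram n)"
    by (rule partition_onI) (auto simp: id_diagram_image nodes_def disjnt_def)
  then show ?thesis by (auto simp: pair_partitions_def id_diagram_image)
qed

text \<open>The lines run from \<open>Bot i\<close> up to \<open>Top (\<sigma> i)\<close>; with this
  orientation stacking is composition of permutations, in the same order.\<close>

definition perm_diagram :: "nat \<Rightarrow> (nat \<Rightarrow> nat) \<Rightarrow> diagram" where
  "perm_diagram n \<sigma> = map_diagram (relabel_top \<sigma>) (id_diagram n)"

lemma perm_diagram_eq: "perm_diagram n \<sigma> = (\<lambda>i. {Top (\<sigma> i), Bot i}) ` {1..n}"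
  by (simp add: perm_diagram_def map_diagram_def id_diagram_image image_image)

lemma perm_diagram_id: "perm_diagram n id = id_diagram n"
  by (simp add: perm_diagram_eq id_diagram_image)

lemma perm_diagram_pp: "\<sigma> permutes {1..n} \<Longrightarrow> perm_diagram n \<sigma> \<in> pp n"
  unfolding perm_diagram_def by (intro map_diagram_pp id_diagram_pp bij_relabel_top)

text \<open>A permutation diagram acts on colour sets by a permutation matrix, so that a single
  \<open>m\<close> contributes to the matrix products below.\<close>

lemma compat_perm_diagram:
  assumes \<sigma>: "\<sigma> permutes {1..n}" and "f \<subseteq> {1..n}" "g \<subseteq> {1..n}"
  shows "compat (perm_diagram n \<sigma>) (colouring f g) \<longleftrightarrow> f = \<sigma> ` g"
proof -
  have "compat (perm_diagram n \<sigma>) (colouring f g) \<longleftrightarrow> (\<forall>i\<in>{1..n}. \<sigma> i \<in> f \<longleftrightarrow> i \<in> g)"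
    by (auto simp: compat_def perm_diagram_eq)
  also have "\<dots> \<longleftrightarrow> f = \<sigma> ` g"
  proof
    assume *: "\<forall>i\<in>{1..n}. \<sigma> i \<in> f \<longleftrightarrow> i \<in> g"
    show "f = \<sigma> ` g"
    proof
      show "\<sigma> ` g \<subseteq> f" using * assms(3) by blast
      show "f \<subseteq> \<sigma> ` g"
      proof
        fix j assume j: "j \<in> f"
        then have "j \<in> \<sigma> ` {1..n}" using assms(2) permutes_image[OF \<sigma>] by blast
        then show "j \<in> \<sigma> ` g" using * j by blast
      qed
    qed
  next
    assume "f = \<sigma> ` g"
    then show "\<forall>i\<in>{1..n}. \<sigma> i \<in> f \<longleftrightarrow> i \<in> g" using permutes_inj[OF \<sigma>] by (auto simp: inj_image_mem_iff)
  qed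
  finally show ?thesis .
qed

lemma
  assumes \<sigma>: "\<sigma> permutes {1..n}" and A: "A \<in> pp n"
  shows compose_perm_left: "compose n (perm_diagram n \<sigma>) A = map_diagram (relabel_top \<sigma>) A"
    and loops_perm_left: "loops n (perm_diagram n \<sigma>) A = 0"
proof -
  have "(\<Sum>m\<in>Pow {1..n}. compat_ind (perm_diagram n \<sigma>) f m * compat_ind A m g) =
      2 ^ 0 * compat_ind (map_diagram (relabel_top \<sigma>) A) f g"
    if f: "f \<subseteq> {1..n}" and g: "g \<subseteq> {1..n}" for f g
  proof -
    have sub: "\<sigma> -` f \<subseteq> {1..n}" using f permutes_in_image[OF \<sigma>] by auto
    have "compat (perm_diagram n \<sigma>) (colouring f m) \<longleftrightarrow> m = \<sigma> -` f" if "m \<subseteq> {1..n}" for m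
      unfolding compat_perm_diagram[OF \<sigma> f that]
      using permutes_inj[OF \<sigma>] permutes_surj[OF \<sigma>] by (metis inj_vimage_image_eq surj_image_vimage_eq)
    then have "(\<Sum>m\<in>Pow {1..n}. compat_ind (perm_diagram n \<sigma>) f m * compat_ind A m g) =
        (\<Sum>m\<in>Pow {1..n}. if m = \<sigma> -` f then compat_ind A m g else 0)"
      by (intro sum.cong) (auto simp: compat_ind_def)
    also have "\<dots> = compat_ind A (\<sigma> -` f) g" using sub by simp
    also have "relabel_top \<sigma> -` colouring f g = colouring (\<sigma> -` f) g"
    proof -
      have "x \<in> relabel_top \<sigma> -` colouring f g \<longleftrightarrow> x \<in> colouring (\<sigma> -` f) g" for x by (cases x) auto
      then show ?thesis by blast
    qed
    then have "compat_ind A (\<sigma> -` f) g = compat_ind (map_diagram (relabel_top \<sigma>) A) f g"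
      by (simp add: compat_ind_def compat_map_diagram)
    finally show ?thesis by simp
  qed
  from compose_eqI[OF perm_diagram_pp[OF \<sigma>] A map_diagram_pp[OF A bij_relabel_top[OF \<sigma>]] this]
  show "compose n (perm_diagram n \<sigma>) A = map_diagram (relabel_top \<sigma>) A" "loops n (perm_diagram n \<sigma>) A = 0"
    by auto
qed

text \<open>The node \<open>Bot i\<close> of \<open>A\<close> is glued to \<open>Top i\<close> and
  continues to the bottom node with the label \<open>inv \<sigma> i\<close>; hence the
  inverse.\<close>

lemma
  assumes \<sigma>: "\<sigma> permutes {1..n}" and A: "A \<in> pp n"
  shows compose_perm_right: "compose n A (perm_diagram n \<sigma>) = map_diagram (relabel_bot (Hilbert_Choice.inv \<sigma>)) A"
    and loops_perm_right: "loops n A (perm_diagram n \<sigma>) = 0"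
proof -
  note \<sigma>' = permutes_inv[OF \<sigma>]
  have "(\<Sum>m\<in>Pow {1..n}. compat_ind A f m * compat_ind (perm_diagram n \<sigma>) m g) =
      2 ^ 0 * compat_ind (map_diagram (relabel_bot (Hilbert_Choice.inv \<sigma>)) A) f g"
    if f: "f \<subseteq> {1..n}" and g: "g \<subseteq> {1..n}" for f g
  proof -
    have sub: "\<sigma> ` g \<subseteq> {1..n}" using g permutes_in_image[OF \<sigma>] by auto
    have "(\<Sum>m\<in>Pow {1..n}. compat_ind A f m * compat_ind (perm_diagram n \<sigma>) m g) =
        (\<Sum>m\<in>Pow {1..n}. if m = \<sigma> ` g then compat_ind A f m else 0)"
      using compat_perm_diagram[OF \<sigma> _ g] by (intro sum.cong) (auto simp: compat_ind_def)
    also have "\<dots> = compat_ind A f (\<sigma> ` g)" using sub by simp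
    also have "relabel_bot (Hilbert_Choice.inv \<sigma>) -` colouring f g = colouring f (\<sigma> ` g)"
    proof -
      have "Hilbert_Choice.inv \<sigma> i \<in> g \<longleftrightarrow> i \<in> \<sigma> ` g" for i
        using permutes_inverses[OF \<sigma>] by (metis imageE imageI)
      then have "x \<in> relabel_bot (Hilbert_Choice.inv \<sigma>) -` colouring f g \<longleftrightarrow> x \<in> colouring f (\<sigma> ` g)" for x
        by (cases x) auto
      then show ?thesis by blast
    qed
    then have "compat_ind A f (\<sigma> ` g) = compat_ind (map_diagram (relabel_bot (Hilbert_Choice.inv \<sigma>)) A) f g"
      by (simp add: compat_ind_def compat_map_diagram)
    finally show ?thesis by simp
  qed
  from compose_eqI[OF A perm_diagram_pp[OF \<sigma>] map_diagram_pp[OF A bij_relabel_bot[OF \<sigma>']] this]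
  show "compose n A (perm_diagram n \<sigma>) = map_diagram (relabel_bot (Hilbert_Choice.inv \<sigma>)) A" "loops n A (perm_diagram n \<sigma>) = 0"
    by auto
qed

lemma map_diagram_comp: "map_diagram \<pi> (map_diagram \<rho> A) = map_diagram (\<pi> \<circ> \<rho>) A"
  by (auto simp: map_diagram_def image_comp image_image comp_def)

lemma map_diagram_id: "map_diagram id A = A"
  by (simp add: map_diagram_def)

abbreviation perm_elem :: "nat \<Rightarrow> (nat \<Rightarrow> nat) \<Rightarrow> brauer_elem" where
  "perm_elem n \<sigma> \<equiv> basis_elem (perm_diagram n \<sigma>)"

lemma
  assumes "\<sigma> permutes {1..n}" "A \<in> pp n"
  shows perm_elem_mult_left: "brauer_mult n (perm_elem n \<sigma>) (basis_elem A) = basis_elem (map_diagram (relabel_top \<sigma>) A)"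
    and perm_elem_mult_right: "brauer_mult n (basis_elem A) (perm_elem n \<sigma>) = basis_elem (map_diagram (relabel_bot (Hilbert_Choice.inv \<sigma>)) A)"
  by (simp_all add: brauer_mult_basis compose_perm_left[OF assms] loops_perm_left[OF assms]
      compose_perm_right[OF assms] loops_perm_right[OF assms])

lemma perm_elem_mult:
  assumes "\<sigma> permutes {1..n}" "\<tau> permutes {1..n}"
  shows "brauer_mult n (perm_elem n \<sigma>) (perm_elem n \<tau>) = perm_elem n (\<sigma> \<circ> \<tau>)"
proof -
  have "map_diagram (relabel_top \<sigma>) (perm_diagram n \<tau>) = perm_diagram n (\<sigma> \<circ> \<tau>)"
    by (auto simp: perm_diagram_eq map_diagram_def image_image)
  then show ?thesis using perm_elem_mult_left[OF assms(1) perm_diagram_pp[OF assms(2)]] by simp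
qed

lemma perm_conj_basis:
  assumes \<sigma>: "\<sigma> permutes {1..n}" and A: "A \<in> pp n"
  shows "brauer_mult n (brauer_mult n (perm_elem n \<sigma>) (basis_elem A)) (perm_elem n (Hilbert_Choice.inv \<sigma>)) =
    basis_elem (map_diagram (relabel \<sigma>) A)"
proof -
  have "relabel_bot \<sigma> (relabel_top \<sigma> x) = relabel \<sigma> x" for x by (cases x) auto
  then have "relabel_bot \<sigma> \<circ> relabel_top \<sigma> = relabel \<sigma>" by auto
  then show ?thesis
    by (simp add: perm_elem_mult_left[OF assms]
      perm_elem_mult_right[OF permutes_inv[OF \<sigma>] map_diagram_pp[OF A bij_relabel_top[OF \<sigma>]]]
      permutes_inv_inv[OF \<sigma>] map_diagram_comp)
qed

subsection \<open>Ring structure\<close>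

lemma brauer_mult_one:
  assumes "x \<in> span_of (pp n)"
  shows "brauer_mult n (basis_elem (id_diagram n)) x = x" "brauer_mult n x (basis_elem (id_diagram n)) = x"
proof -
  have rel: "relabel_top id = id" "relabel_bot id = id"
    by (rule ext, case_tac x, auto)+
  have "brauer_mult n (perm_elem n id) x = x \<and> brauer_mult n x (perm_elem n id) = x"
    using assms
  proof (induction x rule: span_of_induct)
    case (basis A)
    then show ?case
      using perm_elem_mult_left[OF permutes_id, of A n] perm_elem_mult_right[OF permutes_id, of A n]
      by (simp add: rel map_diagram_id flip: id_def)
  qed (simp_all add: brauer_mult_add_left brauer_mult_scale_left brauer_mult_add_right brauer_mult_scale_right)
  then show "brauer_mult n (basis_elem (id_diagram n)) x = x" "brauer_mult n x (basis_elem (id_diagram n)) = x"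
    by (simp_all add: perm_diagram_id)
qed

lemma carrier_brauer: "carrier (brauer n) = span_of (pp n)"
  by (simp add: brauer_def span_of_def)

lemma brauer_simps [simp]:
  "x \<otimes>\<^bsub>brauer n\<^esub> y = brauer_mult n x y" "\<one>\<^bsub>brauer n\<^esub> = basis_elem (id_diagram n)"
  "\<zero>\<^bsub>brauer n\<^esub> = 0" "x \<oplus>\<^bsub>brauer n\<^esub> y = x + y"
  by (simp_all add: brauer_def)

lemma ring_brauer: "ring (brauer n)"
proof (rule ringI)
  show "abelian_group (brauer n)"
    by (rule abelian_groupI)
      (auto simp: carrier_brauer span_of_add add.assoc add.commute intro: span_of_minus bexI[of _ "- _"])
  show "monoid (brauer n)"
    by (rule monoidI)
      (auto simp: carrier_brauer brauer_mult_closed brauer_mult_assoc brauer_mult_one id_diagram_pp)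
qed (auto simp: carrier_brauer brauer_mult_add_left brauer_mult_add_right)

section \<open>Cups and caps\<close>

text \<open>The conjugates of \<open>u_diagram\<close>, needed because the arcs of a general diagram
  do not join neighbours.\<close>

definition cup_diagram :: "nat \<Rightarrow> nat \<Rightarrow> nat \<Rightarrow> diagram" where
  "cup_diagram n i j = (id_diagram n - {{Top i, Bot i}, {Top j, Bot j}})
      \<union> {{Top i, Top j}, {Bot i, Bot j}}"

lemma cup_diagram_image:
  "cup_diagram n i j = (\<lambda>k. {Top k, Bot k}) ` ({1..n} - {i, j}) \<union> {{Top i, Top j}, {Bot i, Bot j}}"
proof -
  have "inj (\<lambda>k. {Top k, Bot k})" by (auto intro!: injI simp: doubleton_eq_iff)
  from image_set_diff[OF this, of "{1..n}" "{i, j}"] show ?thesis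
    by (simp add: cup_diagram_def id_diagram_image)
qed

lemma compat_Un: "compat (A \<union> B) c \<longleftrightarrow> compat A c \<and> compat B c"
  unfolding compat_def by blast

lemma compat_insert_pair:
  "compat (insert {x, y} A) c \<longleftrightarrow> (x \<in> c \<longleftrightarrow> y \<in> c) \<and> compat A c"
  unfolding compat_def by simp blast

lemma compat_empty [simp]: "compat {} c"
  by (simp add: compat_def)

lemma compat_image_pairs:
  "compat ((\<lambda>k. {x k, y k}) ` S) c \<longleftrightarrow> (\<forall>k\<in>S. x k \<in> c \<longleftrightarrow> y k \<in> c)"
  unfolding compat_def by simp blast

lemma u_diagram_eq: "u_diagram n i = cup_diagram n i (i + 1)"
  by (simp add: u_diagram_def cup_diagram_def)

lemma cup_diagram_pp:
  assumes "i \<in> {1..n}" "j \<in> {1..n}" "i \<noteq> j"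
  shows "cup_diagram n i j \<in> pp n"
proof -
  have "partition_on (nodes n) (cup_diagram n i j)"
  proof (rule partition_onI)
    show "\<Union> (cup_diagram n i j) = nodes n"
      using assms by (auto simp: cup_diagram_image nodes_def)
  qed (use assms in \<open>auto simp: cup_diagram_image disjnt_def\<close>)
  then show ?thesis using assms by (auto simp: pair_partitions_def cup_diagram_image)
qed

lemma agree_off_iff:
  "f \<subseteq> U \<Longrightarrow> g \<subseteq> U \<Longrightarrow> (\<forall>k\<in>U - X. k \<in> f \<longleftrightarrow> k \<in> g) \<longleftrightarrow> f - X = g - X"
  unfolding set_eq_iff by (simp add: subset_iff) blast

lemma compat_cup_diagram:
  assumes "i \<in> {1..n}" "j \<in> {1..n}" "i \<noteq> j" "f \<subseteq> {1..n}" "g \<subseteq> {1..n}"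
  shows "compat (cup_diagram n i j) (colouring f g) \<longleftrightarrow>
    (i \<in> f \<longleftrightarrow> j \<in> f) \<and> (i \<in> g \<longleftrightarrow> j \<in> g) \<and> f - {i, j} = g - {i, j}"
proof -
  have "compat (cup_diagram n i j) (colouring f g) \<longleftrightarrow>
      (i \<in> f \<longleftrightarrow> j \<in> f) \<and> (i \<in> g \<longleftrightarrow> j \<in> g) \<and> (\<forall>k\<in>{1..n} - {i, j}. k \<in> f \<longleftrightarrow> k \<in> g)"
    unfolding cup_diagram_image by (simp add: compat_Un compat_insert_pair compat_image_pairs conj_ac)
  moreover have "(\<forall>k\<in>{1..n} - {i, j}. k \<in> f \<longleftrightarrow> k \<in> g) \<longleftrightarrow> f - {i, j} = g - {i, j}"
    by (rule agree_off_iff[OF assms(4,5)])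
  ultimately show ?thesis by simp
qed

lemma compat_block:
  assumes "compat A c" "{x, y} \<in> A" shows "x \<in> c \<longleftrightarrow> y \<in> c"
  using assms(1)[unfolded compat_def, rule_format, OF assms(2), of x y] by simp

lemma compat_iff_partner:
  assumes A: "A \<in> pp n"
  shows "compat A c \<longleftrightarrow> (\<forall>x\<in>nodes n. x \<in> c \<longleftrightarrow> partner A x \<in> c)"
  by (subst pp_blocks_eq[OF A]) (auto simp: compat_def)

lemma pp_doubleton_neq: "A \<in> pp n \<Longrightarrow> {x, y} \<in> A \<Longrightarrow> x \<noteq> y"
  using pp_blockD(1)[of A n "{x, y}"] by auto

text \<open>The southern arc of \<open>A\<close> and the northern arc of the cup diagram close up to
  one loop, and the southern arc of the cup diagram takes the place of the lost one. All other
  strands pass straight through.\<close>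

lemma
  assumes A: "A \<in> pp n" and ij: "{Bot i, Bot j} \<in> A"
  shows compose_cup_absorb: "compose n A (cup_diagram n i j) = A"
    and loops_cup_absorb: "loops n A (cup_diagram n i j) = 1"
proof -
  have i: "i \<in> {1..n}" "j \<in> {1..n}" "i \<noteq> j"
    using pp_blockD(2)[OF A ij] pp_doubleton_neq[OF A ij] by auto
  have pi: "partner A (Bot i) = Bot j" "partner A (Bot j) = Bot i"
    using partner_eqI[OF A] ij by (simp_all add: insert_commute)
  have "(\<Sum>m\<in>Pow {1..n}. compat_ind A f m * compat_ind (cup_diagram n i j) m g) = 2 ^ 1 * compat_ind A f g"
    if f: "f \<subseteq> {1..n}" and g: "g \<subseteq> {1..n}" for f g
  proof -
    have indep: "compat A (colouring f m) \<longleftrightarrow> compat A (colouring f m')"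
      if "i \<in> m \<longleftrightarrow> j \<in> m" "i \<in> m' \<longleftrightarrow> j \<in> m'" "m - {i, j} = m' - {i, j}" for m m'
    proof -
      have m: "k \<in> m \<longleftrightarrow> k \<in> m'" if "k \<noteq> i" "k \<noteq> j" for k
        using that \<open>m - {i, j} = m' - {i, j}\<close> by blast
      have "(x \<in> colouring f m \<longleftrightarrow> partner A x \<in> colouring f m) \<longleftrightarrow>
          (x \<in> colouring f m' \<longleftrightarrow> partner A x \<in> colouring f m')" for x
      proof (cases "x = Bot i \<or> x = Bot j")
        case True
        then show ?thesis using that(1,2) by (auto simp: pi)
      next
        case False
        then have "partner A x \<noteq> Bot i \<and> partner A x \<noteq> Bot j"
          using partner_partner[OF A, of x] pi by metis
        moreover have "y \<in> colouring f m \<longleftrightarrow> y \<in> colouring f m'" if "y \<noteq> Bot i" "y \<noteq> Bot j" for y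
          using that m by (cases y) auto
        ultimately show ?thesis using False by blast
      qed
      then show ?thesis unfolding compat_iff_partner[OF A] by blast
    qed
    \<comment> \<open>The closed loop carries either colour; elsewhere the middle row copies the
      bottom row \<open>g\<close>.\<close>
    define g0 g1 where "g0 = g - {i, j}" and "g1 = g \<union> {i, j}"
    have g01: "g0 \<subseteq> {1..n}" "g1 \<subseteq> {1..n}" "g0 \<noteq> g1" using g i unfolding g0_def g1_def by auto
    have "compat_ind A f m * compat_ind (cup_diagram n i j) m g =
        (if m = g0 then compat_ind A f g else 0) + (if m = g1 then compat_ind A f g else 0)"
      if m: "m \<subseteq> {1..n}" for m
    proof (cases "i \<in> g \<longleftrightarrow> j \<in> g")
      case True
      have "compat (cup_diagram n i j) (colouring m g) \<longleftrightarrow> m = g0 \<or> m = g1"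
        unfolding compat_cup_diagram[OF i m g] g0_def g1_def using True by blast
      moreover have "compat A (colouring f m) \<longleftrightarrow> compat A (colouring f g)" if "m = g0 \<or> m = g1"
        by (rule indep) (use that True in \<open>auto simp: g0_def g1_def\<close>)
      ultimately show ?thesis using g01(3) by (auto simp: compat_ind_def)
    next
      case False
      then have "\<not> compat (cup_diagram n i j) (colouring m g)" unfolding compat_cup_diagram[OF i m g] by simp
      moreover have "\<not> compat A (colouring f g)" using compat_block[OF _ ij] False by fastforce
      ultimately show ?thesis by (simp add: compat_ind_def)
    qed
    then have "(\<Sum>m\<in>Pow {1..n}. compat_ind A f m * compat_ind (cup_diagram n i j) m g) =
        (\<Sum>m\<in>Pow {1..n}. (if m = g0 then compat_ind A f g else 0) + (if m = g1 then compat_ind A f g else 0))"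
      by (intro sum.cong) auto
    also have "\<dots> = 2 * compat_ind A f g" using g01 by (simp add: sum.distrib)
    finally show ?thesis by simp
  qed
  from compose_eqI[OF A cup_diagram_pp[OF i] A this]
  show "compose n A (cup_diagram n i j) = A" "loops n A (cup_diagram n i j) = 1" by auto
qed

text \<open>The two lines ending at i and j are joined by the northern arc of the cup diagram, whose
  southern arc closes the bottom row. Read backwards, this removes one arc from each row of a
  diagram.\<close>

lemma
  fixes i j k l :: nat
  assumes A: "A \<in> pp n" and ki: "{Top k, Bot i} \<in> A" and lj: "{Top l, Bot j} \<in> A" and "i \<noteq> j"
  defines "A' \<equiv> (A - {{Top k, Bot i}, {Top l, Bot j}}) \<union> {{Top k, Top l}, {Bot i, Bot j}}"
  shows compose_cup_cut: "compose n A (cup_diagram n i j) = A'"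
    and loops_cup_cut: "loops n A (cup_diagram n i j) = 0"
proof -
  have i: "i \<in> {1..n}" "j \<in> {1..n}" "i \<noteq> j" "k \<in> {1..n}" "l \<in> {1..n}"
    using pp_blockD(2)[OF A ki] pp_blockD(2)[OF A lj] \<open>i \<noteq> j\<close> by auto
  define R where "R = A - {{Top k, Bot i}, {Top l, Bot j}}"
  have A_eq: "A = R \<union> {{Top k, Bot i}, {Top l, Bot j}}" unfolding R_def using ki lj by blast
  have A'_eq: "A' = R \<union> {{Top k, Top l}, {Bot i, Bot j}}" unfolding A'_def R_def ..
  have "k \<noteq> l"
  proof
    assume "k = l"
    then have "{Top k, Bot i} = {Top l, Bot j}" using pp_block_unique[OF A ki lj] by blast
    then show False using \<open>i \<noteq> j\<close> by (auto simp: doubleton_eq_iff)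
  qed
  have rest: "Top k \<notin> a" "Bot i \<notin> a" "Top l \<notin> a" "Bot j \<notin> a" if "a \<in> R" for a
    using that pp_block_unique[OF A _ ki, of a] pp_block_unique[OF A _ lj, of a] unfolding R_def by blast+
  have A': "A' \<in> pp n"
  proof -
    \<comment> \<open>\<open>A'\<close> arises from \<open>A\<close> by exchanging two nodes, so it
      is a pair partition without a check of the axioms.\<close>
    define \<tau> where "\<tau> = Transposition.transpose (Bot i) (Top l)"
    have "\<tau> ` a = a" if "a \<in> R" for a
    proof -
      have "\<tau> x = x" if "x \<in> a" for x
        using rest[OF \<open>a \<in> R\<close>] that unfolding \<tau>_def by (metis transpose_apply_other)
      then show ?thesis by auto
    qed
    then have "map_diagram \<tau> R = R" unfolding map_diagram_def by simp
    moreover have "map_diagram \<tau> {{Top k, Bot i}, {Top l, Bot j}} = {{Top k, Top l}, {Bot i, Bot j}}"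
      using \<open>k \<noteq> l\<close> \<open>i \<noteq> j\<close> unfolding map_diagram_def \<tau>_def by (simp add: transpose_def insert_commute)
    ultimately have "map_diagram \<tau> A = A'"
      unfolding A_eq A'_eq by (simp only: map_diagram_def image_Un)
    moreover have "bij_betw \<tau> (nodes n) (nodes n)"
      unfolding \<tau>_def using i by (intro permutes_imp_bij permutes_swap_id) auto
    ultimately show ?thesis using map_diagram_pp[OF A] by metis
  qed
  have cA: "compat A (colouring f m) \<longleftrightarrow> compat R (colouring f m) \<and> (k \<in> f \<longleftrightarrow> i \<in> m) \<and> (l \<in> f \<longleftrightarrow> j \<in> m)" for f m
    by (subst A_eq) (auto simp: compat_Un compat_insert_pair)
  have cA': "compat A' (colouring f g) \<longleftrightarrow> compat R (colouring f g) \<and> (k \<in> f \<longleftrightarrow> l \<in> f) \<and> (i \<in> g \<longleftrightarrow> j \<in> g)" for f g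
    unfolding A'_eq by (auto simp: compat_Un compat_insert_pair)
  have R_cong: "compat R (colouring f m) \<longleftrightarrow> compat R (colouring f g)" if eq: "m - {i, j} = g - {i, j}" for f m g
  proof -
    have mg: "p \<in> m \<longleftrightarrow> p \<in> g" if "p \<noteq> i" "p \<noteq> j" for p using eq that by blast
    have "x \<in> colouring f m \<longleftrightarrow> x \<in> colouring f g" if "x \<in> a" "a \<in> R" for x a
    proof -
      have "x \<noteq> Bot i" "x \<noteq> Bot j" using rest[OF that(2)] that(1) by auto
      then show ?thesis using mg by (cases x) auto
    qed
    then show ?thesis unfolding compat_def by simp
  qed
  have "(\<Sum>m\<in>Pow {1..n}. compat_ind A f m * compat_ind (cup_diagram n i j) m g) = 2 ^ 0 * compat_ind A' f g"
    if f: "f \<subseteq> {1..n}" and g: "g \<subseteq> {1..n}" for f g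
  proof -
    \<comment> \<open>The only middle colouring that can contribute: it agrees with \<open>g\<close>
      away from i and j, and there it has the colour of \<open>Top k\<close>.\<close>
    define m0 where "m0 = (g - {i, j}) \<union> (if k \<in> f then {i, j} else {})"
    have m0: "m0 \<subseteq> {1..n}" unfolding m0_def using g i by auto
    have m0_iff: "m0 - {i, j} = g - {i, j}" "i \<in> m0 \<longleftrightarrow> k \<in> f" "j \<in> m0 \<longleftrightarrow> k \<in> f"
      unfolding m0_def by auto
    have m0_eqI: "m = m0" if "m - {i, j} = g - {i, j}" "i \<in> m \<longleftrightarrow> k \<in> f" "j \<in> m \<longleftrightarrow> k \<in> f" for m
      using that m0_iff by blast
    have "compat_ind A f m * compat_ind (cup_diagram n i j) m g = (if m = m0 then compat_ind A' f g else 0)"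
      if m: "m \<subseteq> {1..n}" for m
    proof -
      have "compat A (colouring f m) \<and> compat (cup_diagram n i j) (colouring m g) \<longleftrightarrow>
          m = m0 \<and> compat A' (colouring f g)"
        unfolding cA cA' compat_cup_diagram[OF i(1-3) m g]
        using m0_eqI[of m] m0_iff R_cong[of m g f] by metis
      then show ?thesis by (auto simp: compat_ind_def)
    qed
    then have "(\<Sum>m\<in>Pow {1..n}. compat_ind A f m * compat_ind (cup_diagram n i j) m g) =
        (\<Sum>m\<in>Pow {1..n}. if m = m0 then compat_ind A' f g else 0)"
      by (intro sum.cong) auto
    also have "\<dots> = compat_ind A' f g" using m0 by simp
    finally show ?thesis by simp
  qed
  from compose_eqI[OF A cup_diagram_pp[OF i(1-3)] A' this]
  show "compose n A (cup_diagram n i j) = A'" "loops n A (cup_diagram n i j) = 0" by auto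
qed

section \<open>Northern, southern and propagating pairs\<close>

definition north :: "diagram \<Rightarrow> nat" where
  "north A = card {a \<in> A. tp a = Northern}"

lemma tp_simps [simp]:
  "tp {Top i, Top j} = Northern" "tp {Bot i, Bot j} = Southern"
  "tp {Top i, Bot j} = Propagating" "tp {Bot j, Top i} = Propagating"
  by (auto simp: tp_def)

lemma pp_block_cases:
  assumes "A \<in> pp n" "a \<in> A"
  obtains i j where "a = {Top i, Top j}" "i \<noteq> j" | i j where "a = {Bot i, Bot j}" "i \<noteq> j"
    | i j where "a = {Top i, Bot j}"
proof -
  obtain x y where "a = {x, y}" "x \<noteq> y" using pp_blockD(1)[OF assms] by (auto simp: card_2_iff)
  then show thesis using that by (cases x; cases y) (auto simp: insert_commute)
qed

text \<open>Top nodes are counted by pairs: two in a northern pair, one in a propagating line, none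
  in a southern pair. Comparison with the total of n pairs yields the number of southern
  ones.\<close>

lemma card_types:
  assumes A: "A \<in> pp n"
  shows "2 * north A + card {a \<in> A. tp a = Propagating} = n"
    and "card {a \<in> A. tp a = Southern} = north A"
proof -
  have fin: "finite A" by (rule finite_diagram[OF A])
  have split: "card {a \<in> A. tp a = Northern} + card {a \<in> A. tp a = Southern} + card {a \<in> A. tp a = Propagating} = n"
  proof -
    have "A = {a \<in> A. tp a = Northern} \<union> {a \<in> A. tp a = Southern} \<union> {a \<in> A. tp a = Propagating}"
      using pair_type.exhaust by blast
    then have "card A = card ({a \<in> A. tp a = Northern} \<union> {a \<in> A. tp a = Southern} \<union> {a \<in> A. tp a = Propagating})" by simp
    also have "\<dots> = card {a \<in> A. tp a = Northern} + card {a \<in> A. tp a = Southern} + card {a \<in> A. tp a = Propagating}"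
      by (subst card_Un_disjoint; (use fin in auto)?)+
    finally show ?thesis using card_diagram[OF A] by simp
  qed
  have top: "card (a \<inter> range Top) = (case tp a of Northern \<Rightarrow> 2 | Southern \<Rightarrow> 0 | Propagating \<Rightarrow> 1)" if "a \<in> A" for a
    using pp_block_cases[OF A that] by cases (auto simp: Int_insert_left)
  have "card (nodes n \<inter> range Top) = (\<Sum>a\<in>A. card (a \<inter> range Top))"
  proof -
    have "nodes n \<inter> range Top = (\<Union>a\<in>A. a \<inter> range Top)" using pp_Union[OF A] by blast
    moreover have "card (\<Union>a\<in>A. a \<inter> range Top) = (\<Sum>a\<in>A. card (a \<inter> range Top))"
    proof (rule card_UN_disjoint)
      show "\<forall>a\<in>A. finite (a \<inter> range Top)" using pp_blockD(2)[OF A] finite_nodes by (meson finite_Int finite_subset)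
      show "\<forall>a\<in>A. \<forall>b\<in>A. a \<noteq> b \<longrightarrow> a \<inter> range Top \<inter> (b \<inter> range Top) = {}"
        using pp_block_unique[OF A] by blast
    qed (rule fin)
    ultimately show ?thesis by simp
  qed
  also have "\<dots> = (\<Sum>a\<in>A. 2 * of_bool (tp a = Northern) + of_bool (tp a = Propagating))"
    by (intro sum.cong refl) (simp add: top split: pair_type.split)
  also have "\<dots> = 2 * card {a \<in> A. tp a = Northern} + card {a \<in> A. tp a = Propagating}"
    using fin by (simp add: sum.distrib sum_distrib_left[symmetric] sum_of_bool_eq Int_def)
  finally have "card (nodes n \<inter> range Top) = 2 * north A + card {a \<in> A. tp a = Propagating}"
    by (simp add: north_def)
  moreover have "nodes n \<inter> range Top = Top ` {1..n}" by (auto simp: nodes_def)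
  ultimately show 1: "2 * north A + card {a \<in> A. tp a = Propagating} = n"
    by (simp add: card_image inj_on_def)
  show "card {a \<in> A. tp a = Southern} = north A" using 1 split by (simp add: north_def)
qed

text \<open>The upper bound on lines becomes a lower bound on arcs, a quantity that composition
  cannot decrease; evenness of n - l makes the division exact.\<close>

lemma pair_partitions_le_iff:
  assumes "l \<le> n" "even (n - l)"
  shows "A \<in> pair_partitions_le n l \<longleftrightarrow> A \<in> pp n \<and> (n - l) div 2 \<le> north A"
proof (cases "A \<in> pp n")
  case True
  obtain k where "n - l = 2 * k" using assms(2) by (rule evenE)
  then show ?thesis using card_types(1)[OF True] assms(1) True unfolding pair_partitions_le_def
    by (simp, linarith)
qed (simp add: pair_partitions_le_def)

lemma stack_edge_upper:
  "a \<in> A \<Longrightarrow> x \<in> a \<Longrightarrow> y \<in> a \<Longrightarrow> (upper_embed x, upper_embed y) \<in> stack_edges A B"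
  unfolding stack_edges_def by blast

lemma stack_edge_lower:
  "b \<in> B \<Longrightarrow> x \<in> b \<Longrightarrow> y \<in> b \<Longrightarrow> (lower_embed x, lower_embed y) \<in> stack_edges A B"
  unfolding stack_edges_def by blast

lemma compose_pairI:
  assumes A: "A \<in> pp n" and B: "B \<in> pp n"
    and "(outer_embed x, outer_embed y) \<in> (stack_edges A B)\<^sup>*" "x \<in> nodes n" "x \<noteq> y"
  shows "{x, y} \<in> compose n A B"
proof -
  note C = compose_pair_partitions[OF A B]
  let ?b = "{z. (outer_embed x, outer_embed z) \<in> (stack_edges A B)\<^sup>*}"
  have b: "?b \<in> compose n A B" using compose_block_iff[OF A B, of ?b] assms(4) by blast
  have "x \<in> ?b" "y \<in> ?b" using assms(3) by auto
  then have "y = partner (compose n A B) x" "?b = {x, partner (compose n A B) x}"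
    using pp_block_eq[OF C b, of x] assms(5) by auto
  then show ?thesis using b by simp
qed

lemma
  assumes A: "A \<in> pp n" and B: "B \<in> pp n"
  shows compose_north: "a \<in> A \<Longrightarrow> tp a = Northern \<Longrightarrow> a \<in> compose n A B"
    and compose_south: "b \<in> B \<Longrightarrow> tp b = Southern \<Longrightarrow> b \<in> compose n A B"
proof -
  show "a \<in> compose n A B" if a: "a \<in> A" "tp a = Northern"
  proof (rule pp_block_cases[OF A a(1)])
    fix i j assume ij: "a = {Top i, Top j}" "i \<noteq> j"
    have "(upper_embed (Top i), upper_embed (Top j)) \<in> stack_edges A B"
      by (rule stack_edge_upper[OF a(1)]) (simp_all add: ij)
    then have "(outer_embed (Top i), outer_embed (Top j)) \<in> stack_edges A B" by simp
    then show ?thesis using compose_pairI[OF A B r_into_rtrancl, of "Top i" "Top j"] ij pp_blockD(2)[OF A a(1)] by auto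
  qed (use a in auto)
  show "b \<in> compose n A B" if b: "b \<in> B" "tp b = Southern"
  proof (rule pp_block_cases[OF B b(1)])
    fix i j assume ij: "b = {Bot i, Bot j}" "i \<noteq> j"
    have "(lower_embed (Bot i), lower_embed (Bot j)) \<in> stack_edges A B"
      by (rule stack_edge_lower[OF b(1)]) (simp_all add: ij)
    then have "(outer_embed (Bot i), outer_embed (Bot j)) \<in> stack_edges A B" by simp
    then show ?thesis using compose_pairI[OF A B r_into_rtrancl, of "Bot i" "Bot j"] ij pp_blockD(2)[OF B b(1)] by auto
  qed (use b in auto)
qed

text \<open>Northern arcs of the upper and southern arcs of the lower diagram survive stacking.
  Since every diagram has as many northern as southern arcs, both factors give a bound.\<close>

lemma north_compose:
  assumes A: "A \<in> pp n" and B: "B \<in> pp n"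
  shows "north A \<le> north (compose n A B)" "north B \<le> north (compose n A B)"
proof -
  note C = compose_pair_partitions[OF A B]
  show "north A \<le> north (compose n A B)"
    unfolding north_def by (rule card_mono) (use finite_diagram[OF C] compose_north[OF A B] in auto)
  have "north B = card {b \<in> B. tp b = Southern}" using card_types(2)[OF B] by simp
  also have "\<dots> \<le> card {b \<in> compose n A B. tp b = Southern}"
    by (rule card_mono) (use finite_diagram[OF C] compose_south[OF A B] in auto)
  also have "\<dots> = north (compose n A B)" by (rule card_types(2)[OF C])
  finally show "north B \<le> north (compose n A B)" .
qed

section \<open>The trace form\<close>

definition flip :: "diagram \<Rightarrow> diagram" where
  "flip A = map_diagram opp A"

lemma opp_opp [simp]: "opp (opp x) = x"
  by (cases x) auto

lemma opp_neq [simp]: "opp x \<noteq> x" "x \<noteq> opp x"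
  by (cases x; simp)+

lemma opp_nodes [simp]: "opp x \<in> nodes n \<longleftrightarrow> x \<in> nodes n"
  by (cases x) auto

lemma bij_opp: "bij_betw opp (nodes n) (nodes n)"
  by (rule bij_betwI[where g = opp]) auto

lemma flip_pp: "A \<in> pp n \<Longrightarrow> flip A \<in> pp n"
  unfolding flip_def by (rule map_diagram_pp[OF _ bij_opp])

lemma flip_flip [simp]: "flip (flip A) = A"
  by (simp add: flip_def map_diagram_def image_image)

lemma compat_flip: "compat (flip A) (colouring f g) \<longleftrightarrow> compat A (colouring g f)"
proof -
  have "opp -` colouring f g = colouring g f"
  proof -
    have "x \<in> opp -` colouring f g \<longleftrightarrow> x \<in> colouring g f" for x by (cases x) auto
    then show ?thesis by blast
  qed
  then show ?thesis by (simp add: flip_def compat_map_diagram)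
qed

lemma north_flip: assumes A: "A \<in> pp n" shows "north (flip A) = north A"
proof -
  have tp_opp: "tp (opp ` a) = Northern \<longleftrightarrow> tp a = Southern" if "a \<in> A" for a
    using pp_block_cases[OF A that] by cases auto
  have "inj opp" by (rule inj_on_inverseI[of _ opp]) simp
  then have inj: "inj_on (\<lambda>a. opp ` a) X" for X by (simp add: inj_on_def inj_image_eq_iff)
  have "{a \<in> flip A. tp a = Northern} = (\<lambda>a. opp ` a) ` {a \<in> A. tp a = Southern}"
    using tp_opp by (auto simp: flip_def map_diagram_def)
  then have "north (flip A) = card {a \<in> A. tp a = Southern}"
    unfolding north_def by (simp add: card_image[OF inj])
  then show ?thesis using card_types(2)[OF A] by simp
qed

section \<open>Two diagrams glued along all their nodes\<close>

definition block_edges :: "diagram \<Rightarrow> (node \<times> node) set" where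
  "block_edges A = {(x, y). \<exists>a\<in>A. x \<in> a \<and> y \<in> a}"

definition join_rel :: "nat \<Rightarrow> diagram \<Rightarrow> diagram \<Rightarrow> (node \<times> node) set" where
  "join_rel n A B = (block_edges A \<union> block_edges B)\<^sup>* \<inter> nodes n \<times> nodes n"

text \<open>The number of closed loops obtained by gluing \<open>A\<close> and \<open>B\<close> along all \<open>2n\<close> nodes.\<close>

definition join_comps :: "nat \<Rightarrow> diagram \<Rightarrow> diagram \<Rightarrow> nat" where
  "join_comps n A B = card (nodes n // join_rel n A B)"

lemma join_comps_sym: "join_comps n A B = join_comps n B A"
  by (simp add: join_comps_def join_rel_def Un_commute)

lemma block_edges_props:
  assumes "A \<in> pp n" "B \<in> pp n"
  shows "block_edges A \<union> block_edges B \<subseteq> nodes n \<times> nodes n" "sym (block_edges A \<union> block_edges B)"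
proof -
  show "block_edges A \<union> block_edges B \<subseteq> nodes n \<times> nodes n"
    using pp_blockD(2)[OF assms(1)] pp_blockD(2)[OF assms(2)] unfolding block_edges_def by blast
  show "sym (block_edges A \<union> block_edges B)" unfolding sym_def block_edges_def by blast
qed

lemma equiv_join: "A \<in> pp n \<Longrightarrow> B \<in> pp n \<Longrightarrow> equiv (nodes n) (join_rel n A B)"
  unfolding join_rel_def by (rule equiv_components[OF block_edges_props])

text \<open>This is the count of saturated sets with no colours prescribed: every component is a
  free binary choice.\<close>

lemma card_join_colourings:
  assumes "A \<in> pp n" "B \<in> pp n"
  shows "card {c. c \<subseteq> nodes n \<and> compat A c \<and> compat B c} = 2 ^ join_comps n A B"
proof -
  have "compat A c \<and> compat B c \<longleftrightarrow> saturated (join_rel n A B) c" for c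
  proof -
    have "saturated (join_rel n A B) c \<longleftrightarrow> saturated (block_edges A \<union> block_edges B) c"
      unfolding join_rel_def by (rule saturated_components[OF block_edges_props(1)[OF assms]])
    also have "\<dots> \<longleftrightarrow> saturated (block_edges A) c \<and> saturated (block_edges B) c"
      unfolding saturated_def by blast
    also have "\<dots> \<longleftrightarrow> compat A c \<and> compat B c"
      unfolding saturated_def block_edges_def compat_def by (intro arg_cong2[where f = "(\<and>)"]) blast+
    finally show ?thesis by simp
  qed
  then have "card {c. c \<subseteq> nodes n \<and> compat A c \<and> compat B c} =
      card {c. c \<subseteq> nodes n \<and> saturated (join_rel n A B) c \<and> c \<inter> {} = {}}" by simp
  also have "\<dots> = 2 ^ join_comps n A B"
    by (subst card_saturated_extensions[OF finite_nodes equiv_join[OF assms]]) (auto simp: join_comps_def)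
  finally show ?thesis .
qed

text \<open>The left side is the trace of the product of the two matrices, which counts colourings
  of the closed-up stack. The flip enters because the top row of \<open>B\<close> meets the bottom
  row of \<open>A\<close>.\<close>

lemma join_comps_flip:
  assumes A: "A \<in> pp n" and B: "B \<in> pp n"
  shows "(\<Sum>f\<in>Pow {1..n}. \<Sum>g\<in>Pow {1..n}. compat_ind A f g * compat_ind B g f) = 2 ^ join_comps n A (flip B)"
proof -
  let ?P = "Pow {1..n}"
  let ?Q = "{(f, g). f \<subseteq> {1..n} \<and> g \<subseteq> {1..n} \<and> compat A (colouring f g) \<and> compat B (colouring g f)}"
  have "(\<Sum>f\<in>?P. \<Sum>g\<in>?P. compat_ind A f g * compat_ind B g f) =
      (\<Sum>(f, g)\<in>?P \<times> ?P. of_bool (compat A (colouring f g) \<and> compat B (colouring g f)))"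
    unfolding sum.cartesian_product by (intro sum.cong) (auto simp: compat_ind_def)
  also have "\<dots> = card ((?P \<times> ?P) \<inter> {(f, g). compat A (colouring f g) \<and> compat B (colouring g f)})"
    by (simp add: case_prod_unfold sum_of_bool_eq)
  also have "(?P \<times> ?P) \<inter> {(f, g). compat A (colouring f g) \<and> compat B (colouring g f)} = ?Q" by auto
  also have "card ?Q = card {c. c \<subseteq> nodes n \<and> compat A c \<and> compat (flip B) c}"
  proof (rule bij_betw_same_card[of "\<lambda>(f, g). colouring f g"], rule bij_betwI[where g = "\<lambda>c. (Top -` c, Bot -` c)"])
    have fibre: "colouring (Top -` c) (Bot -` c) = c" for c
    proof -
      have "x \<in> colouring (Top -` c) (Bot -` c) \<longleftrightarrow> x \<in> c" for x by (cases x) auto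
      then show ?thesis by blast
    qed
    show "(\<lambda>(f, g). colouring f g) \<in> ?Q \<rightarrow> {c. c \<subseteq> nodes n \<and> compat A c \<and> compat (flip B) c}"
      by (auto simp: compat_flip) (auto simp: colouring_def nodes_def)
    show "(\<lambda>c. (Top -` c, Bot -` c)) \<in> {c. c \<subseteq> nodes n \<and> compat A c \<and> compat (flip B) c} \<rightarrow> ?Q"
    proof
      fix c assume c: "c \<in> {c. c \<subseteq> nodes n \<and> compat A c \<and> compat (flip B) c}"
      then have "compat (flip B) (colouring (Top -` c) (Bot -` c))" unfolding fibre by simp
      then have "compat B (colouring (Bot -` c) (Top -` c))" unfolding compat_flip .
      moreover have "Top -` c \<subseteq> {1..n}" "Bot -` c \<subseteq> {1..n}" using c by auto
      ultimately show "(Top -` c, Bot -` c) \<in> ?Q" using c unfolding mem_Collect_eq case_prod_conv fibre by blast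
    qed
    show "(\<lambda>c. (Top -` c, Bot -` c)) ((\<lambda>(f, g). colouring f g) x) = x" for x
      by (cases x) auto
    show "(\<lambda>(f, g). colouring f g) (Top -` c, Bot -` c) = c" for c
      using fibre by simp
  qed
  also have "\<dots> = 2 ^ join_comps n A (flip B)" by (rule card_join_colourings[OF A flip_pp[OF B]])
  finally show ?thesis .
qed

lemma join_comps_flip_sym:
  assumes A: "A \<in> pp n" and B: "B \<in> pp n"
  shows "join_comps n A (flip B) = join_comps n B (flip A)"
proof -
  have "(2::nat) ^ join_comps n A (flip B) = 2 ^ join_comps n B (flip A)"
    unfolding join_comps_flip[OF assms, symmetric] join_comps_flip[OF B A, symmetric]
    by (subst sum.swap) (simp add: mult.commute)
  then show ?thesis by simp
qed

text \<open>For the matrices this is tr((AB)C) = tr(A(BC)): both sides count the loops in the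
  closure of three stacked diagrams. It is the associativity of the form, written in
  exponents.\<close>

lemma loops_join_comps:
  assumes A: "A \<in> pp n" and B: "B \<in> pp n" and C: "C \<in> pp n"
  shows "loops n A B + join_comps n (compose n A B) (flip C) = loops n B C + join_comps n A (flip (compose n B C))"
proof -
  let ?P = "Pow {1..n}"
  note AB = compose_pair_partitions[OF A B] and BC = compose_pair_partitions[OF B C]
  have "(2::nat) ^ (loops n A B + join_comps n (compose n A B) (flip C)) =
      2 ^ loops n A B * (\<Sum>f\<in>?P. \<Sum>g\<in>?P. compat_ind (compose n A B) f g * compat_ind C g f)"
    by (simp only: power_add join_comps_flip[OF AB C])
  also have "\<dots> = (\<Sum>f\<in>?P. \<Sum>g\<in>?P. (2 ^ loops n A B * compat_ind (compose n A B) f g) * compat_ind C g f)"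
    by (simp only: sum_distrib_left mult.assoc)
  also have "\<dots> = (\<Sum>f\<in>?P. \<Sum>g\<in>?P. \<Sum>m\<in>?P. compat_ind A f m * compat_ind B m g * compat_ind C g f)"
    by (intro sum.cong refl) (simp only: compat_ind_compose[OF A B, symmetric] Pow_iff sum_distrib_right)
  also have "\<dots> = (\<Sum>f\<in>?P. \<Sum>m\<in>?P. \<Sum>g\<in>?P. compat_ind A f m * (compat_ind B m g * compat_ind C g f))"
    by (rule sum.cong[OF refl], subst sum.swap) (simp only: mult.assoc)
  also have "\<dots> = (\<Sum>f\<in>?P. \<Sum>m\<in>?P. compat_ind A f m * (2 ^ loops n B C * compat_ind (compose n B C) m f))"
    by (intro sum.cong refl) (simp only: compat_ind_compose[OF B C, symmetric] Pow_iff sum_distrib_left)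
  also have "\<dots> = 2 ^ loops n B C * (\<Sum>f\<in>?P. \<Sum>m\<in>?P. compat_ind A f m * compat_ind (compose n B C) m f)"
    by (simp only: sum_distrib_left mult.left_commute)
  also have "\<dots> = 2 ^ (loops n B C + join_comps n A (flip (compose n B C)))"
    by (simp only: power_add join_comps_flip[OF A BC])
  finally show ?thesis by simp
qed

text \<open>Summing over all of \<open>pp n\<close> instead of the supports makes bilinearity a
  formal identity.\<close>

definition trace_form :: "nat \<Rightarrow> brauer_elem \<Rightarrow> brauer_elem \<Rightarrow> ratfun" where
  "trace_form n x y = (\<Sum>A\<in>pp n. \<Sum>B\<in>pp n.
    Poly_Mapping.lookup x A * Poly_Mapping.lookup y B * delta ^ join_comps n A (flip B))"

lemma trace_form_linear [simp]:
  "trace_form n (x + y) z = trace_form n x z + trace_form n y z"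
  "trace_form n z (x + y) = trace_form n z x + trace_form n z y"
  "trace_form n (scale c x) z = c * trace_form n x z"
  "trace_form n z (scale c x) = c * trace_form n z x"
  "trace_form n 0 z = 0" "trace_form n z 0 = 0"
  by (simp_all add: trace_form_def lookup_add algebra_simps sum.distrib sum_distrib_left)

lemma trace_form_minus [simp]:
  "trace_form n (- x) z = - trace_form n x z"
  using trace_form_linear(3)[of n "- 1" x z] by simp

lemma trace_form_diff: "trace_form n (x - y) z = trace_form n x z - trace_form n y z"
  using trace_form_linear(1)[of n x "- y" z] by simp

lemma trace_form_basis:
  assumes "A \<in> pp n" "B \<in> pp n"
  shows "trace_form n (basis_elem A) (basis_elem B) = delta ^ join_comps n A (flip B)"
proof -
  have "trace_form n (basis_elem A) (basis_elem B) =
      (\<Sum>A'\<in>pp n. \<Sum>B'\<in>pp n. if B' = B then (if A' = A then delta ^ join_comps n A (flip B) else 0) else 0)"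
    unfolding trace_form_def by (intro sum.cong refl) auto
  also have "\<dots> = delta ^ join_comps n A (flip B)" using assms by (simp add: sum.delta)
  finally show ?thesis .
qed

lemma trace_form_sym: "trace_form n x y = trace_form n y x"
  unfolding trace_form_def
  by (subst sum.swap, intro sum.cong refl) (simp add: join_comps_flip_sym mult.commute mult.left_commute)

lemma trace_form_assoc:
  assumes "x \<in> span_of (pp n)" "y \<in> span_of (pp n)" "z \<in> span_of (pp n)"
  shows "trace_form n (brauer_mult n x y) z = trace_form n x (brauer_mult n y z)"
  using assms(1)
proof (induction x rule: span_of_induct)
  case (basis A)
  show ?case using assms(2)
  proof (induction y rule: span_of_induct)
    case (basis B)
    show ?case using assms(3)
    proof (induction z rule: span_of_induct)
      case (basis C)
      note ABC = \<open>A \<in> pp n\<close> \<open>B \<in> pp n\<close> \<open>C \<in> pp n\<close>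
      show ?case using ABC
        by (simp add: brauer_mult_basis trace_form_basis compose_pair_partitions
            power_add[symmetric] loops_join_comps[OF ABC])
    qed (simp_all add: brauer_mult_add_right brauer_mult_scale_right)
  qed (simp_all add: brauer_mult_add_left brauer_mult_scale_left brauer_mult_add_right brauer_mult_scale_right)
qed (simp_all add: brauer_mult_add_left brauer_mult_scale_left)

subsection \<open>Estimates for the number of components\<close>

lemma class_closed_partner:
  assumes A: "A \<in> pp n" and B: "B \<in> pp n" and C: "C \<in> nodes n // join_rel n A B" and x: "x \<in> C"
  shows "partner A x \<in> C" "partner B x \<in> C" "x \<in> nodes n"
proof -
  note eq = equiv_join[OF A B]
  show xn: "x \<in> nodes n" using in_quotient_imp_subset[OF eq C] x by blast
  have "{x, partner A x} \<in> A" "{x, partner B x} \<in> B"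
    using partner_block[OF A xn] partner_block[OF B xn] by auto
  then have "(x, partner A x) \<in> block_edges A" "(x, partner B x) \<in> block_edges B"
    unfolding block_edges_def by blast+
  then have "(x, partner A x) \<in> join_rel n A B" "(x, partner B x) \<in> join_rel n A B"
    using partner_nodes[OF A xn] partner_nodes[OF B xn] xn unfolding join_rel_def by auto
  then show "partner A x \<in> C" "partner B x \<in> C" using in_quotient_imp_closed[OF eq C x] by blast+
qed

lemma card_class_blocks:
  assumes A: "A \<in> pp n" and C: "C \<subseteq> nodes n" "\<And>x. x \<in> C \<Longrightarrow> partner A x \<in> C"
  shows "2 * card {a \<in> A. a \<subseteq> C} = card C"
proof -
  have eq: "\<Union>{a \<in> A. a \<subseteq> C} = C"
  proof
    show "C \<subseteq> \<Union>{a \<in> A. a \<subseteq> C}"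
    proof
      fix x assume "x \<in> C"
      then have "{x, partner A x} \<in> {a \<in> A. a \<subseteq> C}" using C partner_block[OF A] by auto
      then show "x \<in> \<Union>{a \<in> A. a \<subseteq> C}" by blast
    qed
  qed auto
  have "2 * card {a \<in> A. a \<subseteq> C} = card (\<Union>{a \<in> A. a \<subseteq> C})"
  proof (rule card_partition)
    show "finite {a \<in> A. a \<subseteq> C}" using finite_diagram[OF A] by simp
    show "finite (\<Union>{a \<in> A. a \<subseteq> C})" unfolding eq using finite_subset[OF C(1)] by simp
    show "\<And>c. c \<in> {a \<in> A. a \<subseteq> C} \<Longrightarrow> card c = 2" using pp_blockD(1)[OF A] by blast
    show "\<And>c d. c \<in> {a \<in> A. a \<subseteq> C} \<Longrightarrow> d \<in> {a \<in> A. a \<subseteq> C} \<Longrightarrow> c \<noteq> d \<Longrightarrow> c \<inter> d = {}"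
      using pp_block_unique[OF A] by blast
  qed
  then show ?thesis unfolding eq .
qed

text \<open>
  The summand 1 is gained because the pairs of \<open>B\<close> in a component are northern if all pairs of
  \<open>A\<close> in it are.
\<close>

lemma class_north_estimate:
  assumes A: "A \<in> pp n" and B: "B \<in> pp n" and C: "C \<in> nodes n // join_rel n A B"
  shows "1 + card {a \<in> A. a \<subseteq> C \<and> tp a = Northern} \<le> card {a \<in> A. a \<subseteq> C} + card {b \<in> B. b \<subseteq> C \<and> tp b = Northern}"
proof (cases "{b \<in> B. b \<subseteq> C \<and> tp b = Northern} = {}")
  case False
  then have "1 \<le> card {b \<in> B. b \<subseteq> C \<and> tp b = Northern}"
    using finite_diagram[OF B] by (simp add: Suc_le_eq card_gt_0_iff)
  moreover have "card {a \<in> A. a \<subseteq> C \<and> tp a = Northern} \<le> card {a \<in> A. a \<subseteq> C}"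
    by (rule card_mono) (use finite_diagram[OF A] in auto)
  ultimately show ?thesis by linarith
next
  case True
  note cl = class_closed_partner[OF A B C]
  obtain x where x: "x \<in> C" using C equiv_join[OF A B] by (auto dest: in_quotient_imp_non_empty)
  have "{a \<in> A. a \<subseteq> C \<and> tp a = Northern} \<noteq> {a \<in> A. a \<subseteq> C}"
  proof
    assume eq: "{a \<in> A. a \<subseteq> C \<and> tp a = Northern} = {a \<in> A. a \<subseteq> C}"
    have top: "y \<in> range Top" if "y \<in> C" for y
    proof -
      have "{y, partner A y} \<in> {a \<in> A. a \<subseteq> C}" using partner_block[OF A] cl that by simp
      then have "tp {y, partner A y} = Northern" using eq by blast
      then show ?thesis unfolding tp_def by (auto split: if_splits)
    qed
    have "{x, partner B x} \<in> B" "{x, partner B x} \<subseteq> C" using partner_block[OF B] cl x by simp_all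
    moreover have "tp {x, partner B x} = Northern" using top cl x unfolding tp_def by auto
    ultimately show False using True by blast
  qed
  then have "card {a \<in> A. a \<subseteq> C \<and> tp a = Northern} < card {a \<in> A. a \<subseteq> C}"
    by (intro psubset_card_mono) (use finite_diagram[OF A] in auto)
  then show ?thesis by linarith
qed

text \<open>The two nodes of a pair are joined by an edge, so each pair of either diagram lies in
  exactly one class.\<close>

lemma sum_over_classes:
  assumes A: "A \<in> pp n" and B: "B \<in> pp n" and D: "D = A \<or> D = B"
  shows "(\<Sum>C\<in>nodes n // join_rel n A B. card {a \<in> D. a \<subseteq> C \<and> P a}) = card {a \<in> D. P a}"
proof -
  note eq = equiv_join[OF A B]
  have Dp: "D \<in> pp n" using A B D by blast
  have ne: "a \<noteq> {}" if "a \<in> D" for a using pp_blockD(1)[OF Dp that] by auto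
  have ex: "\<exists>C\<in>nodes n // join_rel n A B. a \<subseteq> C" if a: "a \<in> D" for a
  proof -
    obtain x where x: "x \<in> a" using ne[OF a] by blast
    then have xn: "x \<in> nodes n" using pp_blockD(2)[OF Dp a] by blast
    have C: "join_rel n A B `` {x} \<in> nodes n // join_rel n A B" using xn by (rule quotientI)
    have xC: "x \<in> join_rel n A B `` {x}" using equiv_class_self[OF eq xn] .
    have "a = {x, partner D x}" by (rule pp_block_eq[OF Dp a x])
    then have "a \<subseteq> join_rel n A B `` {x}" using class_closed_partner[OF A B C xC] xC D by auto
    then show ?thesis using C by blast
  qed
  have "{a \<in> D. P a} = (\<Union>C\<in>nodes n // join_rel n A B. {a \<in> D. a \<subseteq> C \<and> P a})"
    using ex by blast
  moreover have "card (\<Union>C\<in>nodes n // join_rel n A B. {a \<in> D. a \<subseteq> C \<and> P a}) =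
      (\<Sum>C\<in>nodes n // join_rel n A B. card {a \<in> D. a \<subseteq> C \<and> P a})"
  proof (rule card_UN_disjoint)
    show "finite (nodes n // join_rel n A B)" by (rule finite_quotient[OF finite_nodes equiv_type[OF eq]])
    show "\<forall>C\<in>nodes n // join_rel n A B. finite {a \<in> D. a \<subseteq> C \<and> P a}" using finite_diagram[OF Dp] by simp
    show "\<forall>C\<in>nodes n // join_rel n A B. \<forall>C'\<in>nodes n // join_rel n A B. C \<noteq> C' \<longrightarrow>
        {a \<in> D. a \<subseteq> C \<and> P a} \<inter> {a \<in> D. a \<subseteq> C' \<and> P a} = {}"
    proof (intro ballI impI)
      fix C C' assume "C \<in> nodes n // join_rel n A B" "C' \<in> nodes n // join_rel n A B" "C \<noteq> C'"
      then have "C \<inter> C' = {}" using quotient_disj[OF eq] by blast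
      then show "{a \<in> D. a \<subseteq> C \<and> P a} \<inter> {a \<in> D. a \<subseteq> C' \<and> P a} = {}" using ne by blast
    qed
  qed
  ultimately show ?thesis by simp
qed

text \<open>The estimate for a single class is summed over all classes, where its summand 1 produces
  the number of components. The bound makes the exponents of the rescaled Gram matrix
  nonnegative.\<close>

lemma join_comps_north:
  assumes A: "A \<in> pp n" and B: "B \<in> pp n"
  shows "join_comps n A B + north A \<le> n + north B"
proof -
  let ?Q = "nodes n // join_rel n A B"
  have "join_comps n A B + north A = (\<Sum>C\<in>?Q. 1 + card {a \<in> A. a \<subseteq> C \<and> tp a = Northern})"
    using sum_over_classes[OF A B, of A "\<lambda>a. tp a = Northern"]
    unfolding sum.distrib by (simp add: join_comps_def north_def)
  also have "\<dots> \<le> (\<Sum>C\<in>?Q. card {a \<in> A. a \<subseteq> C} + card {b \<in> B. b \<subseteq> C \<and> tp b = Northern})"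
    by (rule sum_mono) (rule class_north_estimate[OF A B])
  also have "\<dots> = card {a \<in> A. True} + north B"
    using sum_over_classes[OF A B, of B "\<lambda>a. tp a = Northern"] sum_over_classes[OF A B, of A "\<lambda>_. True"]
    by (simp add: sum.distrib north_def)
  finally show ?thesis using card_diagram[OF A] by simp
qed

lemma class_blocks_pos:
  assumes A: "A \<in> pp n" and B: "B \<in> pp n" and C: "C \<in> nodes n // join_rel n A B"
  shows "1 \<le> card {a \<in> A. a \<subseteq> C}" "2 * card {a \<in> A. a \<subseteq> C} = card C"
proof -
  note cl = class_closed_partner[OF A B C]
  show 2: "2 * card {a \<in> A. a \<subseteq> C} = card C"
    by (rule card_class_blocks[OF A]) (use cl in blast)+
  obtain x where "x \<in> C" using C equiv_join[OF A B] by (auto dest: in_quotient_imp_non_empty)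
  moreover have "finite C" using cl(3) finite_subset[OF _ finite_nodes] by blast
  ultimately have "card C \<noteq> 0" by auto
  then show "1 \<le> card {a \<in> A. a \<subseteq> C}" using 2 by linarith
qed

text \<open>Every component contains at least one of the n pairs of \<open>A\<close>. With n
  components each contains exactly one, so it consists of two nodes and is a pair of
  \<open>A\<close> and of \<open>B\<close> at once.\<close>

lemma join_comps_self_le:
  assumes A: "A \<in> pp n" and B: "B \<in> pp n"
  shows "join_comps n A B \<le> n" and "A \<noteq> B \<Longrightarrow> join_comps n A B < n"
proof -
  let ?Q = "nodes n // join_rel n A B"
  have fin: "finite ?Q" by (rule finite_quotient[OF finite_nodes equiv_type[OF equiv_join[OF A B]]])
  have n: "(\<Sum>C\<in>?Q. card {a \<in> A. a \<subseteq> C}) = n"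
    using sum_over_classes[OF A B, of A "\<lambda>_. True"] card_diagram[OF A] by simp
  have "join_comps n A B = (\<Sum>C\<in>?Q. 1)" by (simp add: join_comps_def)
  also have "\<dots> \<le> (\<Sum>C\<in>?Q. card {a \<in> A. a \<subseteq> C})"
    by (rule sum_mono) (rule class_blocks_pos(1)[OF A B])
  finally show le: "join_comps n A B \<le> n" unfolding n .
  assume "A \<noteq> B"
  show "join_comps n A B < n"
  proof (rule ccontr)
    assume "\<not> join_comps n A B < n"
    then have "(\<Sum>C\<in>?Q. 1) = (\<Sum>C\<in>?Q. card {a \<in> A. a \<subseteq> C})" using le n by (simp add: join_comps_def)
    then have one: "card {a \<in> A. a \<subseteq> C} = 1" if "C \<in> ?Q" for C
      using sum_mono_inv[of "\<lambda>_. 1" ?Q "\<lambda>C. card {a \<in> A. a \<subseteq> C}" C] class_blocks_pos(1)[OF A B] fin that by force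
    have "A \<subseteq> B"
    proof
      fix a assume a: "a \<in> A"
      then obtain x where x: "x \<in> nodes n" "a = {x, partner A x}" by (subst (asm) pp_blocks_eq[OF A]) auto
      define C where "C = join_rel n A B `` {x}"
      have C: "C \<in> ?Q" unfolding C_def using x(1) by (rule quotientI)
      have xC: "x \<in> C" unfolding C_def by (rule equiv_class_self[OF equiv_join[OF A B] x(1)])
      have "card C = 2" using one[OF C] class_blocks_pos(2)[OF A B C] by simp
      moreover have "{x, partner A x} \<subseteq> C" "{x, partner B x} \<subseteq> C"
        using class_closed_partner[OF A B C xC] xC by auto
      moreover have "card {x, partner A x} = 2" "card {x, partner B x} = 2"
        using partner_neq[OF A x(1)] partner_neq[OF B x(1)] by auto
      ultimately have "{x, partner A x} = C" "{x, partner B x} = C"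
        by (metis card.infinite card_subset_eq zero_neq_numeral)+
      then show "a \<in> B" using partner_block[OF B x(1)] x(2) by simp
    qed
    then show False using pair_partitions_eqI[OF A B] \<open>A \<noteq> B\<close> by blast
  qed
qed

section \<open>The integral scalars\<close>

abbreviation (input) int_poly :: "int poly \<Rightarrow> rat poly" where
  "int_poly \<equiv> map_poly of_int"

lemma coeff_int_poly [simp]: "Polynomial.coeff (int_poly p) i = of_int (Polynomial.coeff p i)"
  by (simp add: coeff_map_poly)

lemma int_poly_add: "int_poly (p + q) = int_poly p + int_poly q"
  and int_poly_minus: "int_poly (- p) = - int_poly p"
  and int_poly_mult: "int_poly (p * q) = int_poly p * int_poly q"
  and int_poly_1: "int_poly 1 = 1"
  and int_poly_eq_0: "int_poly p = 0 \<longleftrightarrow> p = 0"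
  by (auto simp: poly_eq_iff coeff_mult)

text \<open>Modulo the ideal \<open>filtration 1\<close> of the integral scalars, the rescaled Gram matrix is unitriangular.\<close>

definition filtration :: "nat \<Rightarrow> ratfun set" where
  "filtration e = {Fract (int_poly f) (int_poly g) | f g. lead_coeff g = 1 \<and> degree f + e \<le> degree g}"

lemma filtrationI:
  "lead_coeff g = 1 \<Longrightarrow> degree f + e \<le> degree g \<Longrightarrow> Fract (int_poly f) (int_poly g) \<in> filtration e"
  unfolding filtration_def by blast

lemma integral_scalars_eq: "integral_scalars = filtration 0"
  by (simp add: integral_scalars_def filtration_def)

lemma filtration_antimono: "d \<le> e \<Longrightarrow> filtration e \<subseteq> filtration d"
  unfolding filtration_def by fastforce

lemma monic_neq_0: "lead_coeff (g::int poly) = 1 \<Longrightarrow> int_poly g \<noteq> 0"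
  unfolding int_poly_eq_0 by auto

lemma monic_mult:
  assumes "lead_coeff (g::int poly) = 1" "lead_coeff h = 1"
  shows "lead_coeff (g * h) = 1" "degree (g * h) = degree g + degree h"
  using assms by (auto simp: lead_coeff_mult intro!: degree_mult_eq)

lemma filtration_add:
  assumes "x \<in> filtration e" "y \<in> filtration e" shows "x + y \<in> filtration e"
proof -
  obtain f g where x: "x = Fract (int_poly f) (int_poly g)" "lead_coeff g = 1" "degree f + e \<le> degree g"
    using assms(1) unfolding filtration_def by blast
  obtain f' g' where y: "y = Fract (int_poly f') (int_poly g')" "lead_coeff g' = 1" "degree f' + e \<le> degree g'"
    using assms(2) unfolding filtration_def by blast
  have "x + y = Fract (int_poly (f * g' + f' * g)) (int_poly (g * g'))"
    unfolding x(1) y(1) using monic_neq_0[OF x(2)] monic_neq_0[OF y(2)]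
    by (simp add: int_poly_add int_poly_mult)
  moreover have "degree (f * g' + f' * g) + e \<le> degree (g * g')"
  proof -
    have "degree (f * g') + e \<le> degree g + degree g'" "degree (f' * g) + e \<le> degree g + degree g'"
      using degree_mult_le[of f g'] degree_mult_le[of f' g] x(3) y(3) by linarith+
    then show ?thesis using degree_add_le_max[of "f * g'" "f' * g"] monic_mult(2)[OF x(2) y(2)] by linarith
  qed
  ultimately show ?thesis using monic_mult(1)[OF x(2) y(2)] unfolding filtration_def by blast
qed

lemma filtration_mult:
  assumes "x \<in> filtration d" "y \<in> filtration e" shows "x * y \<in> filtration (d + e)"
proof -
  obtain f g where x: "x = Fract (int_poly f) (int_poly g)" "lead_coeff g = 1" "degree f + d \<le> degree g"
    using assms(1) unfolding filtration_def by blast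
  obtain f' g' where y: "y = Fract (int_poly f') (int_poly g')" "lead_coeff g' = 1" "degree f' + e \<le> degree g'"
    using assms(2) unfolding filtration_def by blast
  have "x * y = Fract (int_poly (f * f')) (int_poly (g * g'))"
    unfolding x(1) y(1) by (simp add: int_poly_mult)
  moreover have "degree (f * f') + (d + e) \<le> degree (g * g')"
    using degree_mult_le[of f f'] x(3) y(3) monic_mult(2)[OF x(2) y(2)] by linarith
  ultimately show ?thesis using monic_mult(1)[OF x(2) y(2)] unfolding filtration_def by blast
qed

lemma filtration_minus:
  assumes "x \<in> filtration e" shows "- x \<in> filtration e"
proof -
  obtain f g where x: "x = Fract (int_poly f) (int_poly g)" "lead_coeff g = 1" "degree f + e \<le> degree g"
    using assms(1) unfolding filtration_def by blast
  have "- x = Fract (int_poly (- f)) (int_poly g)" unfolding x(1) by (simp add: int_poly_minus)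
  moreover have "degree (- f) + e \<le> degree g" using x(3) by simp
  ultimately show ?thesis using x(2) unfolding filtration_def by blast
qed

lemma filtration_diff: "x \<in> filtration e \<Longrightarrow> y \<in> filtration e \<Longrightarrow> x - y \<in> filtration e"
  using filtration_add[of x e "- y"] filtration_minus by simp

lemma filtration_mult_0:
  "x \<in> filtration 0 \<Longrightarrow> y \<in> filtration 0 \<Longrightarrow> x * y \<in> filtration 0"
  "x \<in> filtration 1 \<Longrightarrow> y \<in> filtration 0 \<Longrightarrow> x * y \<in> filtration 1"
  "x \<in> filtration 0 \<Longrightarrow> y \<in> filtration 1 \<Longrightarrow> x * y \<in> filtration 1"
  using filtration_mult[of x 0 y 0] filtration_mult[of x 1 y 0] filtration_mult[of x 0 y 1] by auto

lemma zero_filtration [simp]: "0 \<in> filtration e"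
proof -
  \<comment> \<open>The zero polynomial has degree 0, so a denominator of degree e is
    needed.\<close>
  have "(0::ratfun) = Fract (int_poly 0) (int_poly (Polynomial.monom 1 e))" by (simp add: Zero_fract_def eq_fract int_poly_eq_0)
  moreover have "lead_coeff (Polynomial.monom (1::int) e) = 1" "degree (0::int poly) + e \<le> degree (Polynomial.monom (1::int) e)"
    by (simp_all add: degree_monom_eq)
  ultimately show ?thesis unfolding filtration_def by blast
qed

lemma one_filtration [simp]: "1 \<in> filtration 0"
proof -
  have "(1::ratfun) = Fract (int_poly 1) (int_poly 1)" by (simp add: One_fract_def int_poly_1)
  moreover have "Fract (int_poly 1) (int_poly 1) \<in> filtration 0" by (rule filtrationI) simp_all
  ultimately show ?thesis by simp
qed

lemma delta_neq_0 [simp]: "delta \<noteq> 0"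
  by (simp add: delta_def Zero_fract_def eq_fract)

lemma inverse_delta_filtration: "inverse delta \<in> filtration 1"
proof -
  have "inverse delta = Fract (int_poly 1) (int_poly [:0, 1:])"
    unfolding int_poly_1 by (simp add: delta_def map_poly_pCons)
  also have "\<dots> \<in> filtration 1" by (rule filtrationI) simp_all
  finally show ?thesis .
qed

lemma inverse_delta_power: "inverse delta ^ k \<in> filtration 0" "0 < k \<Longrightarrow> inverse delta ^ k \<in> filtration 1"
proof -
  show *: "inverse delta ^ k \<in> filtration 0" for k
    by (induction k)
      (use inverse_delta_filtration filtration_antimono[of 0 1] in \<open>auto intro!: filtration_mult_0(1)\<close>)
  assume "0 < k"
  then obtain j where "k = Suc j" by (cases k) auto
  then show "inverse delta ^ k \<in> filtration 1"
    using filtration_mult_0(2)[OF inverse_delta_filtration *[of j]] by simp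
qed

lemma filtration_sum: "(\<And>i. i \<in> I \<Longrightarrow> f i \<in> filtration e) \<Longrightarrow> sum f I \<in> filtration e"
  by (induction I rule: infinite_finite_induct) (auto intro: filtration_add)

text \<open>With u - 1 = f/g and degree f < degree g, the numerator f + g of u is again monic of the
  degree of g, so the inverse g/(f + g) is an integral scalar.\<close>

lemma filtration_unit:
  assumes "u - 1 \<in> filtration 1"
  shows "u \<noteq> 0" "inverse u \<in> filtration 0"
proof -
  obtain f g where fg: "u - 1 = Fract (int_poly f) (int_poly g)" "lead_coeff g = 1" "degree f + 1 \<le> degree g"
    using assms(1) unfolding filtration_def by blast
  have g0: "int_poly g \<noteq> 0" by (rule monic_neq_0[OF fg(2)])
  have "1 = Fract (int_poly g) (int_poly g)" using g0 by (simp add: One_fract_def eq_fract)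
  then have "u = Fract (int_poly f) (int_poly g) + Fract (int_poly g) (int_poly g)" using fg(1) by (simp add: algebra_simps)
  also have "\<dots> = Fract ((int_poly f + int_poly g) * int_poly g) (int_poly g * int_poly g)"
    using g0 by (simp add: algebra_simps)
  also have "\<dots> = Fract (int_poly (f + g)) (int_poly g)" using g0 by (simp add: int_poly_add eq_fract)
  finally have u: "u = Fract (int_poly (f + g)) (int_poly g)" .
  have lt: "degree f < degree g" using fg(3) by simp
  have deg: "degree (f + g) = degree g" using degree_add_eq_right[OF lt] .
  have lead: "lead_coeff (f + g) = 1" unfolding deg using fg(2) lt by (simp add: coeff_eq_0)
  show "u \<noteq> 0" using monic_neq_0[OF lead] g0 unfolding u by (simp add: Zero_fract_def eq_fract)
  have "inverse u = Fract (int_poly g) (int_poly (f + g))" unfolding u by simp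
  then show "inverse u \<in> filtration 0" using lead deg unfolding filtration_def by force
qed

section \<open>Unitriangular systems\<close>

text \<open>Modulo \<open>filtration 1\<close>, an entry off the diagonal can survive only where
  \<open>h\<close> strictly decreases from row to column. Entries between distinct indices of equal
  weight are small too, so a weight can replace a linear order of the indices.\<close>

definition unitriangular :: "('a \<Rightarrow> nat) \<Rightarrow> 'a set \<Rightarrow> ('a \<Rightarrow> 'a \<Rightarrow> ratfun) \<Rightarrow> bool" where
  "unitriangular h S M \<longleftrightarrow> (\<forall>a\<in>S. \<forall>b\<in>S. M a b \<in> filtration 0 \<and> (a = b \<longrightarrow> M a b - 1 \<in> filtration 1) \<and>
    (a \<noteq> b \<longrightarrow> h a \<le> h b \<longrightarrow> M a b \<in> filtration 1))"

text \<open>Gaussian elimination. Every diagonal entry is a unit by \<open>filtration_unit\<close>,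
  and any index can serve as pivot because the Schur complement is unitriangular for the same
  weight.\<close>

lemma unitriangular_solvable:
  assumes "finite S" "unitriangular h S M" "\<And>a. a \<in> S \<Longrightarrow> v a \<in> filtration 0"
  shows "\<exists>x. (\<forall>a\<in>S. x a \<in> filtration 0) \<and> (\<forall>a\<in>S. (\<Sum>b\<in>S. M a b * x b) = v a)"
  using assms
proof (induction S arbitrary: M v rule: finite_induct)
  case empty
  then show ?case by auto
next
  case (insert s S)
  have M0: "M a b \<in> filtration 0" if "a \<in> insert s S" "b \<in> insert s S" for a b
    using insert.prems(1) that unfolding unitriangular_def by blast
  have M1: "M a b \<in> filtration 1" if "a \<in> insert s S" "b \<in> insert s S" "a \<noteq> b" "h a \<le> h b" for a b
    using insert.prems(1) that unfolding unitriangular_def by blast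
  have Md: "M a a - 1 \<in> filtration 1" if "a \<in> insert s S" for a
    using insert.prems(1) that unfolding unitriangular_def by blast
  define w where "w = inverse (M s s)"
  have w: "M s s * w = 1" "w \<in> filtration 0" using filtration_unit[OF Md[of s]] unfolding w_def by auto
  \<comment> \<open>The Schur complement of the pivot, together with the right-hand side left after
    eliminating the unknown at \<open>s\<close>.\<close>
  define M' where "M' a b = M a b - M a s * w * M s b" for a b
  define v' where "v' a = v a - M a s * w * v s" for a
  have "unitriangular h S M'"
    unfolding unitriangular_def
  proof (intro ballI conjI impI)
    fix a b assume ab: "a \<in> S" "b \<in> S"
    have ne: "a \<noteq> s" "b \<noteq> s" using ab insert.hyps(2) by auto
    show "M' a b \<in> filtration 0"
      unfolding M'_def using ab M0 w(2) by (intro filtration_diff filtration_mult_0(1)) auto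
    \<comment> \<open>The weight of the pivot decides: either \<open>h a \<le> h s\<close> and the
      first factor lies in \<open>filtration 1\<close>, or \<open>h s < h a \<le> h b\<close> and
      the last one does.\<close>
    have *: "M a s * w * M s b \<in> filtration 1" if "h a \<le> h b"
    proof (cases "h a \<le> h s")
      case True
      then show ?thesis using M1[of a s] M0[of s b] ab ne w(2)
        by (intro filtration_mult_0(2)[of "M a s * w"] filtration_mult_0(2)[of "M a s"]) auto
    next
      case False
      then show ?thesis using M1[of s b] M0[of a s] ab ne w(2) that
        by (intro filtration_mult_0(3)[of "M a s * w"] filtration_mult_0(1)[of "M a s"]) auto
    qed
    show "M' a b - 1 \<in> filtration 1" if "a = b"
    proof -
      have eq: "M' a b - 1 = (M a a - 1) - M a s * w * M s b" using that unfolding M'_def by simp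
      have "M a a - 1 \<in> filtration 1" using Md[of a] ab by blast
      moreover have "M a s * w * M s b \<in> filtration 1" by (rule *) (use that in simp)
      ultimately show ?thesis unfolding eq by (rule filtration_diff)
    qed
    show "M' a b \<in> filtration 1" if "a \<noteq> b" "h a \<le> h b"
      unfolding M'_def using M1[of a b] * ab that by (intro filtration_diff) auto
  qed
  moreover have "v' a \<in> filtration 0" if "a \<in> S" for a
    unfolding v'_def using that M0 w(2) insert.prems(2) by (intro filtration_diff filtration_mult_0(1)) auto
  ultimately obtain x where x: "\<And>a. a \<in> S \<Longrightarrow> x a \<in> filtration 0" "\<And>a. a \<in> S \<Longrightarrow> (\<Sum>b\<in>S. M' a b * x b) = v' a"
    using insert.IH[of M' v'] by blast
  define t where "t = (\<Sum>b\<in>S. M s b * x b)"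
  \<comment> \<open>Back substitution: the value at \<open>s\<close> is read off from the row of the
    pivot.\<close>
  define y where "y = x(s := w * (v s - t))"
  have y_sum: "(\<Sum>b\<in>insert s S. M a b * y b) = M a s * (w * (v s - t)) + (\<Sum>b\<in>S. M a b * x b)" for a
  proof -
    have "(\<Sum>b\<in>S. M a b * y b) = (\<Sum>b\<in>S. M a b * x b)"
      by (intro sum.cong) (use insert.hyps(2) in \<open>auto simp: y_def\<close>)
    then show ?thesis using insert.hyps by (simp add: y_def)
  qed
  have "(\<Sum>b\<in>insert s S. M a b * y b) = v a" if a: "a \<in> insert s S" for a
  proof (cases "a = s")
    case True
    show ?thesis unfolding True y_sum t_def[symmetric] by (simp add: w(1) flip: mult.assoc)
  next
    case False
    then have aS: "a \<in> S" using a by simp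
    have "(\<Sum>b\<in>S. M' a b * x b) = (\<Sum>b\<in>S. M a b * x b) - M a s * w * t"
      unfolding M'_def t_def by (simp add: algebra_simps sum_subtractf sum_distrib_left)
    then have "(\<Sum>b\<in>S. M a b * x b) = v' a + M a s * w * t" using x(2)[OF aS] by simp
    then show ?thesis unfolding y_sum v'_def by (simp add: algebra_simps)
  qed
  moreover have "y a \<in> filtration 0" if "a \<in> insert s S" for a
  proof (cases "a = s")
    case True
    have "t \<in> filtration 0" unfolding t_def using M0 x(1) by (intro filtration_sum filtration_mult_0(1)) auto
    then show ?thesis unfolding y_def using True w(2) insert.prems(2) by (auto intro!: filtration_diff filtration_mult_0(1))
  qed (use that x(1) in \<open>auto simp: y_def\<close>)
  ultimately show ?case by blast
qed

section \<open>The unit of an ideal\<close>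

lemma join_comps_self: assumes A: "A \<in> pp n" shows "join_comps n A A = n"
proof -
  have cls: "join_rel n A A `` {x} = {x, partner A x}" if x: "x \<in> nodes n" for x
  proof
    note eq = equiv_join[OF A A]
    have C: "join_rel n A A `` {x} \<in> nodes n // join_rel n A A" using x by (rule quotientI)
    have xC: "x \<in> join_rel n A A `` {x}" by (rule equiv_class_self[OF eq x])
    show "{x, partner A x} \<subseteq> join_rel n A A `` {x}" using class_closed_partner[OF A A C xC] xC by blast
    have blk: "{x, partner A x} \<in> A" by (rule partner_block[OF A x])
    have "y \<in> {x, partner A x}" if "(x, y) \<in> (block_edges A)\<^sup>*" for y
      using that
    proof (induction rule: rtrancl_induct)
      case (step y z)
      then obtain a where "a \<in> A" "y \<in> a" "z \<in> a" unfolding block_edges_def by blast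
      then show ?case using pp_block_unique[OF A blk, of a y] step.IH by blast
    qed simp
    then show "join_rel n A A `` {x} \<subseteq> {x, partner A x}" unfolding join_rel_def by auto
  qed
  have "nodes n // join_rel n A A = (\<lambda>x. {x, partner A x}) ` nodes n"
    unfolding quotient_def using cls by auto
  then have "nodes n // join_rel n A A = A" using pp_blocks_eq[OF A] by simp
  then show ?thesis by (simp add: join_comps_def card_diagram[OF A])
qed

lemma bar_eq: "bar A = scale (inverse delta ^ north A) (basis_elem A)"
  by (simp add: bar_def north_def)

lemma north_id: "north (id_diagram n) = 0"
  by (auto simp: north_def id_diagram_image)

lemma inverse_delta_cancel: "k \<le> m \<Longrightarrow> delta ^ m * inverse delta ^ (m - k) = delta ^ k"
proof -
  assume "k \<le> m"
  then have "delta ^ m * inverse delta ^ (m - k) = delta ^ k * (delta ^ (m - k) * inverse delta ^ (m - k))"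
    by (simp only: mult.assoc[symmetric] power_add[symmetric]) simp
  then show ?thesis by (simp flip: power_mult_distrib)
qed

section \<open>Ideals spanned by diagrams, and their units\<close>

text \<open>Such spans are two-sided ideals. Stability under \<open>flip\<close> supplies the test
  elements \<open>flip B\<close>, whose pairing with \<open>A\<close> is
  \<open>\<delta>^c(A, B)\<close>.\<close>

locale diagram_ideal =
  fixes n :: nat and L :: "diagram set"
  assumes L_pp: "L \<subseteq> pp n"
    and L_left: "\<And>A B. A \<in> L \<Longrightarrow> B \<in> pp n \<Longrightarrow> compose n A B \<in> L"
    and L_right: "\<And>A B. A \<in> L \<Longrightarrow> B \<in> pp n \<Longrightarrow> compose n B A \<in> L"
    and L_flip: "\<And>A. A \<in> L \<Longrightarrow> flip A \<in> L"
begin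

lemma finite_L: "finite L"
  using finite_subset[OF L_pp] by simp

lemma span_L_pp: "x \<in> span_of L \<Longrightarrow> x \<in> span_of (pp n)"
  using span_of_mono L_pp by blast

lemma ideal_mult:
  "x \<in> span_of L \<Longrightarrow> y \<in> span_of (pp n) \<Longrightarrow> brauer_mult n x y \<in> span_of L"
  "x \<in> span_of (pp n) \<Longrightarrow> y \<in> span_of L \<Longrightarrow> brauer_mult n x y \<in> span_of L"
  using brauer_mult_span[of x L y "pp n" n L] brauer_mult_span[of x "pp n" y L n L] L_left L_right by blast+

text \<open>Solving the Gram system with a unit vector on the right gives an element dual to
  \<open>D\<close>; its pairing with \<open>z\<close> is \<open>\<delta>^n\<close> times the
  coefficient of \<open>D\<close> in \<open>z\<close>.\<close>

lemma nondegenerate: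
  assumes z: "z \<in> span_of L" and zero: "\<And>w. w \<in> span_of L \<Longrightarrow> trace_form n z w = 0"
  shows "z = 0"
proof (rule poly_mapping_eqI)
  fix D
  show "Poly_Mapping.lookup z D = Poly_Mapping.lookup 0 D"
  proof (cases "D \<in> L")
    case True
    \<comment> \<open>The Gram matrix divided by \<open>\<delta>^n\<close>. Its exponents are
      strictly negative off the diagonal, so a constant weight does.\<close>
    define M where "M A B = inverse delta ^ (n - join_comps n A B)" for A B
    have "unitriangular (\<lambda>_. 0) L M"
      unfolding unitriangular_def M_def
    proof (intro ballI conjI impI)
      fix A B assume "A \<in> L" "B \<in> L"
      then have AB: "A \<in> pp n" "B \<in> pp n" using L_pp by auto
      show "inverse delta ^ (n - join_comps n A B) \<in> filtration 0" by (rule inverse_delta_power)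
      show "inverse delta ^ (n - join_comps n A B) - 1 \<in> filtration 1" if "A = B"
        using join_comps_self[OF AB(1)] that by simp
      show "inverse delta ^ (n - join_comps n A B) \<in> filtration 1" if "A \<noteq> B"
        by (rule inverse_delta_power(2)) (use join_comps_self_le(2)[OF AB that] in simp)
    qed
    then obtain y where y: "\<And>A. A \<in> L \<Longrightarrow> (\<Sum>B\<in>L. M A B * y B) = of_bool (A = D)"
      using unitriangular_solvable[OF finite_L, of "\<lambda>_. 0" M "\<lambda>A. of_bool (A = D)"] by fastforce
    define w where "w = (\<Sum>B\<in>L. scale (y B) (basis_elem (flip B)))"
    have "w \<in> span_of L" unfolding w_def by (intro span_of_sum span_of_scale) (simp add: L_flip)
    then have "0 = trace_form n z w" using zero by simp
    also have "\<dots> = (\<Sum>A\<in>L. Poly_Mapping.lookup z A * trace_form n (basis_elem A) w)"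
    proof -
      have "Poly_Mapping.keys z \<subseteq> L" using z by (simp add: span_of_def)
      have lin: "trace_form n (\<Sum>A\<in>T. f A) w = (\<Sum>A\<in>T. trace_form n (f A) w)"
        for f :: "diagram \<Rightarrow> brauer_elem" and T
        by (induction T rule: infinite_finite_induct) auto
      show ?thesis
        by (subst basis_expansion[OF finite_L \<open>Poly_Mapping.keys z \<subseteq> L\<close>]) (simp add: lin)
    qed
    also have "\<dots> = (\<Sum>A\<in>L. Poly_Mapping.lookup z A * (delta ^ n * of_bool (A = D)))"
    proof (intro sum.cong refl arg_cong2[where f = "(*)"])
      fix A assume A: "A \<in> L"
      have lin: "trace_form n x (\<Sum>B\<in>T. f B) = (\<Sum>B\<in>T. trace_form n x (f B))"
        for x and f :: "diagram \<Rightarrow> brauer_elem" and T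
        by (induction T rule: infinite_finite_induct) auto
      have "trace_form n (basis_elem A) w = (\<Sum>B\<in>L. y B * trace_form n (basis_elem A) (basis_elem (flip B)))"
        unfolding w_def by (simp add: lin)
      also have "\<dots> = (\<Sum>B\<in>L. delta ^ n * (M A B * y B))"
      proof (intro sum.cong refl)
        fix B assume "B \<in> L"
        then have AB: "A \<in> pp n" "B \<in> pp n" using A L_pp by auto
        have "trace_form n (basis_elem A) (basis_elem (flip B)) = delta ^ join_comps n A B"
          using trace_form_basis[OF AB(1) flip_pp[OF AB(2)]] by simp
        also have "\<dots> = delta ^ n * M A B"
          unfolding M_def using inverse_delta_cancel[OF join_comps_self_le(1)[OF AB]] by simp
        finally show "y B * trace_form n (basis_elem A) (basis_elem (flip B)) = delta ^ n * (M A B * y B)"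
          by simp
      qed
      also have "\<dots> = delta ^ n * of_bool (A = D)" using y[OF A] by (simp flip: sum_distrib_left)
      finally show "trace_form n (basis_elem A) w = delta ^ n * of_bool (A = D)" .
    qed
    also have "\<dots> = (\<Sum>A\<in>L. if A = D then Poly_Mapping.lookup z D * delta ^ n else 0)"
      by (intro sum.cong) auto
    also have "\<dots> = Poly_Mapping.lookup z D * delta ^ n" using True finite_L by simp
    finally show ?thesis by simp
  next
    case False
    then show ?thesis using z lookup_eq_0[of z L D] by (simp add: span_of_def)
  qed
qed

text \<open>
  The unit of the ideal is the orthogonal projection of 1 with respect to the trace form. In
  terms of the elements \<open>bar B\<close>, the Gram matrix is unitriangular modulo \<open>filtration 1\<close>.
\<close>

lemma ideal_unit:
  shows "\<exists>y. (\<forall>B\<in>L. y B \<in> integral_scalars) \<and>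
    (\<forall>x\<in>span_of L. brauer_mult n (\<Sum>B\<in>L. scale (y B) (bar B)) x = x \<and>
      brauer_mult n x (\<Sum>B\<in>L. scale (y B) (bar B)) = x)"
proof -
  \<comment> \<open>Row \<open>A\<close> of the Gram system is divided by
    \<open>\<delta>^(n - north A)\<close>, which leaves \<open>\<delta>^(-k)\<close> as the
    coefficient of \<open>bar B\<close>. By \<open>join_comps_north\<close> the subtraction of
    naturals does not truncate.\<close>
  define k where "k A B = n + north B - (north A + join_comps n A B)" for A B
  have k: "north A + join_comps n A B \<le> n + north B" if "A \<in> pp n" "B \<in> pp n" for A B
    using join_comps_north[OF that] by simp
  define M where "M A B = inverse delta ^ k A B" for A B
  have "unitriangular north L M"
    unfolding unitriangular_def M_def
  proof (intro ballI conjI impI)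
    fix A B assume "A \<in> L" "B \<in> L"
    then have AB: "A \<in> pp n" "B \<in> pp n" using L_pp by auto
    show "inverse delta ^ k A B \<in> filtration 0" by (rule inverse_delta_power)
    show "inverse delta ^ k A B - 1 \<in> filtration 1" if "A = B"
      using join_comps_self[OF AB(1)] that by (simp add: k_def)
    show "inverse delta ^ k A B \<in> filtration 1" if "A \<noteq> B" "north A \<le> north B"
      by (rule inverse_delta_power(2)) (use join_comps_self_le(2)[OF AB that(1)] that(2) in \<open>simp add: k_def\<close>)
  qed
  \<comment> \<open>The right-hand side is the column of the identity diagram: it has no northern
    arcs, so \<open>bar\<close> leaves it unchanged.\<close>
  moreover have "M A (id_diagram n) \<in> filtration 0" for A unfolding M_def by (rule inverse_delta_power)
  ultimately obtain y where y0: "\<forall>B\<in>L. y B \<in> filtration 0"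
    and y: "\<And>A. A \<in> L \<Longrightarrow> (\<Sum>B\<in>L. M A B * y B) = M A (id_diagram n)"
    using unitriangular_solvable[OF finite_L, of north M "\<lambda>A. M A (id_diagram n)"] by blast
  define e where "e = (\<Sum>B\<in>L. scale (y B) (bar B))"
  define one where "one = basis_elem (id_diagram n)"
  have one: "one \<in> span_of (pp n)" by (simp add: one_def id_diagram_pp)
  have one_left: "brauer_mult n one x = x" and one_right: "brauer_mult n x one = x"
    if "x \<in> span_of (pp n)" for x
    unfolding one_def using brauer_mult_one[OF that] by simp_all
  have e_L: "e \<in> span_of L" unfolding e_def bar_eq by (intro span_of_sum span_of_scale) simp
  note e_pp = span_L_pp[OF e_L]
  have gram: "inverse delta ^ north B * delta ^ join_comps n B A = delta ^ n * inverse delta ^ north A * M A B"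
    if A: "A \<in> pp n" and B: "B \<in> pp n" for A B
  proof -
    have "delta ^ (n + north B) * M A B = delta ^ (north A + join_comps n A B)"
      unfolding M_def k_def by (rule inverse_delta_cancel[OF k[OF A B]])
    then have "delta ^ n * delta ^ north B * M A B = delta ^ north A * delta ^ join_comps n B A"
      by (simp add: power_add join_comps_sym[of n A B])
    then show ?thesis by (simp add: field_simps power_inverse)
  qed
  \<comment> \<open>The equations solved by \<open>y\<close>, in the row of \<open>flip C\<close>:
    tested against the ideal, \<open>e\<close> and 1 are indistinguishable.\<close>
  have form: "trace_form n e w = trace_form n one w" if "w \<in> span_of L" for w
    using that
  proof (induction w rule: span_of_induct)
    case (basis C)
    then have A: "flip C \<in> L" "flip C \<in> pp n" "C \<in> pp n" using L_flip L_pp flip_pp by auto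
    have lin: "trace_form n (\<Sum>B\<in>T. f B) x = (\<Sum>B\<in>T. trace_form n (f B) x)"
      for x and f :: "diagram \<Rightarrow> brauer_elem" and T
      by (induction T rule: infinite_finite_induct) auto
    have "trace_form n e (basis_elem C) =
        (\<Sum>B\<in>L. y B * (inverse delta ^ north B * trace_form n (basis_elem B) (basis_elem C)))"
      unfolding e_def bar_eq by (simp add: lin mult.assoc)
    also have "\<dots> = (\<Sum>B\<in>L. delta ^ n * inverse delta ^ north (flip C) * (M (flip C) B * y B))"
    proof (intro sum.cong refl)
      fix B assume "B \<in> L"
      then have B: "B \<in> pp n" using L_pp by auto
      have "trace_form n (basis_elem B) (basis_elem C) = delta ^ join_comps n B (flip C)"
        by (rule trace_form_basis[OF B A(3)])
      then show "y B * (inverse delta ^ north B * trace_form n (basis_elem B) (basis_elem C)) =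
          delta ^ n * inverse delta ^ north (flip C) * (M (flip C) B * y B)"
        using gram[OF A(2) B] by (simp only: mult_ac)
    qed
    also have "\<dots> = delta ^ n * inverse delta ^ north (flip C) * M (flip C) (id_diagram n)"
      using y[OF A(1)] by (simp flip: sum_distrib_left)
    also have "\<dots> = trace_form n one (basis_elem C)"
      unfolding one_def trace_form_basis[OF id_diagram_pp A(3)]
      using gram[OF A(2) id_diagram_pp] by (simp add: north_id)
    finally show ?case .
  qed simp_all
  have "brauer_mult n e x = x \<and> brauer_mult n x e = x" if x: "x \<in> span_of L" for x
  proof
    note x_pp = span_L_pp[OF x]
    \<comment> \<open>By associativity the pairing of \<open>e x\<close> with \<open>w\<close> is
      that of \<open>e\<close> with \<open>x w\<close>, which lies in the ideal, so \<open>e\<close>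
      may be replaced by 1.\<close>
    have "brauer_mult n e x - x = 0"
    proof (rule nondegenerate)
      show "brauer_mult n e x - x \<in> span_of L" using ideal_mult(1)[OF e_L x_pp] x by (rule span_of_diff)
      fix w assume w: "w \<in> span_of L"
      note w_pp = span_L_pp[OF w]
      have "trace_form n (brauer_mult n e x) w = trace_form n one (brauer_mult n x w)"
        unfolding trace_form_assoc[OF e_pp x_pp w_pp] by (rule form) (rule ideal_mult(1)[OF x w_pp])
      also have "\<dots> = trace_form n x w"
        by (simp only: trace_form_assoc[OF one x_pp w_pp, symmetric] one_left[OF x_pp])
      finally show "trace_form n (brauer_mult n e x - x) w = 0" by (simp add: trace_form_diff)
    qed
    then show "brauer_mult n e x = x" by simp
    \<comment> \<open>Symmetry of the form brings \<open>e\<close> to the front: the pairing of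
      \<open>x e\<close> with \<open>w\<close> is that of \<open>e\<close> with
      \<open>w x\<close>.\<close>
    have "brauer_mult n x e - x = 0"
    proof (rule nondegenerate)
      show "brauer_mult n x e - x \<in> span_of L" using ideal_mult(1)[OF x e_pp] x by (rule span_of_diff)
      fix w assume w: "w \<in> span_of L"
      note w_pp = span_L_pp[OF w]
      have "trace_form n (brauer_mult n x e) w = trace_form n w (brauer_mult n x e)" by (rule trace_form_sym)
      also have "\<dots> = trace_form n e (brauer_mult n w x)"
        unfolding trace_form_assoc[OF w_pp x_pp e_pp, symmetric] by (rule trace_form_sym)
      also have "\<dots> = trace_form n one (brauer_mult n w x)" by (rule form) (rule ideal_mult(1)[OF w x_pp])
      also have "\<dots> = trace_form n (brauer_mult n w x) one" by (rule trace_form_sym)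
      also have "\<dots> = trace_form n w x"
        by (simp only: trace_form_assoc[OF w_pp x_pp one] one_right[OF x_pp])
      also have "\<dots> = trace_form n x w" by (rule trace_form_sym)
      finally show "trace_form n (brauer_mult n x e - x) w = 0" by (simp add: trace_form_diff)
    qed
    then show "brauer_mult n x e = x" by simp
  qed
  then show ?thesis using y0 unfolding e_def integral_scalars_eq by (intro exI[of _ y]) blast
qed

end

lemma diagram_ideal_le:
  assumes "l \<le> n" "even (n - l)" shows "diagram_ideal n (pair_partitions_le n l)"
proof
  note iff = pair_partitions_le_iff[OF assms]
  show "pair_partitions_le n l \<subseteq> pp n" by (simp add: pair_partitions_le_def)
  show "compose n A B \<in> pair_partitions_le n l" "compose n B A \<in> pair_partitions_le n l"
    if "A \<in> pair_partitions_le n l" "B \<in> pp n" for A B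
    using that north_compose[of A n B] north_compose[of B n A] unfolding iff
    by (auto intro: compose_pair_partitions)
  show "flip A \<in> pair_partitions_le n l" if "A \<in> pair_partitions_le n l" for A
    using that flip_pp north_flip unfolding iff by auto
qed

section \<open>The integral form contains the normalised diagrams\<close>

lemma sigma_eq:
  assumes "i \<in> {1..n - 1}"
  shows "sigma n i = perm_elem n (Transposition.transpose i (i + 1))"
proof -
  let ?\<tau> = "Transposition.transpose i (i + 1)"
  have i: "i \<in> {1..n}" "i + 1 \<in> {1..n}" using assms by auto
  then have "{1..n} = ({1..n} - {i, i + 1}) \<union> {i, i + 1}" by auto
  then have "perm_diagram n ?\<tau> = (\<lambda>k. {Top (?\<tau> k), Bot k}) ` (({1..n} - {i, i + 1}) \<union> {i, i + 1})"
    unfolding perm_diagram_eq by simp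
  also have "\<dots> = (\<lambda>k. {Top k, Bot k}) ` ({1..n} - {i, i + 1}) \<union> {{Top (i + 1), Bot i}, {Top i, Bot (i + 1)}}"
  proof -
    have "(\<lambda>k. {Top (?\<tau> k), Bot k}) ` ({1..n} - {i, i + 1}) = (\<lambda>k. {Top k, Bot k}) ` ({1..n} - {i, i + 1})"
      by (intro image_cong refl) (auto simp: transpose_def)
    then show ?thesis by (simp add: image_Un)
  qed
  also have "(\<lambda>k. {Top k, Bot k}) ` ({1..n} - {i, i + 1}) = id_diagram n - {{Top i, Bot i}, {Top (i + 1), Bot (i + 1)}}"
  proof -
    have "inj (\<lambda>k. {Top k, Bot k})" by (auto intro!: injI simp: doubleton_eq_iff)
    from image_set_diff[OF this, of "{1..n}" "{i, i + 1}"] show ?thesis by (simp add: id_diagram_image)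
  qed
  finally show ?thesis by (simp add: sigma_def sigma_diagram_def insert_commute)
qed

definition integral_carrier :: "nat \<Rightarrow> brauer_elem set" where
  "integral_carrier n = carrier (integral_brauer n)"

context
  fixes n :: nat
begin

lemma integral_carrier_eq: "integral_carrier n =
    \<Inter>{S. integral_subalgebra n S \<and> sigma n ` {1..n - 1} \<union> u_bar n ` {1..n - 1} \<subseteq> S}"
  by (simp add: integral_carrier_def integral_brauer_def)

lemma u_bar_eq: "u_bar n i = scale (inverse delta) (basis_elem (cup_diagram n i (i + 1)))"
  by (simp add: u_bar_def u_diagram_eq)

lemma u_bar_span: "i \<in> {1..n - 1} \<Longrightarrow> u_bar n i \<in> span_of (pp n)"
  unfolding u_bar_eq by (intro span_of_scale) (simp, rule cup_diagram_pp, auto)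

text \<open>This puts a member into the family whose intersection is the integral form, so that the
  intersection is a subring of the Brauer algebra.\<close>

lemma span_integral_subalgebra:
  "integral_subalgebra n (span_of (pp n))"
  "sigma n ` {1..n - 1} \<union> u_bar n ` {1..n - 1} \<subseteq> span_of (pp n)"
proof -
  interpret ring "brauer n" by (rule ring_brauer)
  show "integral_subalgebra n (span_of (pp n))"
    unfolding integral_subalgebra_def using carrier_is_subring span_of_scale by (simp add: carrier_brauer)
  have "sigma n i \<in> span_of (pp n)" if "i \<in> {1..n - 1}" for i
    unfolding sigma_eq[OF that] using that by (simp, intro perm_diagram_pp permutes_swap_id) auto
  then show "sigma n ` {1..n - 1} \<union> u_bar n ` {1..n - 1} \<subseteq> span_of (pp n)"
    using u_bar_span by blast
qed

lemma subring_integral_carrier: "subring (integral_carrier n) (brauer n)"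
proof -
  interpret ring "brauer n" by (rule ring_brauer)
  show ?thesis unfolding integral_carrier_eq
    by (rule subring_Inter) (use span_integral_subalgebra in \<open>auto simp: integral_subalgebra_def\<close>)
qed

lemma integral_brauer_eq: "integral_brauer n = (brauer n)\<lparr>carrier := integral_carrier n\<rparr>"
  by (simp add: integral_carrier_def integral_brauer_def)

lemma ring_integral_brauer: "ring (integral_brauer n)"
  unfolding integral_brauer_eq by (rule ring.subring_is_ring[OF ring_brauer subring_integral_carrier])

lemma integral_brauer_simps [simp]:
  "x \<otimes>\<^bsub>integral_brauer n\<^esub> y = brauer_mult n x y" "\<one>\<^bsub>integral_brauer n\<^esub> = basis_elem (id_diagram n)"
  "\<zero>\<^bsub>integral_brauer n\<^esub> = 0" "x \<oplus>\<^bsub>integral_brauer n\<^esub> y = x + y" "carrier (integral_brauer n) = integral_carrier n"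
  by (simp_all add: integral_brauer_eq brauer_def)

lemma integral_carrier_span: "integral_carrier n \<subseteq> span_of (pp n)"
  using subringE(1)[OF subring_integral_carrier] by (simp add: carrier_brauer)

lemma integral_carrier_mult:
  "x \<in> integral_carrier n \<Longrightarrow> y \<in> integral_carrier n \<Longrightarrow> brauer_mult n x y \<in> integral_carrier n"
  using subringE(6)[OF subring_integral_carrier] by simp

lemma integral_carrier_add:
  "x \<in> integral_carrier n \<Longrightarrow> y \<in> integral_carrier n \<Longrightarrow> x + y \<in> integral_carrier n"
  using subringE(7)[OF subring_integral_carrier] by simp

lemma integral_carrier_one: "basis_elem (id_diagram n) \<in> integral_carrier n"
  using subringE(3)[OF subring_integral_carrier] by simp

lemma integral_carrier_scale:
  "c \<in> integral_scalars \<Longrightarrow> x \<in> integral_carrier n \<Longrightarrow> scale c x \<in> integral_carrier n"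
  unfolding integral_carrier_eq integral_subalgebra_def by blast

lemma integral_carrier_gens:
  "i \<in> {1..n - 1} \<Longrightarrow> sigma n i \<in> integral_carrier n" "i \<in> {1..n - 1} \<Longrightarrow> u_bar n i \<in> integral_carrier n"
  unfolding integral_carrier_eq by blast+

text \<open>Induction on the distance: with k = j - 1, the transposition (i j) is the conjugate of
  (i k) by the adjacent transposition (k j).\<close>

lemma transposition_integral:
  assumes "i \<in> {1..n}" "j \<in> {1..n}" "i < j"
  shows "perm_elem n (Transposition.transpose i j) \<in> integral_carrier n"
  using assms
proof (induction "j - i" arbitrary: j rule: less_induct)
  case less
  show ?case
  proof (cases "j = i + 1")
    case True
    then show ?thesis using integral_carrier_gens(1)[of i] sigma_eq[of i n] less.prems by simp
  next
    case False
    define k where "k = j - 1"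
    have k: "j = k + 1" "i < k" "k \<in> {1..n - 1}" "k \<in> {1..n}" using False less.prems unfolding k_def by auto
    let ?s = "Transposition.transpose k (k + 1)" and ?t = "Transposition.transpose i k"
    have s: "perm_elem n ?s \<in> integral_carrier n"
      using integral_carrier_gens(1)[OF k(3)] sigma_eq[OF k(3)] by simp
    have t: "perm_elem n ?t \<in> integral_carrier n"
      using less.hyps[of k] k less.prems by simp
    have perm: "?s permutes {1..n}" "?t permutes {1..n}"
      using k less.prems by (auto intro!: permutes_swap_id)
    have "Transposition.transpose i j = ?s \<circ> (?t \<circ> ?s)"
      using k by (auto simp: transpose_def fun_eq_iff)
    then have "perm_elem n (Transposition.transpose i j) =
        brauer_mult n (perm_elem n ?s) (brauer_mult n (perm_elem n ?t) (perm_elem n ?s))"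
      using perm_elem_mult[OF perm(2) perm(1)] perm_elem_mult[OF perm(1) permutes_compose[OF perm(1) perm(2)]] by simp
    then show ?thesis using s t by (simp add: integral_carrier_mult)
  qed
qed

lemma perm_integral:
  assumes "\<sigma> permutes {1..n}"
  shows "perm_elem n \<sigma> \<in> integral_carrier n"
  using assms finite_atLeastAtMost
proof (induction rule: permutes_induct)
  case id
  show ?case unfolding perm_diagram_id by (rule integral_carrier_one)
next
  case (swap a b p)
  have \<tau>: "Transposition.transpose a b permutes {1..n}" using swap by (intro permutes_swap_id) auto
  have "perm_elem n (Transposition.transpose a b) \<in> integral_carrier n"
    using transposition_integral[of a b] transposition_integral[of b a] swap
    by (cases a b rule: linorder_cases) (auto simp: transpose_commute)
  from integral_carrier_mult[OF this \<open>perm_elem n p \<in> integral_carrier n\<close>]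
  show ?case unfolding perm_elem_mult[OF \<tau> \<open>p permutes {1..n}\<close>] .
qed

lemma map_diagram_cup:
  assumes \<sigma>: "\<sigma> permutes {1..n}"
  shows "map_diagram (relabel \<sigma>) (cup_diagram n i j) = cup_diagram n (\<sigma> i) (\<sigma> j)"
proof -
  have "\<sigma> ` ({1..n} - {i, j}) = {1..n} - {\<sigma> i, \<sigma> j}"
    using image_set_diff[OF permutes_inj[OF \<sigma>], of "{1..n}" "{i, j}"] permutes_image[OF \<sigma>] by simp
  then have "(\<lambda>k. {Top k, Bot k}) ` ({1..n} - {\<sigma> i, \<sigma> j}) = (\<lambda>k. {Top (\<sigma> k), Bot (\<sigma> k)}) ` ({1..n} - {i, j})"
    by (metis (no_types, lifting) image_cong image_image)
  then show ?thesis
    by (simp add: cup_diagram_image map_diagram_def image_Un image_image)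
qed

lemma cup_integral:
  assumes ij: "i \<in> {1..n}" "j \<in> {1..n}" "i \<noteq> j"
  shows "scale (inverse delta) (basis_elem (cup_diagram n i j)) \<in> integral_carrier n"
proof -
  have n: "2 \<le> n" using ij by auto
  \<comment> \<open>\<open>c\<close> is where the first transposition sends 2. The second one moves
    it on to j and leaves i in place, so \<open>\<sigma>\<close> sends 1 and 2 to i and j.\<close>
  define c where "c = Transposition.transpose 1 i 2"
  define \<sigma> where "\<sigma> = Transposition.transpose c j \<circ> Transposition.transpose 1 i"
  have c: "c \<in> {1..n}" "c \<noteq> i" using ij n unfolding c_def transpose_def by auto
  have \<sigma>: "\<sigma> permutes {1..n}"
    unfolding \<sigma>_def using ij c n by (intro permutes_compose permutes_swap_id) auto
  have "\<sigma> 1 = Transposition.transpose c j i" "\<sigma> 2 = Transposition.transpose c j c"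
    unfolding \<sigma>_def by (simp_all add: c_def)
  then have "\<sigma> 1 = i" "\<sigma> 2 = j" using c(2) ij(3) by (simp_all add: transpose_def)
  then have "map_diagram (relabel \<sigma>) (cup_diagram n 1 2) = cup_diagram n i j"
    using map_diagram_cup[OF \<sigma>, of 1 2] by simp
  moreover have "cup_diagram n 1 2 \<in> pp n" using n by (intro cup_diagram_pp) auto
  ultimately have "scale (inverse delta) (basis_elem (cup_diagram n i j)) =
      brauer_mult n (brauer_mult n (perm_elem n \<sigma>) (u_bar n 1)) (perm_elem n (Hilbert_Choice.inv \<sigma>))"
    using perm_conj_basis[OF \<sigma>, of "cup_diagram n 1 2"]
    by (simp add: u_bar_eq brauer_mult_scale_left brauer_mult_scale_right numeral_2_eq_2)
  moreover have "u_bar n 1 \<in> integral_carrier n" using n by (intro integral_carrier_gens) auto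
  ultimately show ?thesis
    using perm_integral[OF \<sigma>] perm_integral[OF permutes_inv[OF \<sigma>]] by (simp add: integral_carrier_mult)
qed

text \<open>Without northern arcs there are no southern ones either, so every pair is a line and the
  partners of the bottom nodes form a permutation.\<close>

lemma north_0_perm:
  assumes A: "A \<in> pp n" and "north A = 0"
  obtains \<sigma> where "\<sigma> permutes {1..n}" "A = perm_diagram n \<sigma>"
proof -
  have "card {a \<in> A. tp a = Northern} = 0" "card {a \<in> A. tp a = Southern} = 0"
    using card_types(2)[OF A] assms(2) unfolding north_def by (simp_all only:)
  then have "{a \<in> A. tp a = Northern} = {}" "{a \<in> A. tp a = Southern} = {}"
    using finite_diagram[OF A] by (simp_all only: card_0_eq finite_Collect_conjI[OF disjI1] Collect_mem_eq)
  then have tpP: "tp a = Propagating" if "a \<in> A" for a using that pair_type.exhaust by blast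
  \<comment> \<open>The case \<open>Bot j\<close> occurs only outside the range 1 to n, where
    \<open>partner\<close> is the identity and hence \<open>\<sigma>\<close> is too.\<close>
  define \<sigma> where "\<sigma> i = (case partner A (Bot i) of Top j \<Rightarrow> j | Bot j \<Rightarrow> j)" for i
  have top: "partner A (Bot i) = Top (\<sigma> i)" if "i \<in> {1..n}" for i
  proof -
    have "{Bot i, partner A (Bot i)} \<in> A" using that by (intro partner_block[OF A]) auto
    then have "tp {Bot i, partner A (Bot i)} = Propagating" by (rule tpP)
    then show ?thesis by (cases "partner A (Bot i)") (auto simp: \<sigma>_def)
  qed
  have into: "\<sigma> i \<in> {1..n}" if "i \<in> {1..n}" for i
    using partner_nodes[OF A, of "Bot i"] that top[OF that] by simp
  have "inj_on \<sigma> {1..n}"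
  proof (rule inj_onI)
    fix i j assume ij: "i \<in> {1..n}" "j \<in> {1..n}" "\<sigma> i = \<sigma> j"
    then have "partner A (Bot i) = partner A (Bot j)" using top by simp
    then have "Bot i = Bot j" using partner_partner[OF A] by metis
    then show "i = j" by simp
  qed
  then have "bij_betw \<sigma> {1..n} {1..n}"
    using into by (intro bij_betw_imageI endo_inj_surj) auto
  moreover have "\<sigma> i = i" if "i \<notin> {1..n}" for i
    using partner_outside[OF A, of "Bot i"] that by (auto simp: \<sigma>_def)
  ultimately have \<sigma>: "\<sigma> permutes {1..n}" by (rule bij_imp_permutes)
  have "{Top (\<sigma> i), Bot i} \<in> A" if "i \<in> {1..n}" for i
    using partner_block[OF A, of "Bot i"] that top[OF that] by (simp add: insert_commute)
  then have "perm_diagram n \<sigma> \<subseteq> A" unfolding perm_diagram_eq by blast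
  then have "perm_diagram n \<sigma> = A" by (rule pair_partitions_eqI[OF perm_diagram_pp[OF \<sigma>] A])
  then show thesis using that \<sigma> by blast
qed

text \<open>A diagram with an arc is a cup below a diagram with one northern arc less.\<close>

lemma bar_integral:
  assumes "A \<in> pp n"
  shows "bar A \<in> integral_carrier n"
  using assms
proof (induction "north A" arbitrary: A)
  case 0
  then obtain \<sigma> where "\<sigma> permutes {1..n}" "A = perm_diagram n \<sigma>" using north_0_perm by metis
  then show ?case using perm_integral 0 by (simp add: bar_eq)
next
  case (Suc h)
  note A = \<open>A \<in> pp n\<close>
  have "card {a \<in> A. tp a = Northern} \<noteq> 0" "card {a \<in> A. tp a = Southern} \<noteq> 0"
    using card_types(2)[OF A] Suc.hyps(2) by (auto simp: north_def)
  then obtain a b where a: "a \<in> A" "tp a = Northern" and b: "b \<in> A" "tp b = Southern"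
    by (metis (mono_tags, lifting) Collect_empty_eq card.empty)
  obtain k l where kl: "a = {Top k, Top l}" "k \<noteq> l" using pp_block_cases[OF A a(1)] a(2) by cases auto
  obtain i j where ij: "b = {Bot i, Bot j}" "i \<noteq> j" using pp_block_cases[OF A b(1)] b(2) by cases auto
  define R where "R = A - {a, b}"
  have A_eq: "A = R \<union> {a, b}" unfolding R_def using a b by blast
  have range: "k \<in> {1..n}" "l \<in> {1..n}" "i \<in> {1..n}" "j \<in> {1..n}"
    using pp_blockD(2)[OF A a(1)] pp_blockD(2)[OF A b(1)] kl ij by auto
  have rest: "Top k \<notin> c" "Top l \<notin> c" "Bot i \<notin> c" "Bot j \<notin> c" if "c \<in> R" for c
    using that pp_block_unique[OF A _ a(1), of c] pp_block_unique[OF A _ b(1), of c] kl ij unfolding R_def by blast+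
  \<comment> \<open>Exchanging \<open>Bot i\<close> and \<open>Top l\<close> turns the two arcs into
    two lines, which a cup at i and j joins to the same arcs again.\<close>
  define \<tau> where "\<tau> = Transposition.transpose (Bot i) (Top l)"
  define A0 where "A0 = map_diagram \<tau> A"
  have A0_eq: "A0 = R \<union> {{Top k, Bot i}, {Top l, Bot j}}"
  proof -
    have "\<tau> ` c = c" if "c \<in> R" for c
    proof -
      have "\<tau> x = x" if "x \<in> c" for x
        using rest[OF \<open>c \<in> R\<close>] that unfolding \<tau>_def by (metis transpose_apply_other)
      then show ?thesis by auto
    qed
    then have "map_diagram \<tau> R = R" unfolding map_diagram_def by simp
    moreover have "map_diagram \<tau> {a, b} = {{Top k, Bot i}, {Top l, Bot j}}"
      using kl ij unfolding map_diagram_def \<tau>_def by (simp add: transpose_def insert_commute)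
    ultimately show ?thesis unfolding A0_def by (subst A_eq) (simp only: map_diagram_def image_Un)
  qed
  have "bij_betw \<tau> (nodes n) (nodes n)"
    unfolding \<tau>_def using range by (intro permutes_imp_bij permutes_swap_id) auto
  then have A0: "A0 \<in> pp n" unfolding A0_def by (rule map_diagram_pp[OF A])
  have in_A0: "{Top k, Bot i} \<in> A0" "{Top l, Bot j} \<in> A0" unfolding A0_eq by auto
  have notin: "{Top k, Bot i} \<notin> R" "{Top l, Bot j} \<notin> R" using rest by blast+
  have A_cut: "(A0 - {{Top k, Bot i}, {Top l, Bot j}}) \<union> {{Top k, Top l}, {Bot i, Bot j}} = A"
    using notin unfolding A0_eq by (subst A_eq) (auto simp: kl ij)
  have "north A = Suc (north A0)"
  proof -
    have "{c \<in> A. tp c = Northern} = insert a {c \<in> R. tp c = Northern}" using a(2) b(2) A_eq by auto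
    moreover have "{c \<in> A0. tp c = Northern} = {c \<in> R. tp c = Northern}" unfolding A0_eq by auto
    moreover have "a \<notin> R" "finite R" using finite_diagram[OF A] unfolding R_def by auto
    ultimately show ?thesis by (simp add: north_def)
  qed
  then have h: "h = north A0" "north A = Suc h" using Suc.hyps(2) by auto
  \<comment> \<open>No loop arises, and the factor \<open>inverse delta\<close> accounts for the one
    northern arc gained.\<close>
  have "brauer_mult n (bar A0) (scale (inverse delta) (basis_elem (cup_diagram n i j))) = bar A"
    using compose_cup_cut[OF A0 in_A0 ij(2)] loops_cup_cut[OF A0 in_A0 ij(2)] h
    unfolding A_cut
    by (simp add: bar_eq brauer_mult_scale_left brauer_mult_scale_right brauer_mult_basis mult.commute)
  then show ?case
    using integral_carrier_mult[OF Suc.hyps(1)[OF h(1) A0] cup_integral[OF range(3,4) ij(2)]] by simp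
qed

end

section \<open>The idempotents \<open>u_bar_prod\<close>\<close>

text \<open>Final segments of the product, for inductions that add factors on the left.\<close>

definition u_bar_tail :: "nat \<Rightarrow> nat \<Rightarrow> nat \<Rightarrow> brauer_elem" where
  "u_bar_tail n k h = foldr (\<lambda>j x. brauer_mult n (u_bar n (2 * j + 1)) x) [k..<h] (basis_elem (id_diagram n))"

lemma u_bar_prod_eq: "u_bar_prod n l = u_bar_tail n 0 ((n - l) div 2)"
  by (simp add: u_bar_prod_def u_bar_tail_def)

lemma u_bar_tail_Suc: "k < h \<Longrightarrow> u_bar_tail n k h = brauer_mult n (u_bar n (2 * k + 1)) (u_bar_tail n (Suc k) h)"
  by (simp add: u_bar_tail_def upt_conv_Cons)

lemma u_bar_tail_self: "u_bar_tail n h h = basis_elem (id_diagram n)"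
  by (simp add: u_bar_tail_def)

text \<open>The lines of the cup diagram at p and q carry the arc of \<open>D\<close> from the
  middle row up to the top row.\<close>

lemma cup_preserves_north:
  assumes i: "i \<in> {1..n}" "j \<in> {1..n}" "i \<noteq> j" and D: "D \<in> pp n"
    and pq: "{Top p, Top q} \<in> D" "p \<notin> {i, j}" "q \<notin> {i, j}"
  shows "{Top p, Top q} \<in> compose n (cup_diagram n i j) D"
proof (rule compose_pairI[OF cup_diagram_pp[OF i] D])
  have p: "p \<in> {1..n}" "q \<in> {1..n}" "p \<noteq> q" using pp_blockD(2)[OF D pq(1)] pp_doubleton_neq[OF D pq(1)] by auto
  have line: "{Top k, Bot k} \<in> cup_diagram n i j" if "k \<in> {1..n}" "k \<notin> {i, j}" for k
    using that unfolding cup_diagram_image by blast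
  let ?E = "stack_edges (cup_diagram n i j) D"
  have "(upper_embed (Top p), upper_embed (Bot p)) \<in> ?E" "(upper_embed (Bot q), upper_embed (Top q)) \<in> ?E"
    by (rule stack_edge_upper[OF line[OF p(1) pq(2)]], simp, simp)
      (rule stack_edge_upper[OF line[OF p(2) pq(3)]], simp, simp)
  moreover have "(lower_embed (Top p), lower_embed (Top q)) \<in> ?E"
    by (rule stack_edge_lower[OF pq(1)]) simp_all
  ultimately show "(outer_embed (Top p), outer_embed (Top q)) \<in> ?E\<^sup>*"
    by (auto intro: converse_rtrancl_into_rtrancl)
  show "Top p \<in> nodes n" "Top p \<noteq> Top q" using p by auto
qed

text \<open>The factors act at disjoint positions, so each new one adds its northern arc and keeps
  the earlier ones. The scalar is left open because membership in an ideal does not see it.\<close>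

lemma u_bar_tail_diagram:
  assumes "2 * h \<le> n" "k \<le> h"
  shows "\<exists>c. \<exists>D\<in>pp n. u_bar_tail n k h = scale c (basis_elem D) \<and>
    (\<forall>i. k \<le> i \<longrightarrow> i < h \<longrightarrow> {Top (2 * i + 1), Top (2 * i + 2)} \<in> D)"
  using assms(2)
proof (induction k rule: inc_induct)
  case base
  show ?case using id_diagram_pp by (intro exI[of _ 1] bexI[of _ "id_diagram n"]) (auto simp: u_bar_tail_self)
next
  case (step k)
  then obtain c D where D: "D \<in> pp n" "u_bar_tail n (Suc k) h = scale c (basis_elem D)"
    "\<And>i. Suc k \<le> i \<Longrightarrow> i < h \<Longrightarrow> {Top (2 * i + 1), Top (2 * i + 2)} \<in> D" by blast
  let ?C = "cup_diagram n (2 * k + 1) (2 * k + 2)"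
  have k: "2 * k + 1 \<in> {1..n}" "2 * k + 2 \<in> {1..n}" "2 * k + 1 \<noteq> 2 * k + 2" using step.hyps assms(1) by auto
  have C: "?C \<in> pp n" by (rule cup_diagram_pp[OF k])
  have "{Top (2 * i + 1), Top (2 * i + 2)} \<in> compose n ?C D" if "k \<le> i" "i < h" for i
  proof (cases "i = k")
    case True
    have "{Top (2 * k + 1), Top (2 * k + 2)} \<in> ?C" by (simp add: cup_diagram_image)
    then show ?thesis using compose_north[OF C D(1)] True by simp
  next
    case False
    then show ?thesis using that D(3)[of i] by (intro cup_preserves_north[OF k D(1)]) auto
  qed
  moreover have "u_bar_tail n k h = scale (inverse delta * c * delta ^ loops n ?C D) (basis_elem (compose n ?C D))"
    unfolding u_bar_tail_Suc[OF step.hyps(2)] D(2) u_bar_eq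
    by (simp add: brauer_mult_scale_left brauer_mult_scale_right brauer_mult_basis mult_ac)
  ultimately show ?case using compose_pair_partitions[OF C D(1)] by blast
qed

lemma u_bar_prod_ideal:
  assumes "l \<le> n" "even (n - l)"
  shows "u_bar_prod n l \<in> span_of (pair_partitions_le n l)"
proof -
  let ?h = "(n - l) div 2"
  have h: "2 * ?h \<le> n" using assms by simp
  obtain c D where D: "D \<in> pp n" "u_bar_prod n l = scale c (basis_elem D)"
    "\<And>i. i < ?h \<Longrightarrow> {Top (2 * i + 1), Top (2 * i + 2)} \<in> D"
    using u_bar_tail_diagram[OF h, of 0] unfolding u_bar_prod_eq by auto
  have "card ((\<lambda>i. {Top (2 * i + 1), Top (2 * i + 2)}) ` {..<?h}) \<le> north D"
    unfolding north_def by (rule card_mono) (use finite_diagram[OF D(1)] D(3) in auto)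
  moreover have "inj_on (\<lambda>i. {Top (2 * i + 1), Top (2 * i + 2)}) {..<?h}"
    by (rule inj_onI) (simp only: doubleton_eq_iff node.inject, presburger)
  ultimately have "?h \<le> north D" by (simp add: card_image)
  then show ?thesis unfolding D(2) using D(1) pair_partitions_le_iff[OF assms] by (intro span_of_scale) simp
qed

text \<open>Each factor meets a southern arc of \<open>A\<close> in the same position: the diagram
  is absorbed, and the loop created cancels against the factor \<open>inverse delta\<close>.\<close>

lemma absorb_u_bar_tail:
  assumes A: "A \<in> pp n" and "2 * h \<le> n" "k \<le> h"
    and arcs: "\<And>i. i < h \<Longrightarrow> {Bot (2 * i + 1), Bot (2 * i + 2)} \<in> A"
  shows "u_bar_tail n k h \<in> span_of (pp n) \<and> brauer_mult n (basis_elem A) (u_bar_tail n k h) = basis_elem A"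
  using assms(3)
proof (induction k rule: inc_induct)
  case base
  show ?case using brauer_mult_one(2)[of "basis_elem A" n] A by (simp add: u_bar_tail_self id_diagram_pp)
next
  case (step k)
  have u: "u_bar n (2 * k + 1) \<in> span_of (pp n)" using step.hyps assms(2) by (intro u_bar_span) auto
  have arc: "{Bot (2 * k + 1), Bot (2 * k + 2)} \<in> A" using arcs step.hyps by auto
  have "brauer_mult n (basis_elem A) (u_bar n (2 * k + 1)) = basis_elem A"
    using compose_cup_absorb[OF A arc] loops_cup_absorb[OF A arc]
    by (simp add: u_bar_eq brauer_mult_scale_right brauer_mult_basis)
  then have "brauer_mult n (basis_elem A) (u_bar_tail n k h) = basis_elem A"
    unfolding u_bar_tail_Suc[OF step.hyps(2)]
    using brauer_mult_assoc[of "basis_elem A" n "u_bar n (2 * k + 1)" "u_bar_tail n (Suc k) h"] A u step.IH by simp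
  then show ?case unfolding u_bar_tail_Suc[OF step.hyps(2)] using u step.IH by (simp add: brauer_mult_closed)
qed

section \<open>Characterising the unit\<close>

lemma permutes_extend:
  assumes "finite S" "X \<subseteq> S" "inj_on f X" "f ` X \<subseteq> S"
  obtains \<pi> where "\<pi> permutes S" "\<And>x. x \<in> X \<Longrightarrow> \<pi> x = f x"
proof -
  have fin: "finite X" "finite (S - X)" "finite (S - f ` X)" using assms finite_subset by auto
  have "card (S - X) = card (S - f ` X)"
    using assms fin card_image[OF assms(3)] by (simp add: card_Diff_subset)
  then obtain g where g: "bij_betw g (S - X) (S - f ` X)" using finite_same_card_bij[OF fin(2,3)] by blast
  define \<pi> where "\<pi> x = (if x \<in> X then f x else if x \<in> S then g x else x)" for x
  have "bij_betw \<pi> X (f ` X)"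
    using assms(3) by (intro bij_betw_imageI) (auto simp: \<pi>_def inj_on_def)
  moreover have "bij_betw \<pi> (S - X) (S - f ` X)"
    using g by (subst bij_betw_cong[of _ _ g]) (auto simp: \<pi>_def)
  ultimately have "bij_betw \<pi> (X \<union> (S - X)) (f ` X \<union> (S - f ` X))" by (rule bij_betw_combine) auto
  moreover have "X \<union> (S - X) = S" "f ` X \<union> (S - f ` X) = S" using assms by auto
  ultimately have "bij_betw \<pi> S S" by simp
  then have "\<pi> permutes S" by (rule bij_imp_permutes) (use assms(2) in \<open>auto simp: \<pi>_def\<close>)
  then show thesis using that by (auto simp: \<pi>_def)
qed

text \<open>Any h southern arcs can be moved to the positions of the factors of the product. Right
  multiplication by the diagram of \<open>\<sigma>\<close> relabels by the inverse, so
  \<open>\<sigma>\<close> has to map the wanted positions to the present ends.\<close>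

lemma standardise_south:
  assumes A: "A \<in> pp n" and h: "h \<le> north A"
  obtains \<sigma> where "\<sigma> permutes {1..n}"
    "\<And>i. i < h \<Longrightarrow> {Bot (2 * i + 1), Bot (2 * i + 2)} \<in> map_diagram (relabel_bot (Hilbert_Choice.inv \<sigma>)) A"
proof -
  have fin: "finite {a \<in> A. tp a = Southern}" using finite_diagram[OF A] by simp
  have "card {..<h} \<le> card {a \<in> A. tp a = Southern}" using h card_types(2)[OF A] by simp
  then obtain arc where arc: "inj_on arc {..<h}" "arc ` {..<h} \<subseteq> {a \<in> A. tp a = Southern}"
    using card_le_inj[OF finite_lessThan fin] by blast
  have "\<exists>p q. arc i = {Bot p, Bot q} \<and> p \<noteq> q" if "i < h" for i
  proof -
    have "arc i \<in> A" "tp (arc i) = Southern" using arc(2) that by auto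
    from pp_block_cases[OF A this(1)] this(2) show ?thesis by cases auto
  qed
  then obtain p q where pq: "\<And>i. i < h \<Longrightarrow> arc i = {Bot (p i), Bot (q i)}" "\<And>i. i < h \<Longrightarrow> p i \<noteq> q i"
    by metis
  have arcA: "arc i \<in> A" if "i < h" for i using arc(2) that by auto
  have same: "i = j" if "i < h" "j < h" "arc i \<inter> arc j \<noteq> {}" for i j
  proof -
    have "arc i = arc j" using pp_block_unique[OF A arcA[OF that(1)] arcA[OF that(2)]] that(3) by blast
    then show ?thesis using arc(1) that by (auto simp: inj_on_def)
  qed
  \<comment> \<open>Positions 2i + 1 and 2i + 2 are mapped to the two ends of arc i, which are
    numbered from 0.\<close>
  define f where "f x = (if odd x then p (x div 2) else q ((x - 1) div 2))" for x
  define X where "X = {1..2 * h}"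
  have f_in: "Bot (f x) \<in> arc ((x - 1) div 2)" "(x - 1) div 2 < h" if "x \<in> X" for x
  proof -
    show lt: "(x - 1) div 2 < h" using that unfolding X_def by auto
    have "odd x \<Longrightarrow> x div 2 = (x - 1) div 2" by (auto elim: oddE)
    then show "Bot (f x) \<in> arc ((x - 1) div 2)" using pq(1)[OF lt] unfolding f_def by auto
  qed
  have inj: "inj_on f X"
  proof (rule inj_onI)
    fix x y assume xy: "x \<in> X" "y \<in> X" "f x = f y"
    have "Bot (f x) \<in> arc ((x - 1) div 2) \<inter> arc ((y - 1) div 2)"
      using f_in(1)[OF xy(1)] f_in(1)[OF xy(2)] xy(3) by simp
    then have eq: "(x - 1) div 2 = (y - 1) div 2" using same[OF f_in(2)[OF xy(1)] f_in(2)[OF xy(2)]] by blast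
    have pos: "1 \<le> x" "1 \<le> y" using xy unfolding X_def by auto
    have ne: "p ((x - 1) div 2) \<noteq> q ((x - 1) div 2)" using pq(2) f_in(2)[OF xy(1)] by blast
    have par: "odd x \<longleftrightarrow> odd y"
    proof (rule ccontr)
      assume *: "\<not> (odd x \<longleftrightarrow> odd y)"
      have "odd z \<Longrightarrow> z div 2 = (z - 1) div 2" for z :: nat by (auto elim: oddE)
      then show False using * xy(3) eq ne unfolding f_def by (cases "odd x") auto
    qed
    show "x = y" using eq par pos by presburger
  qed
  have "f ` X \<subseteq> {1..n}"
  proof
    fix y assume "y \<in> f ` X"
    then obtain x where x: "x \<in> X" "y = f x" by blast
    then have "Bot y \<in> nodes n" using f_in[OF x(1)] arcA pp_blockD(2)[OF A] by blast
    then show "y \<in> {1..n}" by simp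
  qed
  moreover have "X \<subseteq> {1..n}"
    using card_types(1)[OF A] h unfolding X_def by auto
  ultimately obtain \<sigma> where \<sigma>: "\<sigma> permutes {1..n}" "\<And>x. x \<in> X \<Longrightarrow> \<sigma> x = f x"
    using permutes_extend[OF finite_atLeastAtMost _ inj] by blast
  have "{Bot (2 * i + 1), Bot (2 * i + 2)} \<in> map_diagram (relabel_bot (Hilbert_Choice.inv \<sigma>)) A" if "i < h" for i
  proof -
    have X: "2 * i + 1 \<in> X" "2 * i + 2 \<in> X" using that unfolding X_def by auto
    have "f (2 * i + 1) = p i" "f (2 * i + 2) = q i" by (simp_all add: f_def)
    then have "\<sigma> (2 * i + 1) = p i" "\<sigma> (2 * i + 2) = q i" using \<sigma>(2) X by simp_all
    then have inv: "Hilbert_Choice.inv \<sigma> (p i) = 2 * i + 1" "Hilbert_Choice.inv \<sigma> (q i) = 2 * i + 2"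
      using permutes_inverses(2)[OF \<sigma>(1)] by metis+
    have "relabel_bot (Hilbert_Choice.inv \<sigma>) ` arc i = {Bot (2 * i + 1), Bot (2 * i + 2)}"
      unfolding pq(1)[OF that] by (simp add: inv)
    then show ?thesis
      using imageI[OF arcA[OF that], of "\<lambda>a. relabel_bot (Hilbert_Choice.inv \<sigma>) ` a"] by (simp add: map_diagram_def)
  qed
  then show thesis using that \<sigma>(1) by blast
qed

lemma perm_elem_span: "\<sigma> permutes {1..n} \<Longrightarrow> perm_elem n \<sigma> \<in> span_of (pp n)"
  by (simp add: perm_diagram_pp)

lemma perm_elem_inverse:
  assumes "\<sigma> permutes {1..n}"
  shows "brauer_mult n (perm_elem n \<sigma>) (perm_elem n (Hilbert_Choice.inv \<sigma>)) = basis_elem (id_diagram n)"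
    "brauer_mult n (perm_elem n (Hilbert_Choice.inv \<sigma>)) (perm_elem n \<sigma>) = basis_elem (id_diagram n)"
  using perm_elem_mult[OF assms permutes_inv[OF assms]] perm_elem_mult[OF permutes_inv[OF assms] assms]
  by (simp_all add: permutes_inv_o[OF assms] perm_diagram_id)

text \<open>
  Every diagram in the ideal is of the form \<open>y \<cdot> u \<cdot> \<sigma>\<close>, so an invariant element that acts
  trivially on \<open>u\<close> is a right unit, hence equal to the unit.
\<close>

lemma unit_unique:
  assumes l: "l \<le> n" "even (n - l)"
  defines "L \<equiv> pair_partitions_le n l"
  assumes e: "e \<in> span_of L" "\<And>x. x \<in> span_of L \<Longrightarrow> brauer_mult n e x = x"
    and x: "x \<in> span_of L" "brauer_mult n (u_bar_prod n l) x = u_bar_prod n l"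
    and inv: "\<And>\<sigma>. \<sigma> permutes {1..n} \<Longrightarrow> brauer_mult n (perm_elem n \<sigma>) x = brauer_mult n x (perm_elem n \<sigma>)"
  shows "x = e"
proof -
  interpret diagram_ideal n L unfolding L_def by (rule diagram_ideal_le[OF l])
  let ?h = "(n - l) div 2" and ?U = "u_bar_prod n l"
  have h: "2 * ?h \<le> n" using l by simp
  have U: "?U \<in> span_of (pp n)" using span_L_pp u_bar_prod_ideal[OF l] unfolding L_def by blast
  note x_pp = span_L_pp[OF x(1)]
  have "brauer_mult n z x = z" if "z \<in> span_of L" for z
    using that
  proof (induction z rule: span_of_induct)
    case (basis A)
    then have A: "A \<in> pp n" "?h \<le> north A" using pair_partitions_le_iff[OF l] unfolding L_def by auto
    obtain \<sigma> where \<sigma>: "\<sigma> permutes {1..n}"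
      "\<And>i. i < ?h \<Longrightarrow> {Bot (2 * i + 1), Bot (2 * i + 2)} \<in> map_diagram (relabel_bot (Hilbert_Choice.inv \<sigma>)) A"
      using standardise_south[OF A] by blast
    \<comment> \<open>The southern arcs of \<open>B\<close> sit at the positions of the factors of
      \<open>?U\<close>, which \<open>B\<close> therefore absorbs from the right.\<close>
    define B where "B = map_diagram (relabel_bot (Hilbert_Choice.inv \<sigma>)) A"
    define s t where "s = perm_elem n \<sigma>" and "t = perm_elem n (Hilbert_Choice.inv \<sigma>)"
    have B: "B \<in> pp n" unfolding B_def by (rule map_diagram_pp[OF A(1) bij_relabel_bot[OF permutes_inv[OF \<sigma>(1)]]])
    have st: "s \<in> span_of (pp n)" "t \<in> span_of (pp n)"
      unfolding s_def t_def using perm_elem_span \<sigma>(1) permutes_inv[OF \<sigma>(1)] by blast+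
    have bB: "basis_elem B \<in> span_of (pp n)" "basis_elem A \<in> span_of (pp n)" using B A by simp_all
    have As: "brauer_mult n (basis_elem A) s = basis_elem B"
      unfolding s_def B_def by (rule perm_elem_mult_right[OF \<sigma>(1) A(1)])
    have Bt: "brauer_mult n (basis_elem B) t = basis_elem A"
      using brauer_mult_assoc[OF bB(2) st] perm_elem_inverse(1)[OF \<sigma>(1)] brauer_mult_one(2)[OF bB(2)]
      by (simp add: As s_def[symmetric] t_def[symmetric])
    have BU: "brauer_mult n (basis_elem B) ?U = basis_elem B"
      using absorb_u_bar_tail[OF B h, of 0] \<sigma>(2) unfolding u_bar_prod_eq B_def by simp
    have Bx: "brauer_mult n (basis_elem B) x = basis_elem B"
      using brauer_mult_assoc[OF bB(1) U x_pp] BU x(2) by simp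
    \<comment> \<open>Invariance lets \<open>x\<close> pass the permutation \<open>t\<close>: A x =
      B t x = B x t = B t = A.\<close>
    have "brauer_mult n (basis_elem A) x = brauer_mult n (brauer_mult n (basis_elem B) t) x" by (simp add: Bt)
    also have "\<dots> = brauer_mult n (basis_elem B) (brauer_mult n x t)"
      using brauer_mult_assoc[OF bB(1) st(2) x_pp] inv[OF permutes_inv[OF \<sigma>(1)]] by (simp add: t_def)
    also have "\<dots> = basis_elem A" using brauer_mult_assoc[OF bB(1) x_pp st(2)] by (simp add: Bx Bt)
    finally show ?case .
  qed (simp_all add: brauer_mult_add_left brauer_mult_scale_left)
  \<comment> \<open>At z = e the right unit property gives e x = e, and the left unit property of
    \<open>e\<close> gives e x = x.\<close>
  then show ?thesis using e x(1) by metis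
qed

text \<open>Both products equal \<open>e z e\<close>, since \<open>z e\<close> and
  \<open>e z\<close> lie in the ideal.\<close>

lemma (in diagram_ideal) unit_central:
  assumes e: "e \<in> span_of L" "\<And>x. x \<in> span_of L \<Longrightarrow> brauer_mult n e x = x \<and> brauer_mult n x e = x"
    and z: "z \<in> span_of (pp n)"
  shows "brauer_mult n z e = brauer_mult n e z"
proof -
  note e_pp = span_L_pp[OF e(1)]
  have "brauer_mult n z e = brauer_mult n e (brauer_mult n z e)" using e(2) ideal_mult(2)[OF z e(1)] by simp
  also have "\<dots> = brauer_mult n (brauer_mult n e z) e" by (rule brauer_mult_assoc[OF e_pp z e_pp, symmetric])
  also have "\<dots> = brauer_mult n e z" using e(2) ideal_mult(1)[OF e(1) z] by simp
  finally show ?thesis .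
qed

section \<open>Conjugation\<close>

lemma bij_relabel: assumes \<sigma>: "\<sigma> permutes {1..n}" shows "bij_betw (relabel \<sigma>) (nodes n) (nodes n)"
proof -
  have "relabel \<sigma> = relabel_bot \<sigma> \<circ> relabel_top \<sigma>" by (rule ext, case_tac x) auto
  then show ?thesis using bij_betw_trans[OF bij_relabel_top[OF \<sigma>] bij_relabel_bot[OF \<sigma>]] by simp
qed

lemma map_relabel_pp: "\<sigma> permutes {1..n} \<Longrightarrow> A \<in> pp n \<Longrightarrow> map_diagram (relabel \<sigma>) A \<in> pp n"
  by (rule map_diagram_pp[OF _ bij_relabel])

lemma relabel_comp: "relabel \<sigma> (relabel \<tau> x) = relabel (\<sigma> \<circ> \<tau>) x"
  by (cases x) auto

lemma map_relabel_comp: "map_diagram (relabel \<sigma>) (map_diagram (relabel \<tau>) A) = map_diagram (relabel (\<sigma> \<circ> \<tau>)) A"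
  by (simp add: map_diagram_comp comp_def[of "relabel \<sigma>"] relabel_comp)

lemma relabel_id: "relabel id = id"
  by (rule ext, case_tac x) auto

lemma map_relabel_inv:
  assumes "\<sigma> permutes {1..n}"
  shows "map_diagram (relabel (Hilbert_Choice.inv \<sigma>)) (map_diagram (relabel \<sigma>) A) = A"
    "map_diagram (relabel \<sigma>) (map_diagram (relabel (Hilbert_Choice.inv \<sigma>)) A) = A"
  by (simp_all add: map_relabel_comp permutes_inv_o[OF assms] relabel_id map_diagram_id)

lemma tp_relabel: "tp (relabel \<sigma> ` a) = tp a"
proof -
  have "relabel \<sigma> x \<in> range Top \<longleftrightarrow> x \<in> range Top" "relabel \<sigma> x \<in> range Bot \<longleftrightarrow> x \<in> range Bot" for x
    by (cases x; auto)+
  then show ?thesis unfolding tp_def by (simp add: image_subset_iff subset_eq)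
qed

lemma north_map_relabel:
  assumes \<sigma>: "\<sigma> permutes {1..n}" shows "north (map_diagram (relabel \<sigma>) A) = north A"
proof -
  have "inj (relabel \<sigma>)"
    by (rule inj_on_inverseI[of _ "relabel (Hilbert_Choice.inv \<sigma>)"])
      (simp add: relabel_comp permutes_inv_o[OF \<sigma>] relabel_id)
  then have inj: "inj (\<lambda>a. relabel \<sigma> ` a)" by (simp add: inj_image_eq_iff inj_on_def)
  have "{a \<in> map_diagram (relabel \<sigma>) A. tp a = Northern} = (\<lambda>a. relabel \<sigma> ` a) ` {a \<in> A. tp a = Northern}"
    by (auto simp: map_diagram_def tp_relabel)
  then show ?thesis unfolding north_def using card_image[OF inj_on_subset[OF inj]] by simp
qed

lemma conj_orbit_eq: "conj_orbit n A = {map_diagram (relabel \<sigma>) A | \<sigma>. \<sigma> permutes {1..n}}"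
  by (simp add: conj_orbit_def map_diagram_def)

lemma conj_orbit_self: "A \<in> conj_orbit n A"
  unfolding conj_orbit_eq using permutes_id relabel_id map_diagram_id
  by (intro CollectI exI[of _ id]) (auto simp: relabel_id map_diagram_id permutes_id)

lemma conj_orbit_map:
  assumes \<sigma>: "\<sigma> permutes {1..n}"
  shows "map_diagram (relabel \<sigma>) B \<in> conj_orbit n A \<longleftrightarrow> B \<in> conj_orbit n A"
proof
  assume "B \<in> conj_orbit n A"
  then obtain \<tau> where \<tau>: "\<tau> permutes {1..n}" "B = map_diagram (relabel \<tau>) A" unfolding conj_orbit_eq by blast
  have "map_diagram (relabel \<sigma>) B = map_diagram (relabel (\<sigma> \<circ> \<tau>)) A" unfolding \<tau>(2) by (rule map_relabel_comp)
  then show "map_diagram (relabel \<sigma>) B \<in> conj_orbit n A"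
    unfolding conj_orbit_eq using permutes_compose[OF \<tau>(1) \<sigma>] by blast
next
  assume "map_diagram (relabel \<sigma>) B \<in> conj_orbit n A"
  then obtain \<tau> where \<tau>: "\<tau> permutes {1..n}" "map_diagram (relabel \<sigma>) B = map_diagram (relabel \<tau>) A"
    unfolding conj_orbit_eq by blast
  have "B = map_diagram (relabel (Hilbert_Choice.inv \<sigma>)) (map_diagram (relabel \<tau>) A)"
    using map_relabel_inv(1)[OF \<sigma>, of B] \<tau>(2) by simp
  then have "B = map_diagram (relabel (Hilbert_Choice.inv \<sigma> \<circ> \<tau>)) A" by (simp only: map_relabel_comp)
  then show "B \<in> conj_orbit n A"
    unfolding conj_orbit_eq using permutes_compose[OF \<tau>(1) permutes_inv[OF \<sigma>]] by blast
qed

lemma conj_orbit_eqI: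
  assumes "B \<in> conj_orbit n A" shows "conj_orbit n B = conj_orbit n A"
proof -
  have sub: "conj_orbit n B \<subseteq> conj_orbit n A" if "B \<in> conj_orbit n A" for A B
  proof
    fix C assume "C \<in> conj_orbit n B"
    then obtain \<sigma> where "\<sigma> permutes {1..n}" "C = map_diagram (relabel \<sigma>) B" unfolding conj_orbit_eq by blast
    then show "C \<in> conj_orbit n A" using conj_orbit_map that by simp
  qed
  obtain \<tau> where \<tau>: "\<tau> permutes {1..n}" "B = map_diagram (relabel \<tau>) A"
    using assms unfolding conj_orbit_eq by blast
  have "A \<in> conj_orbit n B" using conj_orbit_map[OF \<tau>(1), of A B] conj_orbit_self[of B n] \<tau>(2) by simp
  then show ?thesis using sub assms by blast
qed

lemma conj_orbit_pp: "A \<in> pp n \<Longrightarrow> B \<in> conj_orbit n A \<Longrightarrow> B \<in> pp n \<and> north B = north A"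
  unfolding conj_orbit_eq using map_relabel_pp north_map_relabel by blast

definition conj_elem :: "nat \<Rightarrow> (nat \<Rightarrow> nat) \<Rightarrow> brauer_elem \<Rightarrow> brauer_elem" where
  "conj_elem n \<sigma> x = brauer_mult n (brauer_mult n (perm_elem n \<sigma>) x) (perm_elem n (Hilbert_Choice.inv \<sigma>))"

lemma conj_elem_linear:
  "conj_elem n \<sigma> 0 = 0" "conj_elem n \<sigma> (x + y) = conj_elem n \<sigma> x + conj_elem n \<sigma> y"
  "conj_elem n \<sigma> (scale c x) = scale c (conj_elem n \<sigma> x)"
  by (simp_all add: conj_elem_def brauer_mult_add_left brauer_mult_add_right brauer_mult_scale_left brauer_mult_scale_right)

lemma conj_elem_sum: "conj_elem n \<sigma> (sum f S) = (\<Sum>i\<in>S. conj_elem n \<sigma> (f i))"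
  by (induction S rule: infinite_finite_induct) (auto simp: conj_elem_linear)

lemma conj_elem_basis:
  "\<sigma> permutes {1..n} \<Longrightarrow> A \<in> pp n \<Longrightarrow> conj_elem n \<sigma> (basis_elem A) = basis_elem (map_diagram (relabel \<sigma>) A)"
  unfolding conj_elem_def by (rule perm_conj_basis)

lemma lookup_conj_elem:
  assumes \<sigma>: "\<sigma> permutes {1..n}" and x: "x \<in> span_of (pp n)"
  shows "Poly_Mapping.lookup (conj_elem n \<sigma> x) (map_diagram (relabel \<sigma>) B) = Poly_Mapping.lookup x B"
  using x
proof (induction x rule: span_of_induct)
  case (basis A)
  have "map_diagram (relabel \<sigma>) A = map_diagram (relabel \<sigma>) B \<longleftrightarrow> A = B"
    using map_relabel_inv(1)[OF \<sigma>] by metis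
  then show ?case using basis by (simp add: conj_elem_basis[OF \<sigma>])
qed (simp_all add: conj_elem_linear lookup_add)

lemma conj_elem_eq_iff:
  assumes \<sigma>: "\<sigma> permutes {1..n}" and x: "x \<in> span_of (pp n)"
  shows "conj_elem n \<sigma> x = x \<longleftrightarrow> brauer_mult n (perm_elem n \<sigma>) x = brauer_mult n x (perm_elem n \<sigma>)"
proof -
  let ?s = "perm_elem n \<sigma>" and ?t = "perm_elem n (Hilbert_Choice.inv \<sigma>)"
  have st: "?s \<in> span_of (pp n)" "?t \<in> span_of (pp n)"
    using perm_elem_span \<sigma> permutes_inv[OF \<sigma>] by blast+
  note inv = perm_elem_inverse[OF \<sigma>]
  have sx: "brauer_mult n ?s x \<in> span_of (pp n)" by (rule brauer_mult_closed[OF st(1) x])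
  show ?thesis
  proof
    assume "conj_elem n \<sigma> x = x"
    then have "brauer_mult n x ?s = brauer_mult n (brauer_mult n (brauer_mult n ?s x) ?t) ?s"
      by (simp add: conj_elem_def)
    also have "\<dots> = brauer_mult n ?s x"
      unfolding brauer_mult_assoc[OF sx st(2,1)] inv by (rule brauer_mult_one[OF sx])
    finally show "brauer_mult n ?s x = brauer_mult n x ?s" by simp
  next
    assume "brauer_mult n ?s x = brauer_mult n x ?s"
    then have "conj_elem n \<sigma> x = brauer_mult n (brauer_mult n x ?s) ?t" by (simp add: conj_elem_def)
    also have "\<dots> = x" unfolding brauer_mult_assoc[OF x st] inv by (rule brauer_mult_one[OF x])
    finally show "conj_elem n \<sigma> x = x" .
  qed
qed

lemma conj_orbit_sum:
  assumes \<sigma>: "\<sigma> permutes {1..n}" and A: "A \<in> pp n"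
  shows "conj_elem n \<sigma> (orbit_sum n A) = orbit_sum n A"
proof -
  have "conj_elem n \<sigma> (orbit_sum n A) = (\<Sum>B\<in>conj_orbit n A. basis_elem (map_diagram (relabel \<sigma>) B))"
    unfolding orbit_sum_def conj_elem_sum
    by (intro sum.cong refl conj_elem_basis[OF \<sigma>]) (use conj_orbit_pp[OF A] in blast)
  also have "\<dots> = orbit_sum n A"
    unfolding orbit_sum_def
    by (rule sum.reindex_bij_witness[of _ "map_diagram (relabel (Hilbert_Choice.inv \<sigma>))" "map_diagram (relabel \<sigma>)"])
      (auto simp: map_relabel_inv[OF \<sigma>] conj_orbit_map[OF \<sigma>] conj_orbit_map[OF permutes_inv[OF \<sigma>]])
  finally show ?thesis .
qed

section \<open>Spores\<close>

fun label :: "node \<Rightarrow> nat" where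
  "label (Top i) = i"
| "label (Bot i) = i"

lemma label_opp [simp]: "label (opp x) = label x"
  by (cases x) auto

lemma label_eq_iff: "label x = label y \<longleftrightarrow> y = x \<or> y = opp x"
  by (cases x; cases y) auto

lemma label_nodes: "label x \<in> {1..n} \<longleftrightarrow> x \<in> nodes n"
  by (cases x) auto

text \<open>One move from x_j to x_(j+1) in the construction of a spore. As a product of two
  involutions it is a permutation of the nodes that \<open>opp\<close> inverts.\<close>

definition walk_step :: "diagram \<Rightarrow> node \<Rightarrow> node" where
  "walk_step A = partner A \<circ> opp"

definition block_of :: "diagram \<Rightarrow> node \<Rightarrow> node set" where
  "block_of A x = {x, partner A x}"

abbreviation walk_at :: "diagram \<Rightarrow> node \<Rightarrow> nat \<Rightarrow> node" where
  "walk_at A x j \<equiv> (walk_step A ^^ j) x"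

abbreviation walk_period :: "diagram \<Rightarrow> node \<Rightarrow> nat" where
  "walk_period A x \<equiv> period (walk_step A) x"

definition walk_word :: "diagram \<Rightarrow> node \<Rightarrow> pair_type list" where
  "walk_word A x = map (\<lambda>j. tp (block_of A (walk_at A x j))) [0..<walk_period A x]"

definition walk_blocks :: "diagram \<Rightarrow> node \<Rightarrow> diagram" where
  "walk_blocks A x = range (\<lambda>j. block_of A (walk_at A x j))"

definition walk_labels :: "diagram \<Rightarrow> node \<Rightarrow> nat set" where
  "walk_labels A x = range (\<lambda>j. label (walk_at A x j))"

lemma in_block_of [simp]: "x \<in> block_of A x" "partner A x \<in> block_of A x"
  by (simp_all add: block_of_def)

lemma walk_at_add: "walk_at A x (i + j) = walk_at A (walk_at A x j) i"
  by (simp add: funpow_add)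

context
  fixes n :: nat and A :: diagram
  assumes A: "A \<in> pp n"
begin

lemma walk_step_opp: "walk_step A (opp x) = partner A x"
  by (simp add: walk_step_def)

lemma partner_walk_step: "partner A (walk_step A x) = opp x"
  by (simp add: walk_step_def partner_partner[OF A])

lemma inj_walk_step: "inj (walk_step A)"
  unfolding walk_step_def by (rule inj_involutions[OF partner_partner[OF A] opp_opp])

lemma walk_step_nodes: "x \<in> nodes n \<Longrightarrow> walk_step A x \<in> nodes n"
  unfolding walk_step_def by (simp add: partner_nodes[OF A])

lemma walk_nodes: "x \<in> nodes n \<Longrightarrow> walk_at A x j \<in> nodes n"
  by (rule funpow_closed[of "nodes n"]) (auto intro: walk_step_nodes)

lemma walk_period_pos: "x \<in> nodes n \<Longrightarrow> 0 < walk_period A x"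
  by (rule period_pos[OF inj_walk_step finite_nodes walk_step_nodes])

lemma walk_at_period: "x \<in> nodes n \<Longrightarrow> walk_at A x (walk_period A x) = x"
  by (rule funpow_period[OF inj_walk_step finite_nodes walk_step_nodes])

lemma walk_at_mod: "x \<in> nodes n \<Longrightarrow> walk_at A x (j mod walk_period A x) = walk_at A x j"
  by (rule funpow_mod_period[OF walk_at_period])

lemma walk_at_eq_iff: "walk_at A x i = walk_at A y i \<longleftrightarrow> x = y"
  using inj_fn[OF inj_walk_step, of i] by (simp add: inj_eq)

lemma walk_reflect: "walk_at A (opp (walk_at A x j)) j = opp x"
  using reflect_funpow[of "partner A" opp j x, OF partner_partner[OF A] opp_opp]
  unfolding walk_step_def .

text \<open>The involution \<open>opp\<close> inverts the step, so the walk from the opposite node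
  runs backwards.\<close>

lemma walk_opp:
  assumes x: "x \<in> nodes n" and j: "j \<le> walk_period A x"
  shows "walk_at A (opp x) j = opp (walk_at A x (walk_period A x - j))"
  using walk_reflect[of j "walk_at A x (walk_period A x - j)"] j walk_at_period[OF x]
  by (simp flip: walk_at_add)

text \<open>If \<open>opp x\<close> were reached from \<open>x\<close> in i steps, then with y =
  \<open>walk_step A x\<close> the node \<open>opp y\<close> would be reached from y in i - 2 steps.
  The descent ends at i = 0 or i = 1, where \<open>opp\<close> or \<open>partner A\<close> would
  have a fixed point. Hence a walk meets each label through one of its two nodes only.\<close>

lemma opp_neq_walk: "x \<in> nodes n \<Longrightarrow> opp x \<noteq> walk_at A x i"
proof (induction i arbitrary: x rule: less_induct)
  case (less i)
  show ?case
  proof (cases "i < 2")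
    case True
    then consider "i = 0" | "i = 1" by linarith
    then show ?thesis
    proof cases
      case 2
      have "partner A (opp x) \<noteq> opp x" using partner_neq[OF A, of "opp x"] less.prems by simp
      moreover have "walk_at A x i = partner A (opp x)" unfolding 2 by (simp add: walk_step_def)
      ultimately show ?thesis by metis
    qed simp
  next
    case False
    then obtain k where k: "i = Suc (Suc k)" by (metis add_2_eq_Suc less_iff_Suc_add not_less_iff_gr_or_eq numeral_2_eq_2 add.commute)
    show ?thesis
    proof
      assume *: "opp x = walk_at A x i"
      let ?y = "walk_step A x"
      have "walk_step A (opp ?y) = opp x" by (simp add: walk_step_opp partner_walk_step)
      also have "\<dots> = walk_step A (walk_at A ?y k)" unfolding * k by (simp add: funpow_swap1)
      finally have "opp ?y = walk_at A ?y k" using inj_walk_step by (simp add: inj_eq)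
      then show False using less.IH[of k ?y] less.prems k walk_step_nodes by simp
    qed
  qed
qed

lemma opp_walk_neq_walk:
  assumes x: "x \<in> nodes n" shows "opp (walk_at A x i) \<noteq> walk_at A x j"
proof
  assume *: "opp (walk_at A x i) = walk_at A x j"
  have "opp x = walk_at A (opp (walk_at A x i)) i" by (simp add: walk_reflect)
  also have "\<dots> = walk_at A x (i + j)" unfolding * by (simp add: funpow_add)
  finally show False using opp_neq_walk[OF x] by blast
qed

text \<open>Each node of the walk is the partner of the opposite of its predecessor. Adding the
  period before subtracting 1 covers j = 0.\<close>

lemma partner_walk: "x \<in> nodes n \<Longrightarrow> partner A (walk_at A x j) = opp (walk_at A x (j + walk_period A x - 1))"
proof -
  assume x: "x \<in> nodes n"
  then obtain k where k: "walk_period A x = Suc k" using walk_period_pos gr0_conv_Suc by blast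
  have "walk_at A x j = walk_at A x (j + walk_period A x)" by (simp add: walk_at_add walk_at_period[OF x])
  also have "\<dots> = walk_step A (walk_at A x (j + k))" by (simp add: k)
  finally show ?thesis using partner_walk_step k by simp
qed

lemma partner_neq_walk: "x \<in> nodes n \<Longrightarrow> partner A (walk_at A x i) \<noteq> walk_at A x j"
  using partner_walk opp_walk_neq_walk by simp

lemma walk_at_inj:
  assumes "walk_at A x i = walk_at A x j" "i < walk_period A x" "j < walk_period A x"
  shows "i = j"
  using assms funpow_neq_within_period[OF inj_walk_step, of i j x] funpow_neq_within_period[OF inj_walk_step, of j i x]
  by (cases i j rule: linorder_cases) auto

lemma block_of_eq: "a \<in> A \<Longrightarrow> x \<in> a \<Longrightarrow> a = block_of A x"
  unfolding block_of_def by (rule pp_block_eq[OF A])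

lemma block_of_in: "x \<in> nodes n \<Longrightarrow> block_of A x \<in> A"
  unfolding block_of_def by (rule partner_block[OF A])

lemma block_of_step: "block_of A (walk_step A x) = {opp x, walk_step A x}"
  by (auto simp: block_of_def partner_walk_step)

lemma block_of_opp: "block_of A (opp x) = block_of A (walk_step A x)"
  unfolding block_of_step by (simp add: block_of_def walk_step_def)

lemma block_of_walk_eq:
  assumes x: "x \<in> nodes n" and eq: "block_of A (walk_at A x i) = block_of A (walk_at A x j)"
  shows "walk_at A x i = walk_at A x j"
proof -
  have "walk_at A x i \<in> {walk_at A x j, partner A (walk_at A x j)}"
    using in_block_of(1)[of "walk_at A x i" A] eq unfolding block_of_def by simp
  then show ?thesis using partner_neq_walk[OF x, of j i] by auto
qed

lemma range_mod:
  assumes "x \<in> nodes n" shows "range (\<lambda>j. F (walk_at A x j)) = (\<lambda>j. F (walk_at A x j)) ` {..<walk_period A x}"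
proof
  show "range (\<lambda>j. F (walk_at A x j)) \<subseteq> (\<lambda>j. F (walk_at A x j)) ` {..<walk_period A x}"
  proof
    fix y assume "y \<in> range (\<lambda>j. F (walk_at A x j))"
    then obtain j where "y = F (walk_at A x (j mod walk_period A x))" using walk_at_mod[OF assms] by auto
    then show "y \<in> (\<lambda>j. F (walk_at A x j)) ` {..<walk_period A x}"
      using walk_period_pos[OF assms] by (intro image_eqI[of _ _ "j mod walk_period A x"]) auto
  qed
qed auto

lemma inj_on_block_of: "x \<in> nodes n \<Longrightarrow> inj_on (\<lambda>j. block_of A (walk_at A x j)) {..<walk_period A x}"
  by (rule inj_onI) (metis block_of_walk_eq lessThan_iff walk_at_inj)

lemma inj_on_label: "x \<in> nodes n \<Longrightarrow> inj_on (\<lambda>j. label (walk_at A x j)) {..<walk_period A x}"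
proof (rule inj_onI)
  fix i j assume x: "x \<in> nodes n" and ij: "i \<in> {..<walk_period A x}" "j \<in> {..<walk_period A x}"
    and "label (walk_at A x i) = label (walk_at A x j)"
  then have "walk_at A x j = walk_at A x i" using opp_walk_neq_walk[OF x, of i j] unfolding label_eq_iff by auto
  then show "i = j" using walk_at_inj[of j x i] ij by auto
qed

lemma card_walk_blocks: "x \<in> nodes n \<Longrightarrow> card (walk_blocks A x) = walk_period A x"
  unfolding walk_blocks_def by (simp add: range_mod card_image[OF inj_on_block_of])

text \<open>Of the two nodes in a pair of the walk, the opposite of one lies in the next pair and
  the opposite of the other in the previous one. So the pairs of a walk are separated from all
  others.\<close>

lemma walk_blocks_closed:
  assumes x: "x \<in> nodes n" and a: "a \<in> walk_blocks A x" "z \<in> a" and b: "b \<in> A" "opp z \<in> b"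
  shows "b \<in> walk_blocks A x"
proof -
  obtain j where j: "a = block_of A (walk_at A x j)" using a(1) unfolding walk_blocks_def by blast
  have b_eq: "b = block_of A (opp z)" by (rule block_of_eq[OF b])
  consider "z = walk_at A x j" | "z = opp (walk_at A x (j + walk_period A x - 1))"
    using a(2) partner_walk[OF x, of j] unfolding j block_of_def by auto
  then show ?thesis
  proof cases
    case 1
    then have "b = block_of A (walk_at A x (Suc j))" using b_eq block_of_opp by simp
    then show ?thesis unfolding walk_blocks_def by blast
  next
    case 2
    then have "b = block_of A (walk_at A x (j + walk_period A x - 1))" using b_eq by simp
    then show ?thesis unfolding walk_blocks_def by blast
  qed
qed

text \<open>After the start node the construction leaves no freedom, so it follows the walk. The
  closing condition makes its length at least the period, and the absence of an earlier return makes
  it at most the period.\<close>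

lemma spore_walkD:
  assumes walk: "spore_walk A' as xs" and sub: "A' \<subseteq> A"
  obtains x where "x \<in> nodes n" "block_of A x \<in> A'" "map tp as = walk_word A x"
proof -
  define x where "x = xs ! 0"
  define k where "k = length as"
  have w: "as \<noteq> []" "length xs = k" "set as \<subseteq> A'" "x \<in> as ! 0"
    "\<And>j. Suc j < k \<Longrightarrow> as ! Suc j = {opp (xs ! j), xs ! Suc j} \<and> as ! Suc j \<noteq> as ! 0"
    "opp (last xs) \<in> as ! 0"
    using walk unfolding spore_walk_def x_def k_def by auto
  have k0: "0 < k" using w(1) unfolding k_def by simp
  have in_A: "as ! j \<in> A" if "j < k" for j
  proof -
    have "as ! j \<in> set as" using that unfolding k_def by simp
    then show ?thesis using w(3) sub by blast
  qed
  have as0: "as ! 0 = block_of A x" by (rule block_of_eq[OF in_A[OF k0] w(4)])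
  have x: "x \<in> nodes n" using pp_blockD(2)[OF A in_A[OF k0]] w(4) by blast
  have at: "xs ! j = walk_at A x j \<and> as ! j = block_of A (walk_at A x j)" if "j < k" for j
    using that
  proof (induction j)
    case 0
    then show ?case using as0 by (simp add: x_def)
  next
    case (Suc j)
    then have eq: "as ! Suc j = {opp (walk_at A x j), xs ! Suc j}" using w(5)[of j] by simp
    then have "partner A (opp (walk_at A x j)) = xs ! Suc j"
      using in_A[OF Suc.prems] by (intro partner_eqI[OF A]) simp
    then have "xs ! Suc j = walk_at A x (Suc j)" by (simp add: walk_step_def)
    then show ?case using eq block_of_step by simp
  qed
  have last: "last xs = walk_at A x (k - 1)" using at[of "k - 1"] k0 w(2) by (metis diff_less last_conv_nth length_0_conv less_numeral_extra(1,3))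
  then have "opp (walk_at A x (k - 1)) \<in> {x, partner A x}" using w(6) as0 by (simp add: block_of_def)
  moreover have "opp (walk_at A x (k - 1)) \<noteq> x" using opp_walk_neq_walk[OF x, of "k - 1" 0] by simp
  ultimately have "partner A x = opp (walk_at A x (k - 1))" by auto
  then have "x = partner A (opp (walk_at A x (k - 1)))" using partner_partner[OF A, of x] by simp
  then have "walk_at A x k = x" using k0 by (cases k) (auto simp: walk_step_def)
  then have le: "walk_period A x \<le> k" using period_le[of k "walk_step A" x] k0 by simp
  have "walk_period A x = k"
  proof (rule ccontr)
    assume "walk_period A x \<noteq> k"
    then have lt: "walk_period A x < k" using le by simp
    obtain j where j: "walk_period A x = Suc j" using walk_period_pos[OF x] gr0_conv_Suc by blast
    have "as ! Suc j = as ! 0" using at[of "Suc j"] lt walk_at_period[OF x] as0 unfolding j by simp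
    then show False using w(5)[of j] lt j by simp
  qed
  moreover have "map tp as = map (\<lambda>j. tp (as ! j)) [0..<k]"
    unfolding k_def by (rule nth_equalityI) auto
  moreover have "map (\<lambda>j. tp (as ! j)) [0..<k] = map (\<lambda>j. tp (block_of A (walk_at A x j))) [0..<k]"
    using at by (intro map_cong) auto
  ultimately have "map tp as = walk_word A x" by (simp add: walk_word_def)
  moreover have "block_of A x \<in> A'"
  proof -
    have "as ! 0 \<in> set as" using w(1) by simp
    then show ?thesis using w(3) as0 by auto
  qed
  ultimately show thesis using that x by blast
qed

lemma spore_walkI:
  assumes x: "x \<in> nodes n" and sub: "walk_blocks A x \<subseteq> A'"
  shows "\<exists>as xs. spore_walk A' as xs"
proof -
  let ?k = "walk_period A x"
  note k0 = walk_period_pos[OF x]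
  define as where "as = map (\<lambda>j. block_of A (walk_at A x j)) [0..<?k]"
  define xs where "xs = map (walk_at A x) [0..<?k]"
  have "spore_walk A' as xs"
    unfolding spore_walk_def
  proof (intro conjI allI impI)
    show "as \<noteq> []" "length xs = length as" "xs ! 0 \<in> as ! 0" using k0 by (auto simp: as_def xs_def)
    show "set as \<subseteq> A'" using sub by (auto simp: as_def walk_blocks_def)
    fix j assume "Suc j < length as"
    then have j: "Suc j < ?k" by (simp add: as_def)
    then show "as ! Suc j = {opp (xs ! j), xs ! Suc j}" using block_of_step by (simp add: as_def xs_def)
    show "as ! Suc j \<noteq> as ! 0"
    proof
      assume "as ! Suc j = as ! 0"
      then have "block_of A (walk_at A x (Suc j)) = block_of A (walk_at A x 0)" using j by (simp add: as_def)
      then have "walk_at A x (Suc j) = walk_at A x 0" by (rule block_of_walk_eq[OF x])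
      then show False using walk_at_inj[of "Suc j" x 0] j by simp
    qed
  next
    have "last xs = walk_at A x (?k - 1)" using k0 unfolding xs_def by (simp add: last_map)
    then have "opp (last xs) = partner A x" using partner_walk[OF x, of 0] by simp
    then show "opp (last xs) \<in> as ! 0" using k0 by (simp add: as_def block_of_def)
  qed
  then show ?thesis by blast
qed

end

lemma bij_betw_filter: "bij_betw f S T \<Longrightarrow> bij_betw f {p \<in> S. P (f p)} {a \<in> T. P a}"
  unfolding bij_betw_def by (auto simp: inj_on_def)

lemma count_list_map: "count_list (map f xs) y = length (filter (\<lambda>x. f x = y) xs)"
  by (induction xs) auto

lemma count_list_concat: "count_list (concat xss) y = (\<Sum>i<length xss. count_list (xss ! i) y)"
proof (induction xss rule: rev_induct)
  case (snoc xs xss)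
  then show ?case by (simp add: nth_append)
qed simp

lemma sum_list_lengths: "sum_list (map length xss) = (\<Sum>i<length xss. length (xss ! i))"
  by (simp add: sum_list_sum_nth atLeast0LessThan)

subsection \<open>Maximal separated decompositions\<close>

definition separated :: "diagram \<Rightarrow> diagram \<Rightarrow> bool" where
  "separated P Q \<longleftrightarrow> P \<inter> Q = {} \<and> (\<forall>a\<in>P. \<forall>b\<in>Q. \<forall>x\<in>a. opp x \<notin> b)"

lemma separated_sym: "separated P Q \<Longrightarrow> separated Q P"
  unfolding separated_def by (metis Int_commute opp_opp)

lemma separated_mono: "separated P Q \<Longrightarrow> P' \<subseteq> P \<Longrightarrow> Q' \<subseteq> Q \<Longrightarrow> separated P' Q'"
  unfolding separated_def by blast

text \<open>Parts are nonempty and pairwise disjoint, hence distinct, so the parts themselves can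
  replace their indices; in this form reordering is harmless.\<close>

lemma separated_decomposition_iff:
  "separated_decomposition A As \<longleftrightarrow> {} \<notin> set As \<and> \<Union>(set As) = A \<and>
    (\<forall>i<length As. \<forall>j<length As. i \<noteq> j \<longrightarrow> separated (As ! i) (As ! j))"
  by (simp add: separated_decomposition_def separated_def)

lemma separated_decomposition_set_iff:
  "separated_decomposition A As \<longleftrightarrow> {} \<notin> set As \<and> \<Union>(set As) = A \<and> distinct As \<and>
    (\<forall>P\<in>set As. \<forall>Q\<in>set As. P \<noteq> Q \<longrightarrow> separated P Q)" (is "?L \<longleftrightarrow> ?R")
proof
  assume L: ?L
  have "distinct As"
    unfolding distinct_conv_nth
  proof (intro allI impI)
    fix i j assume ij: "i < length As" "j < length As" "i \<noteq> j"
    then have "As ! i \<inter> As ! j = {}" using L unfolding separated_decomposition_iff separated_def by blast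
    moreover have "As ! i \<noteq> {}" using L ij(1) unfolding separated_decomposition_iff by (metis nth_mem)
    ultimately show "As ! i \<noteq> As ! j" by auto
  qed
  moreover have "separated P Q" if PQ: "P \<in> set As" "Q \<in> set As" "P \<noteq> Q" for P Q
  proof -
    obtain i j where "i < length As" "P = As ! i" "j < length As" "Q = As ! j"
      using PQ by (metis in_set_conv_nth)
    then show ?thesis using L PQ(3) unfolding separated_decomposition_iff by blast
  qed
  ultimately show ?R using L unfolding separated_decomposition_iff by blast
next
  assume R: ?R
  have "separated (As ! i) (As ! j)" if "i < length As" "j < length As" "i \<noteq> j" for i j
    using that R nth_eq_iff_index_eq[of As i j] by simp
  then show ?L using R unfolding separated_decomposition_iff by blast
qed

text \<open>Picking one pair from each part is injective, so the number of parts is bounded by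
  \<open>card A\<close> and a longest decomposition exists. Sorting it by size keeps it
  longest.\<close>

lemma spore_decomposition_exists:
  assumes "finite A" obtains As where "spore_decomposition A As"
proof -
  have bound: "length As \<le> card A" if "separated_decomposition A As" for As
  proof -
    have R: "{} \<notin> set As" "\<Union>(set As) = A" "distinct As" "\<And>P Q. P \<in> set As \<Longrightarrow> Q \<in> set As \<Longrightarrow> P \<noteq> Q \<Longrightarrow> separated P Q"
      using that unfolding separated_decomposition_set_iff by blast+
    define f where "f P = (SOME a. a \<in> P)" for P :: diagram
    have f: "f P \<in> P" if "P \<in> set As" for P
      using R(1) that unfolding f_def by (metis all_not_in_conv some_in_eq)
    have "inj_on f (set As)"
    proof (rule inj_onI)
      fix P Q assume "P \<in> set As" "Q \<in> set As" "f P = f Q"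
      then show "P = Q" using R(4)[of P Q] f[of P] f[of Q] unfolding separated_def by auto
    qed
    moreover have "f ` set As \<subseteq> A" using f R(2) by blast
    ultimately have "card (set As) \<le> card A" using assms by (metis card_inj_on_le)
    then show ?thesis using distinct_card[OF R(3)] by simp
  qed
  have "\<exists>As. separated_decomposition A As"
  proof (cases "A = {}")
    case True
    then show ?thesis by (intro exI[of _ "[]"]) (simp add: separated_decomposition_def)
  next
    case False
    then show ?thesis by (intro exI[of _ "[A]"]) (simp add: separated_decomposition_def)
  qed
  then obtain As0 where "separated_decomposition A As0" by blast
  from ex_has_greatest_nat[of "separated_decomposition A", OF this, of length "Suc (card A)"]
  obtain As where As: "separated_decomposition A As"
    "\<And>Bs. separated_decomposition A Bs \<Longrightarrow> length Bs \<le> length As"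
    using bound by (auto simp: less_Suc_eq_le)
  define Bs where "Bs = rev (sort_key card As)"
  have "set Bs = set As" "distinct Bs \<longleftrightarrow> distinct As" "length Bs = length As" by (simp_all add: Bs_def)
  then have "separated_decomposition A Bs" "\<And>Cs. separated_decomposition A Cs \<Longrightarrow> length Cs \<le> length Bs"
    using As unfolding separated_decomposition_set_iff by simp_all
  moreover have "sorted_wrt (\<ge>) (map card Bs)"
    unfolding Bs_def rev_map[symmetric] by (simp add: sorted_wrt_rev)
  ultimately show thesis using that unfolding spore_decomposition_def by blast
qed

context
  fixes n :: nat and A :: diagram
  assumes A: "A \<in> pp n"
begin

lemma separated_part_contains_walk:
  assumes As: "separated_decomposition A As" and i: "i < length As" and x: "x \<in> nodes n" "block_of A x \<in> As ! i"
  shows "walk_blocks A x \<subseteq> As ! i"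
proof -
  have "block_of A (walk_at A x j) \<in> As ! i" for j
  proof (induction j)
    case (Suc j)
    let ?y = "walk_at A x j"
    have "block_of A (walk_step A ?y) \<in> A" using block_of_in[OF A] walk_nodes[OF A x(1), of "Suc j"] by simp
    then obtain P where "P \<in> set As" "block_of A (walk_step A ?y) \<in> P"
      using As unfolding separated_decomposition_iff by blast
    then obtain k where k: "k < length As" "block_of A (walk_step A ?y) \<in> As ! k" by (metis in_set_conv_nth)
    have "opp ?y \<in> block_of A (walk_step A ?y)" by (simp add: block_of_step[OF A])
    then have "k = i"
      using As i k Suc in_block_of(1)[of ?y A] unfolding separated_decomposition_iff separated_def by blast
    then show ?case using k by simp
  qed (use x in simp)
  then show ?thesis unfolding walk_blocks_def by blast
qed

text \<open>By maximality: if the part were larger than the walk inside it, splitting it into the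
  walk and the remainder would give one more part.\<close>

lemma spore_part_eq:
  assumes As: "spore_decomposition A As" and i: "i < length As" and x: "x \<in> nodes n" "block_of A x \<in> As ! i"
  shows "As ! i = walk_blocks A x"
proof (rule ccontr)
  assume neq: "As ! i \<noteq> walk_blocks A x"
  have sep: "separated_decomposition A As" and max: "\<And>Bs. separated_decomposition A Bs \<Longrightarrow> length Bs \<le> length As"
    using As unfolding spore_decomposition_def by blast+
  have R: "{} \<notin> set As" "\<Union>(set As) = A" "\<And>i j. i < length As \<Longrightarrow> j < length As \<Longrightarrow> i \<noteq> j \<Longrightarrow> separated (As ! i) (As ! j)"
    using sep unfolding separated_decomposition_iff by blast+
  let ?C = "walk_blocks A x" and ?D = "As ! i - walk_blocks A x"
  have C: "?C \<subseteq> As ! i" by (rule separated_part_contains_walk[OF sep i x])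
  have Ai: "As ! i \<subseteq> A" using R(2) i nth_mem by blast
  have sepCD: "separated ?C ?D"
    unfolding separated_def
  proof (intro conjI ballI notI)
    fix a b z assume "a \<in> ?C" "b \<in> ?D" "z \<in> a" "opp z \<in> b"
    then show False using walk_blocks_closed[OF A x(1), of a z b] Ai by blast
  qed auto
  define Bs where "Bs = As[i := ?C] @ [?D]"
  have sub: "As[i := ?C] ! j \<subseteq> As ! j" if "j < length As" for j
    using C that by (cases "j = i") auto
  have "separated_decomposition A Bs"
    unfolding separated_decomposition_iff
  proof (intro conjI allI impI)
    have "?C \<noteq> {}" unfolding walk_blocks_def by blast
    moreover have "?D \<noteq> {}" using neq C by blast
    ultimately show "{} \<notin> set Bs"
      using R(1) set_update_subset_insert[of As i ?C] unfolding Bs_def by auto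
    have "\<Union>(set Bs) = A"
    proof
      show "\<Union>(set Bs) \<subseteq> A"
        using set_update_subset_insert[of As i ?C] R(2) C Ai unfolding Bs_def by auto
      show "A \<subseteq> \<Union>(set Bs)"
      proof
        fix a assume "a \<in> A"
        then obtain j where j: "j < length As" "a \<in> As ! j" using R(2) by (metis UnionE in_set_conv_nth)
        show "a \<in> \<Union>(set Bs)"
        proof (cases "j = i")
          case True
          have "?C \<in> set Bs" "?D \<in> set Bs" using i unfolding Bs_def by (auto simp: set_update_memI)
          then show ?thesis using j True by blast
        next
          case False
          then have "As[i := ?C] ! j = As ! j" by simp
          moreover have "As[i := ?C] ! j \<in> set (As[i := ?C])" using j by (intro nth_mem) simp
          ultimately have "As ! j \<in> set Bs" unfolding Bs_def by simp
          then show ?thesis using j by blast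
        qed
      qed
    qed
    then show "\<Union>(set Bs) = A" .
    have sepD: "separated (Bs ! j) ?D" if j: "j < length As" for j
    proof (cases "j = i")
      case True then show ?thesis using sepCD i by (simp add: Bs_def nth_append)
    next
      case False
      then show ?thesis using R(3)[OF j i False] separated_mono[of "As ! j" "As ! i" "As ! j" ?D] j
        by (simp add: Bs_def nth_append)
    qed
    fix j k assume jk: "j < length Bs" "k < length Bs" "j \<noteq> k"
    have len: "length Bs = Suc (length As)" by (simp add: Bs_def)
    have lastB: "Bs ! length As = ?D" by (simp add: Bs_def nth_append)
    consider "j < length As" "k < length As" | "j < length As" "k = length As" | "j = length As" "k < length As"
      using jk len by linarith
    then show "separated (Bs ! j) (Bs ! k)"
    proof cases
      case 1
      then show ?thesis using separated_mono[OF R(3)[OF 1 jk(3)] sub[OF 1(1)] sub[OF 1(2)]]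
        by (simp add: Bs_def nth_append)
    next
      case 2 then show ?thesis using sepD lastB by simp
    next
      case 3 then show ?thesis using sepD lastB separated_sym by simp
    qed
  qed
  then have "length Bs \<le> length As" by (rule max)
  then show False by (simp add: Bs_def)
qed

lemma spore_filling_exists: "\<exists>s. spore_filling A s"
proof -
  obtain As where As: "spore_decomposition A As"
    using spore_decomposition_exists[OF finite_diagram[OF A]] .
  then have sep: "separated_decomposition A As" unfolding spore_decomposition_def by blast
  have "\<exists>w. \<exists>as xs. spore_walk (As ! i) as xs \<and> w = map tp as" if i: "i < length As" for i
  proof -
    have "As ! i \<noteq> {}" using sep i unfolding separated_decomposition_iff by (metis nth_mem)
    then obtain a where a: "a \<in> As ! i" by blast
    then have aA: "a \<in> A" using sep i unfolding separated_decomposition_iff by (metis UnionI nth_mem)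
    then obtain x where x: "x \<in> nodes n" "a = block_of A x"
      unfolding block_of_def by (subst (asm) pp_blocks_eq[OF A]) auto
    have "walk_blocks A x \<subseteq> As ! i" by (rule separated_part_contains_walk[OF sep i x(1)]) (use a x in simp)
    then show ?thesis using spore_walkI[OF A x(1)] by blast
  qed
  then have "\<forall>i\<in>{..<length As}. \<exists>w. \<exists>as xs. spore_walk (As ! i) as xs \<and> w = map tp as" by simp
  from bchoice[OF this] obtain w
    where w: "\<And>i. i < length As \<Longrightarrow> \<exists>as xs. spore_walk (As ! i) as xs \<and> w i = map tp as"
    by auto
  have "spore_filling A (map w [0..<length As])"
    unfolding spore_filling_def using As w by (intro exI[of _ As]) simp
  then show ?thesis by blast
qed

text \<open>The parts are walks, so a filling amounts to a choice of start nodes \<open>z\<close>.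
  Together the walks pass every pair and every label exactly once.\<close>

lemma spore_fillingD:
  assumes "spore_filling A s"
  obtains z where "\<And>i. i < length s \<Longrightarrow> z i \<in> nodes n"
    "\<And>i. i < length s \<Longrightarrow> s ! i = walk_word A (z i)"
    "sorted_wrt (\<ge>) (map length s)"
    "bij_betw (\<lambda>(i, j). block_of A (walk_at A (z i) j)) (SIGMA i:{..<length s}. {..<walk_period A (z i)}) A"
    "\<And>i j. i < length s \<Longrightarrow> j < length s \<Longrightarrow> i \<noteq> j \<Longrightarrow> walk_labels A (z i) \<inter> walk_labels A (z j) = {}"
    "(\<Union>i<length s. walk_labels A (z i)) = {1..n}"
proof -
  obtain As where As: "spore_decomposition A As" and len: "length s = length As"
    and walks: "\<And>i. i < length As \<Longrightarrow> \<exists>as xs. spore_walk (As ! i) as xs \<and> s ! i = map tp as"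
    using assms unfolding spore_filling_def by blast
  have sep: "separated_decomposition A As" and sorted: "sorted_wrt (\<ge>) (map card As)"
    using As unfolding spore_decomposition_def by blast+
  have R: "{} \<notin> set As" "\<Union>(set As) = A" "\<And>i j. i < length As \<Longrightarrow> j < length As \<Longrightarrow> i \<noteq> j \<Longrightarrow> separated (As ! i) (As ! j)"
    using sep unfolding separated_decomposition_iff by blast+
  have "\<exists>x. x \<in> nodes n \<and> s ! i = walk_word A x \<and> As ! i = walk_blocks A x" if i: "i < length As" for i
  proof -
    obtain as xs where w: "spore_walk (As ! i) as xs" "s ! i = map tp as" using walks[OF i] by blast
    have "As ! i \<subseteq> A" using R(2) i nth_mem by blast
    from spore_walkD[OF A w(1) this] obtain x where x: "x \<in> nodes n" "block_of A x \<in> As ! i" "map tp as = walk_word A x"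
      by blast
    then show ?thesis using spore_part_eq[OF As i x(1,2)] w(2) by auto
  qed
  then obtain z where z: "\<And>i. i < length s \<Longrightarrow> z i \<in> nodes n" "\<And>i. i < length s \<Longrightarrow> s ! i = walk_word A (z i)"
    "\<And>i. i < length s \<Longrightarrow> As ! i = walk_blocks A (z i)"
    unfolding len by metis
  let ?S = "SIGMA i:{..<length s}. {..<walk_period A (z i)}"
  let ?f = "\<lambda>(i, j). block_of A (walk_at A (z i) j)"
  have parts: "separated (walk_blocks A (z i)) (walk_blocks A (z j))" if "i < length s" "j < length s" "i \<noteq> j" for i j
    using R(3)[of i j] z(3) that len by simp
  have "map length s = map card As"
    by (rule nth_equalityI) (auto simp: len z walk_word_def card_walk_blocks[OF A] simp flip: len)
  then have 3: "sorted_wrt (\<ge>) (map length s)" using sorted by simp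
  have inj: "inj_on ?f ?S"
  proof (rule inj_onI)
    fix p q assume "p \<in> ?S" "q \<in> ?S" "?f p = ?f q"
    moreover obtain i j k l where "p = (i, j)" "q = (k, l)" by (cases p, cases q)
    ultimately have ij: "i < length s" "j < walk_period A (z i)" "k < length s" "l < walk_period A (z k)"
      and eq: "block_of A (walk_at A (z i) j) = block_of A (walk_at A (z k) l)" and pq: "p = (i, j)" "q = (k, l)" by auto
    have "i = k"
    proof (rule ccontr)
      assume "i \<noteq> k"
      then have "walk_blocks A (z i) \<inter> walk_blocks A (z k) = {}" using parts ij unfolding separated_def by blast
      then show False using eq unfolding walk_blocks_def by blast
    qed
    moreover have "j = l" using inj_on_block_of[OF A z(1)[OF ij(1)]] eq ij \<open>i = k\<close> by (auto simp: inj_on_def)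
    ultimately show "p = q" using pq by simp
  qed
  have img: "?f ` ?S = A"
  proof -
    have "?f ` ?S = (\<Union>i<length s. (\<lambda>j. block_of A (walk_at A (z i) j)) ` {..<walk_period A (z i)})" by force
    also have "\<dots> = (\<Union>i<length s. walk_blocks A (z i))"
      unfolding walk_blocks_def by (intro SUP_cong refl range_mod[OF A, symmetric]) (use z in simp)
    also have "\<dots> = (\<Union>i<length As. As ! i)" unfolding len[symmetric] using z(3) by simp
    also have "\<dots> = A"     proof -
      have "set As = (!) As ` {..<length As}" by (auto simp: set_conv_nth)
      then show ?thesis using R(2) by simp
    qed
    finally show ?thesis .
  qed
  have bij: "bij_betw ?f ?S A" using inj img by (simp add: bij_betw_def)
  have disj: "walk_labels A (z i) \<inter> walk_labels A (z j) = {}" if ij: "i < length s" "j < length s" "i \<noteq> j" for i j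
  proof (rule ccontr)
    assume "walk_labels A (z i) \<inter> walk_labels A (z j) \<noteq> {}"
    then obtain k l where "label (walk_at A (z i) k) = label (walk_at A (z j) l)" unfolding walk_labels_def by blast
    then consider "walk_at A (z j) l = walk_at A (z i) k" | "walk_at A (z j) l = opp (walk_at A (z i) k)"
      unfolding label_eq_iff by blast
    then show False
    proof cases
      case 1
      then have "block_of A (walk_at A (z i) k) \<in> walk_blocks A (z i) \<inter> walk_blocks A (z j)"
        unfolding walk_blocks_def by (metis IntI rangeI)
      then show False using parts[OF ij] unfolding separated_def by blast
    next
      case 2
      have "block_of A (walk_at A (z i) k) \<in> walk_blocks A (z i)" "block_of A (walk_at A (z j) l) \<in> walk_blocks A (z j)"
        unfolding walk_blocks_def by auto
      moreover have "opp (walk_at A (z i) k) \<in> block_of A (walk_at A (z j) l)" unfolding 2[symmetric] by (rule in_block_of(1))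
      ultimately show False using parts[OF ij] in_block_of(1) unfolding separated_def by blast
    qed
  qed
  \<comment> \<open>The disjoint label sets have as many elements in total as there are pairs,
    namely n, so no label is missed.\<close>
  have union: "(\<Union>i<length s. walk_labels A (z i)) = {1..n}"
  proof (rule card_subset_eq)
    have sub: "walk_labels A (z i) \<subseteq> {1..n}" if "i < length s" for i
      unfolding walk_labels_def using walk_nodes[OF A z(1)[OF that]] label_nodes by blast
    then show "(\<Union>i<length s. walk_labels A (z i)) \<subseteq> {1..n}" by blast
    have "card (\<Union>i<length s. walk_labels A (z i)) = (\<Sum>i<length s. card (walk_labels A (z i)))"
    proof (rule card_UN_disjoint)
      show "\<forall>i\<in>{..<length s}. finite (walk_labels A (z i))"
        using sub finite_subset[OF _ finite_atLeastAtMost] by blast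
    qed (use disj in auto)
    also have "\<dots> = (\<Sum>i<length s. walk_period A (z i))"
    proof (rule sum.cong[OF refl])
      fix i assume "i \<in> {..<length s}"
      then have zi: "z i \<in> nodes n" using z(1) by simp
      show "card (walk_labels A (z i)) = walk_period A (z i)"
        unfolding walk_labels_def range_mod[OF A zi] by (simp add: card_image[OF inj_on_label[OF A zi]])
    qed
    also have "\<dots> = card ?S" by simp
    also have "\<dots> = card A" by (rule bij_betw_same_card[OF bij])
    finally show "card (\<Union>i<length s. walk_labels A (z i)) = card {1..n}" using card_diagram[OF A] by simp
  qed simp
  show thesis by (rule that[OF z(1,2) 3 bij disj union]) simp_all
qed

lemma spore_filling_props:
  assumes "spore_filling A s"
  shows "s \<in> fillings n" and "count_list (concat s) Propagating = card {a \<in> A. tp a = Propagating}"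
proof -
  obtain z where z: "\<And>i. i < length s \<Longrightarrow> z i \<in> nodes n" "\<And>i. i < length s \<Longrightarrow> s ! i = walk_word A (z i)"
    "sorted_wrt (\<ge>) (map length s)"
    "bij_betw (\<lambda>(i, j). block_of A (walk_at A (z i) j)) (SIGMA i:{..<length s}. {..<walk_period A (z i)}) A"
    using spore_fillingD[OF assms] by metis
  have len: "length (s ! i) = walk_period A (z i)" if "i < length s" for i
    using z(2)[OF that] by (simp add: walk_word_def)
  have "[] \<notin> set s"
  proof
    assume "[] \<in> set s"
    then obtain i where i: "i < length s" "s ! i = []" by (auto simp: in_set_conv_nth)
    then show False using len[OF i(1)] walk_period_pos[OF A z(1)[OF i(1)]] by simp
  qed
  moreover have "sum_list (map length s) = n"
  proof -
    have "sum_list (map length s) = (\<Sum>i<length s. walk_period A (z i))"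
      unfolding sum_list_lengths using len by simp
    also have "\<dots> = card (SIGMA i:{..<length s}. {..<walk_period A (z i)})" by simp
    also have "\<dots> = n" using bij_betw_same_card[OF z(4)] card_diagram[OF A] by simp
    finally show ?thesis .
  qed
  ultimately show "s \<in> fillings n" using z(3) by (simp add: fillings_def)
  let ?T = "SIGMA i:{..<length s}. {j \<in> {..<walk_period A (z i)}. tp (block_of A (walk_at A (z i) j)) = Propagating}"
  have "count_list (concat s) Propagating = (\<Sum>i<length s. card {j \<in> {..<walk_period A (z i)}. tp (block_of A (walk_at A (z i) j)) = Propagating})"
    unfolding count_list_concat
  proof (rule sum.cong[OF refl])
    fix i assume "i \<in> {..<length s}"
    then have "count_list (s ! i) Propagating =
        length (filter (\<lambda>j. tp (block_of A (walk_at A (z i) j)) = Propagating) [0..<walk_period A (z i)])"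
      using z(2) by (simp add: walk_word_def count_list_map)
    also have "\<dots> = card {j \<in> {..<walk_period A (z i)}. tp (block_of A (walk_at A (z i) j)) = Propagating}"
      by (subst distinct_length_filter) (auto intro!: arg_cong[where f = card])
    finally show "count_list (s ! i) Propagating = card {j \<in> {..<walk_period A (z i)}. tp (block_of A (walk_at A (z i) j)) = Propagating}" .
  qed
  also have "\<dots> = card ?T" by simp
  also have "\<dots> = card {a \<in> A. tp a = Propagating}"
  proof (rule bij_betw_same_card[of "\<lambda>(i, j). block_of A (walk_at A (z i) j)"])
    let ?f = "\<lambda>(i, j). block_of A (walk_at A (z i) j)"
    have "?T = {p \<in> (SIGMA i:{..<length s}. {..<walk_period A (z i)}). tp (?f p) = Propagating}" by auto
    moreover have "bij_betw ?f \<dots> {a \<in> A. tp a = Propagating}" by (rule bij_betw_filter[OF z(4)])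
    ultimately show "bij_betw ?f ?T {a \<in> A. tp a = Propagating}" by simp
  qed
  finally show "count_list (concat s) Propagating = card {a \<in> A. tp a = Propagating}" .
qed

end

section \<open>The spore determines the conjugacy class\<close>

definition is_top :: "node \<Rightarrow> bool" where
  "is_top x \<longleftrightarrow> x \<in> range Top"

lemma is_top_simps [simp]: "is_top (Top i)" "\<not> is_top (Bot i)"
  by (auto simp: is_top_def)

lemma is_top_opp [simp]: "is_top (opp x) \<longleftrightarrow> \<not> is_top x"
  by (cases x) auto

lemma node_eqI: "label x = label y \<Longrightarrow> is_top x = is_top y \<Longrightarrow> x = y"
  by (cases x; cases y) auto

lemma tp_pair:
  "tp {x, y} = (if is_top x \<and> is_top y then Northern else if \<not> is_top x \<and> \<not> is_top y then Southern else Propagating)"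
  by (cases x; cases y) auto

lemma tp_block_of_top:
  "tp (block_of A x) = Northern \<Longrightarrow> is_top x" "tp (block_of A x) = Southern \<Longrightarrow> \<not> is_top x"
  unfolding block_of_def tp_pair by (auto split: if_splits)

context
  fixes n :: nat and A :: diagram
  assumes A: "A \<in> pp n"
begin

text \<open>The pair reached is \<open>{opp x, walk_step A x}\<close>. If it is propagating, its
  nodes lie in different rows, as do \<open>x\<close> and \<open>opp x\<close>, so the row is
  kept.\<close>

lemma is_top_step:
  "is_top (walk_step A x) = (case tp (block_of A (walk_step A x)) of Northern \<Rightarrow> True | Southern \<Rightarrow> False | Propagating \<Rightarrow> is_top x)"
  unfolding block_of_step[OF A] tp_pair by auto

lemma walk_period_shift: "walk_period A (walk_at A x c) = walk_period A x"
proof -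
  have "walk_at A (walk_at A x c) m = walk_at A x c \<longleftrightarrow> walk_at A x m = x" for m
  proof -
    have "walk_at A (walk_at A x c) m = walk_at A (walk_at A x m) c"
      by (simp only: walk_at_add[symmetric] add.commute)
    then show ?thesis using walk_at_eq_iff[OF A] by simp
  qed
  then show ?thesis unfolding period_def by simp
qed

lemma walk_period_opp: "walk_period A (opp x) = walk_period A x"
proof -
  have "walk_at A (opp x) m = opp x \<longleftrightarrow> walk_at A x m = x" for m
  proof
    assume *: "walk_at A (opp x) m = opp x"
    have "walk_at A (opp (walk_at A x m)) m = walk_at A (opp x) m" unfolding walk_reflect[OF A] * ..
    then have "opp (walk_at A x m) = opp x" by (simp only: walk_at_eq_iff[OF A])
    then show "walk_at A x m = x" by (metis opp_opp)
  next
    assume "walk_at A x m = x"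
    then show "walk_at A (opp x) m = opp x" using walk_reflect[OF A, of m x] by simp
  qed
  then show ?thesis unfolding period_def by simp
qed

lemma walk_at_cong_mod:
  assumes "x \<in> nodes n" "i mod walk_period A x = j mod walk_period A x"
  shows "walk_at A x i = walk_at A x j"
  using walk_at_mod[OF A assms(1), of i] walk_at_mod[OF A assms(1), of j] assms(2) by simp

lemma walk_labels_shift: "x \<in> nodes n \<Longrightarrow> walk_labels A (walk_at A x c) = walk_labels A x"
proof -
  assume x: "x \<in> nodes n"
  have "label (walk_at A x j) \<in> walk_labels A (walk_at A x c)" for j
  proof -
    define k where "k = walk_period A x"
    have k: "0 < k" unfolding k_def by (rule walk_period_pos[OF A x])
    \<comment> \<open>Moving on by c and then by c(k - 1) makes c full turns, which inverts the
      shift without subtraction.\<close>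
    have "walk_at A x (j + c * (k - 1) + c) = walk_at A x j"
    proof (rule walk_at_cong_mod[OF x])
      have "j + c * (k - 1) + c = j + c * k" using k by (cases k) auto
      then show "(j + c * (k - 1) + c) mod walk_period A x = j mod walk_period A x"
        unfolding k_def[symmetric] by (simp only: mod_mult_self1)
    qed
    then have "label (walk_at A x j) = label (walk_at A (walk_at A x c) (j + c * (k - 1)))"
      by (simp add: walk_at_add)
    then show ?thesis unfolding walk_labels_def by blast
  qed
  moreover have "label (walk_at A (walk_at A x c) j) \<in> walk_labels A x" for j
    unfolding walk_at_add[symmetric] walk_labels_def by blast
  ultimately show ?thesis unfolding walk_labels_def by blast
qed

lemma walk_labels_opp: "x \<in> nodes n \<Longrightarrow> walk_labels A (opp x) = walk_labels A x"
proof -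
  have sub: "walk_labels A (opp x) \<subseteq> walk_labels A x" if x: "x \<in> nodes n" for x
  proof
    fix y assume "y \<in> walk_labels A (opp x)"
    moreover have x': "opp x \<in> nodes n" using x by simp
    ultimately obtain j where j: "j < walk_period A x" "y = label (walk_at A (opp x) j)"
      unfolding walk_labels_def range_mod[OF A x'] walk_period_opp by auto
    then show "y \<in> walk_labels A x" using walk_opp[OF A x, of j] unfolding walk_labels_def by auto
  qed
  assume "x \<in> nodes n"
  then show ?thesis using sub[of x] sub[of "opp x"] by simp
qed

lemma walk_word_shift: "x \<in> nodes n \<Longrightarrow> walk_word A (walk_at A x c) = rotate c (walk_word A x)"
proof (rule nth_equalityI)
  assume x: "x \<in> nodes n"
  show "length (walk_word A (walk_at A x c)) = length (rotate c (walk_word A x))"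
    by (simp add: walk_word_def walk_period_shift)
  fix i assume "i < length (walk_word A (walk_at A x c))"
  then have i: "i < walk_period A x" by (simp add: walk_word_def walk_period_shift)
  have "walk_at A x ((c + i) mod walk_period A x) = walk_at A (walk_at A x c) i"
    unfolding walk_at_mod[OF A x] by (simp only: walk_at_add[symmetric] add.commute)
  then show "walk_word A (walk_at A x c) ! i = rotate c (walk_word A x) ! i"
    using i by (simp add: walk_word_def walk_period_shift nth_rotate)
qed

lemma block_of_opp_walk:
  assumes x: "x \<in> nodes n" and j: "j \<le> walk_period A x"
  shows "block_of A (walk_at A (opp x) j) = block_of A (walk_at A x (Suc (walk_period A x - j)))"
  unfolding walk_opp[OF A x j] block_of_opp[OF A] by simp

text \<open>Pair j of the walk from the opposite node is pair k + 1 - j of the walk, k being the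
  period. Reversal of the word asks for k - 1 - j, so the start is shifted by -2, written 2k - 2
  because k may be 1.\<close>

lemma walk_word_rev:
  assumes x: "x \<in> nodes n"
  shows "walk_word A (opp (walk_at A x (2 * walk_period A x - 2))) = rev (walk_word A x)"
proof (rule nth_equalityI)
  define k where "k = walk_period A x"
  define y where "y = walk_at A x (2 * k - 2)"
  have k0: "0 < k" unfolding k_def by (rule walk_period_pos[OF A x])
  have y: "y \<in> nodes n" unfolding y_def by (rule walk_nodes[OF A x])
  have ky: "walk_period A y = k" "walk_period A (opp y) = k" unfolding y_def k_def walk_period_opp walk_period_shift by simp_all
  show "length (walk_word A (opp (walk_at A x (2 * walk_period A x - 2)))) = length (rev (walk_word A x))"
    using ky by (simp add: walk_word_def y_def k_def)
  fix i assume "i < length (walk_word A (opp (walk_at A x (2 * walk_period A x - 2))))"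
  then have i: "i < k" using ky by (simp add: walk_word_def y_def k_def)
  have "block_of A (walk_at A (opp y) i) = block_of A (walk_at A x (Suc (k - i) + (2 * k - 2)))"
    using block_of_opp_walk[OF y, of i] i unfolding ky walk_at_add[of _ _ A x] y_def[symmetric] by simp
  also have "walk_at A x (Suc (k - i) + (2 * k - 2)) = walk_at A x (k - 1 - i)"
  proof (rule walk_at_cong_mod[OF x])
    have eq: "Suc (k - i) + (2 * k - 2) = (k - 1 - i) + 2 * k" using i k0 by linarith
    show "(Suc (k - i) + (2 * k - 2)) mod walk_period A x = (k - 1 - i) mod walk_period A x"
      unfolding k_def[symmetric] eq by (simp only: mod_mult_self1)
  qed
  finally show "walk_word A (opp (walk_at A x (2 * walk_period A x - 2))) ! i = rev (walk_word A x) ! i"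
    using i ky(2) unfolding k_def[symmetric] y_def[symmetric] by (simp add: walk_word_def rev_nth k_def[symmetric])
qed

text \<open>Rotating a row moves the start node along its walk, and reversing it starts from an
  opposite node. So these changes of a row amount to another start node for the same set of
  labels.\<close>

lemma walk_word_similar:
  assumes x: "x \<in> nodes n" and w: "w = rotate c (walk_word A x) \<or> w = rotate c (rev (walk_word A x))"
  obtains y where "y \<in> nodes n" "walk_word A y = w" "walk_period A y = walk_period A x" "walk_labels A y = walk_labels A x"
  using w
proof
  assume "w = rotate c (walk_word A x)"
  then show thesis
    using that[of "walk_at A x c"] walk_nodes[OF A x] walk_word_shift[OF x] walk_period_shift walk_labels_shift[OF x] by simp
next
  assume w: "w = rotate c (rev (walk_word A x))"
  define v where "v = opp (walk_at A x (2 * walk_period A x - 2))"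
  have v: "v \<in> nodes n" unfolding v_def using walk_nodes[OF A x] by simp
  have "walk_word A (walk_at A v c) = w"
    unfolding walk_word_shift[OF v] w using walk_word_rev[OF x] by (simp add: v_def)
  moreover have "walk_period A (walk_at A v c) = walk_period A x"
    unfolding walk_period_shift v_def walk_period_opp by simp
  moreover have "walk_labels A (walk_at A v c) = walk_labels A x"
    unfolding walk_labels_shift[OF v] unfolding v_def walk_labels_opp[OF walk_nodes[OF A x]]
    by (rule walk_labels_shift[OF x])
  ultimately show thesis using that walk_nodes[OF A v] by blast
qed

lemma tp_walk_nth:
  assumes "x \<in> nodes n"
  shows "tp (block_of A (walk_at A x j)) = walk_word A x ! (j mod walk_period A x)"
  using walk_period_pos[OF A assms] walk_at_mod[OF A assms, of j] by (simp add: walk_word_def)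

end

text \<open>
  The word determines the rows of all nodes of the walk once the row of the first node is known.
  If it contains a northern or a southern pair the latter is determined as well; otherwise the
  walk can be reversed.
\<close>

lemma align_tops:
  assumes A: "A \<in> pp n" and B: "B \<in> pp n" and x: "x \<in> nodes n" and y: "y \<in> nodes n"
    and word: "walk_word A x = walk_word B y"
  obtains x' where "x' \<in> nodes n" "walk_word A x' = walk_word B y" "walk_period A x' = walk_period A x"
    "walk_labels A x' = walk_labels A x" "is_top x' = is_top y"
proof (cases "is_top x = is_top y")
  case True
  then show ?thesis using that[of x] x word by simp
next
  case False
  define k where "k = walk_period A x"
  have k: "walk_period B y = k" using arg_cong[OF word, of length] by (simp add: walk_word_def k_def)
  have k0: "0 < k" unfolding k_def by (rule walk_period_pos[OF A x])
  have tp_eq: "tp (block_of A (walk_at A x j)) = tp (block_of B (walk_at B y j))" for j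
    unfolding tp_walk_nth[OF A x] tp_walk_nth[OF B y] word k k_def[symmetric] ..
  \<comment> \<open>The induction descends from j = k, where both walks are back at their starts.
    Different rows at \<open>Suc j\<close> rule out a northern or southern pair there, so the
    difference is inherited from j; forwards, such a pair could have removed it.\<close>
  have neq: "is_top (walk_at A x j) \<noteq> is_top (walk_at B y j)" if "j \<le> k" for j
    using that
  proof (induction "k - j" arbitrary: j)
    case 0
    then have "j = k" by simp
    then show ?case using False walk_at_period[OF A x] walk_at_period[OF B y] unfolding k k_def[symmetric] by simp
  next
    case (Suc d)
    have "is_top (walk_at A x (Suc j)) \<noteq> is_top (walk_at B y (Suc j))"
      by (rule Suc.hyps(1)) (use Suc.hyps(2) in auto)
    then show ?case
      using is_top_step[OF A, of "walk_at A x j"] is_top_step[OF B, of "walk_at B y j"] tp_eq[of "Suc j"]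
      by (auto split: pair_type.splits)
  qed
  \<comment> \<open>A northern or southern pair would put both nodes into the same row. So the word
    is constant, and the reversed walk, which starts in the other row, has the same word.\<close>
  have P: "tp (block_of A (walk_at A x j)) = Propagating" for j
  proof -
    have "tp (block_of A (walk_at A x j)) = tp (block_of A (walk_at A x (j mod k)))"
      unfolding k_def walk_at_mod[OF A x] ..
    moreover have "tp (block_of A (walk_at A x (j mod k))) = Propagating"
    proof (cases "tp (block_of A (walk_at A x (j mod k)))")
      case Northern
      then show ?thesis using neq[of "j mod k"] k0 tp_eq[of "j mod k"]
          tp_block_of_top(1)[of A "walk_at A x (j mod k)"] tp_block_of_top(1)[of B "walk_at B y (j mod k)"]
        by (simp add: less_imp_le)
    next
      case Southern
      then show ?thesis using neq[of "j mod k"] k0 tp_eq[of "j mod k"]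
          tp_block_of_top(2)[of A "walk_at A x (j mod k)"] tp_block_of_top(2)[of B "walk_at B y (j mod k)"]
        by (simp add: less_imp_le)
    qed
    ultimately show ?thesis by simp
  qed
  have "walk_word A (opp x) = walk_word B y"
    unfolding word[symmetric]
  proof (rule nth_equalityI)
    show "length (walk_word A (opp x)) = length (walk_word A x)" by (simp add: walk_word_def walk_period_opp[OF A])
    fix i assume "i < length (walk_word A (opp x))"
    then have i: "i < walk_period A x" by (simp add: walk_word_def walk_period_opp[OF A])
    then show "walk_word A (opp x) ! i = walk_word A x ! i"
      using block_of_opp_walk[OF A x, of i] P[of i] P[of "Suc (walk_period A x - i)"]
      by (simp add: walk_word_def walk_period_opp[OF A] del: funpow.simps)
  qed
  then show ?thesis
    using that[of "opp x"] x walk_period_opp[OF A] walk_labels_opp[OF A x] False by simp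
qed

lemma bij_betw_labels:
  assumes A: "A \<in> pp n" and z: "\<And>i. i < m \<Longrightarrow> z i \<in> nodes n"
    and disj: "\<And>i j. i < m \<Longrightarrow> j < m \<Longrightarrow> i \<noteq> j \<Longrightarrow> walk_labels A (z i) \<inter> walk_labels A (z j) = {}"
    and union: "(\<Union>i<m. walk_labels A (z i)) = {1..n}"
  shows "bij_betw (\<lambda>(i, j). label (walk_at A (z i) j)) (SIGMA i:{..<m}. {..<walk_period A (z i)}) {1..n}"
proof (rule bij_betw_imageI)
  let ?S = "SIGMA i:{..<m}. {..<walk_period A (z i)}"
  show "inj_on (\<lambda>(i, j). label (walk_at A (z i) j)) ?S"
  proof (rule inj_onI)
    fix p q assume "p \<in> ?S" "q \<in> ?S"
      "(\<lambda>(i, j). label (walk_at A (z i) j)) p = (\<lambda>(i, j). label (walk_at A (z i) j)) q"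
    moreover obtain i j k l where pq: "p = (i, j)" "q = (k, l)" by (cases p, cases q)
    ultimately have ij: "i < m" "j < walk_period A (z i)" "k < m" "l < walk_period A (z k)"
      and eq: "label (walk_at A (z i) j) = label (walk_at A (z k) l)" by auto
    have "i = k"
    proof (rule ccontr)
      assume "i \<noteq> k"
      then have "walk_labels A (z i) \<inter> walk_labels A (z k) = {}" using disj ij by blast
      moreover have "label (walk_at A (z i) j) \<in> walk_labels A (z i)" "label (walk_at A (z k) l) \<in> walk_labels A (z k)"
        unfolding walk_labels_def by blast+
      ultimately show False using eq by auto
    qed
    moreover have "j = l" using inj_on_label[OF A z[OF ij(1)]] eq ij \<open>i = k\<close> by (auto simp: inj_on_def)
    ultimately show "p = q" using pq by simp
  qed
  have "(\<lambda>(i, j). label (walk_at A (z i) j)) ` ?S =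
      (\<Union>i<m. (\<lambda>j. label (walk_at A (z i) j)) ` {..<walk_period A (z i)})" by force
  also have "\<dots> = (\<Union>i<m. walk_labels A (z i))"
    unfolding walk_labels_def by (intro SUP_cong refl range_mod[OF A, symmetric]) (use z in simp)
  finally show "(\<lambda>(i, j). label (walk_at A (z i) j)) ` ?S = {1..n}" using union by simp
qed

lemma relabel_opp: "relabel f (opp x) = opp (relabel f x)"
  by (cases x) auto

lemma label_relabel: "label (relabel f x) = f (label x)" "is_top (relabel f x) = is_top x"
  by (cases x; simp)+

text \<open>With start nodes chosen so that words and initial rows agree, both diagrams look alike
  along their walks. Matching the labels position by position defines the conjugating
  permutation.\<close>

lemma conjugate_of_spores:
  assumes A: "A \<in> pp n" and B: "B \<in> pp n" and s: "spore_filling A s" and t: "spore_filling B t"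
    and sim: "(s, t) \<in> filling_sim n"
  shows "B \<in> conj_orbit n A"
proof -
  obtain \<rho> where \<rho>: "\<rho> permutes {..<length s}" and len: "length s = length t"
    and rows: "\<And>i. i < length s \<Longrightarrow> \<exists>k. t ! \<rho> i = rotate k (s ! i) \<or> t ! \<rho> i = rotate k (rev (s ! i))"
    using sim unfolding filling_sim_def by blast
  define m where "m = length s"
  obtain z0 where z0: "\<And>i. i < m \<Longrightarrow> z0 i \<in> nodes n" "\<And>i. i < m \<Longrightarrow> s ! i = walk_word A (z0 i)"
    "\<And>i j. i < m \<Longrightarrow> j < m \<Longrightarrow> i \<noteq> j \<Longrightarrow> walk_labels A (z0 i) \<inter> walk_labels A (z0 j) = {}"
    "(\<Union>i<m. walk_labels A (z0 i)) = {1..n}"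
    using spore_fillingD[OF A s] unfolding m_def by metis
  obtain w0 where w0: "\<And>i. i < m \<Longrightarrow> w0 i \<in> nodes n" "\<And>i. i < m \<Longrightarrow> t ! i = walk_word B (w0 i)"
    "\<And>i j. i < m \<Longrightarrow> j < m \<Longrightarrow> i \<noteq> j \<Longrightarrow> walk_labels B (w0 i) \<inter> walk_labels B (w0 j) = {}"
    "(\<Union>i<m. walk_labels B (w0 i)) = {1..n}"
    using spore_fillingD[OF B t] unfolding m_def len by metis
  have \<rho>m: "\<rho> i < m" if "i < m" for i using permutes_in_image[OF \<rho>, of i] that by (simp add: m_def)
  \<comment> \<open>The start nodes of \<open>B\<close>, renumbered so that row i of
    \<open>s\<close> faces row \<open>\<rho> i\<close> of \<open>t\<close>.\<close>
  define w where "w i = w0 (\<rho> i)" for i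
  have w: "w i \<in> nodes n" if "i < m" for i unfolding w_def using w0(1) \<rho>m that by blast
  have "\<exists>x. x \<in> nodes n \<and> walk_word A x = walk_word B (w i) \<and> walk_period A x = walk_period A (z0 i) \<and>
      walk_labels A x = walk_labels A (z0 i) \<and> is_top x = is_top (w i)" if i: "i < m" for i
  proof -
    obtain k where "t ! \<rho> i = rotate k (walk_word A (z0 i)) \<or> t ! \<rho> i = rotate k (rev (walk_word A (z0 i)))"
      using rows i z0(2)[OF i] unfolding m_def by metis
    from walk_word_similar[OF A z0(1)[OF i] this] obtain y where y: "y \<in> nodes n" "walk_word A y = t ! \<rho> i"
      "walk_period A y = walk_period A (z0 i)" "walk_labels A y = walk_labels A (z0 i)" by blast
    have "walk_word A y = walk_word B (w i)" unfolding y(2) w_def by (rule w0(2)[OF \<rho>m[OF i]])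
    from align_tops[OF A B y(1) w[OF i] this] show ?thesis using y by metis
  qed
  then obtain z where z: "\<And>i. i < m \<Longrightarrow> z i \<in> nodes n" "\<And>i. i < m \<Longrightarrow> walk_word A (z i) = walk_word B (w i)"
    "\<And>i. i < m \<Longrightarrow> walk_labels A (z i) = walk_labels A (z0 i)" "\<And>i. i < m \<Longrightarrow> is_top (z i) = is_top (w i)"
    by metis
  have per: "walk_period B (w i) = walk_period A (z i)" if "i < m" for i
    using arg_cong[OF z(2)[OF that], of length] by (simp add: walk_word_def)
  let ?S = "SIGMA i:{..<m}. {..<walk_period A (z i)}"
  let ?F = "\<lambda>(i, j). label (walk_at A (z i) j)" and ?G = "\<lambda>(i, j). label (walk_at B (w i) j)"
  have F: "bij_betw ?F ?S {1..n}"
    by (rule bij_betw_labels[OF A z(1)]) (use z(3) z0(3,4) in simp_all)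
  have G: "bij_betw ?G ?S {1..n}"
  proof -
    have "walk_labels B (w i) \<inter> walk_labels B (w j) = {}" if "i < m" "j < m" "i \<noteq> j" for i j
    proof -
      have "\<rho> i \<noteq> \<rho> j" using permutes_inj[OF \<rho>] that(3) by (auto dest: injD)
      then show ?thesis unfolding w_def using w0(3) \<rho>m that by blast
    qed
    moreover have "(\<Union>i<m. walk_labels B (w i)) = {1..n}"
    proof -
      have "(\<Union>i<m. walk_labels B (w i)) = (\<Union>i\<in>\<rho> ` {..<m}. walk_labels B (w0 i))" by (simp add: w_def)
      also have "\<rho> ` {..<m} = {..<m}" using permutes_image[OF \<rho>] by (simp add: m_def)
      finally show ?thesis using w0(4) by simp
    qed
    ultimately have "bij_betw ?G (SIGMA i:{..<m}. {..<walk_period B (w i)}) {1..n}"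
      by (intro bij_betw_labels[OF B w]) simp_all
    moreover have "(SIGMA i:{..<m}. {..<walk_period B (w i)}) = ?S" by (intro Sigma_cong refl) (simp add: per)
    ultimately show ?thesis by simp
  qed
  have bij: "bij_betw (?G \<circ> inv_into ?S ?F) {1..n} {1..n}"
    by (rule bij_betw_trans[OF bij_betw_inv_into[OF F] G])
  then obtain f where f: "f permutes {1..n}" "\<And>x. x \<in> {1..n} \<Longrightarrow> f x = (?G \<circ> inv_into ?S ?F) x"
    using permutes_extend[of "{1..n}" "{1..n}" "?G \<circ> inv_into ?S ?F"] by (auto simp: bij_betw_def)
  have f_label: "f (label (walk_at A (z i) j)) = label (walk_at B (w i) j)" if "i < m" "j < walk_period A (z i)" for i j
  proof -
    have p: "(i, j) \<in> ?S" using that by simp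
    have "inv_into ?S ?F (?F (i, j)) = (i, j)" using inv_into_f_f[OF bij_betw_imp_inj_on[OF F] p] .
    moreover have "?F (i, j) \<in> {1..n}" using F p unfolding bij_betw_def by blast
    ultimately show ?thesis using f(2)[of "?F (i, j)"] by simp
  qed
  \<comment> \<open>The words agree and the walks start in the same row, so by
    \<open>is_top_step\<close> the rows agree throughout.\<close>
  have top: "is_top (walk_at A (z i) j) = is_top (walk_at B (w i) j)" if i: "i < m" for i j
  proof (induction j)
    case 0
    then show ?case using z(4)[OF i] by simp
  next
    case (Suc j)
    have "tp (block_of A (walk_at A (z i) (Suc j))) = tp (block_of B (walk_at B (w i) (Suc j)))"
      unfolding tp_walk_nth[OF A z(1)[OF i]] tp_walk_nth[OF B w[OF i]] per[OF i] z(2)[OF i] ..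
    then show ?case using is_top_step[OF A, of "walk_at A (z i) j"] is_top_step[OF B, of "walk_at B (w i) j"] Suc
      by (simp split: pair_type.split)
  qed
  have rel: "relabel f (walk_at A (z i) j) = walk_at B (w i) j" if i: "i < m" for i j
  proof -
    let ?k = "walk_period A (z i)"
    have k0: "j mod ?k < ?k" using walk_period_pos[OF A z(1)[OF i]] by simp
    have "relabel f (walk_at A (z i) (j mod ?k)) = walk_at B (w i) (j mod ?k)"
      by (rule node_eqI) (simp_all only: label_relabel f_label[OF i k0] top[OF i])
    then show ?thesis using walk_at_mod[OF A z(1)[OF i], of j] walk_at_mod[OF B w[OF i], of j] per[OF i] by simp
  qed
  \<comment> \<open>Every pair consists of the opposite of a walk node and the next walk node. Since
    \<open>relabel f\<close> carries walks to walks and commutes with \<open>opp\<close>, it carries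
    pairs to pairs.\<close>
  have "map_diagram (relabel f) A \<subseteq> B"
  proof
    fix b assume "b \<in> map_diagram (relabel f) A"
    then obtain a where a: "a \<in> A" "b = relabel f ` a" unfolding map_diagram_def by blast
    then obtain x where x: "x \<in> nodes n" "a = block_of A x"
      unfolding block_of_def by (subst (asm) pp_blocks_eq[OF A]) auto
    have "label x \<in> ?F ` ?S" using x(1) F label_nodes[of x n] unfolding bij_betw_def by simp
    then obtain i j where ij: "i < m" "label (walk_at A (z i) j) = label x" by auto
    have "\<exists>j. a = block_of A (walk_at A (z i) (Suc j))"
    proof -
      consider "x = walk_at A (z i) j" | "x = opp (walk_at A (z i) j)" using ij(2) unfolding label_eq_iff by blast
      then show ?thesis
      proof cases
        case 1
        obtain k where "walk_period A (z i) = Suc k" using walk_period_pos[OF A z(1)[OF ij(1)]] gr0_conv_Suc by blast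
        then have "walk_at A (z i) (Suc (j + k)) = x"
          using walk_at_cong_mod[OF A z(1)[OF ij(1)], of "Suc (j + k)" j] mod_add_self2[of j "Suc k"] 1 by simp
        then show ?thesis using x(2) by metis
      next
        case 2
        then show ?thesis using x(2) block_of_opp[OF A] by auto
      qed
    qed
    then obtain j where "a = {opp (walk_at A (z i) j), walk_at A (z i) (Suc j)}"
      using block_of_step[OF A] by auto
    then have "b = {opp (walk_at B (w i) j), walk_at B (w i) (Suc j)}"
      unfolding a(2) by (simp add: relabel_opp rel[OF ij(1)] del: funpow.simps)
    then have "b = block_of B (walk_at B (w i) (Suc j))" using block_of_step[OF B] by simp
    then show "b \<in> B" using block_of_in[OF B walk_nodes[OF B w[OF ij(1)], of "Suc j"]] by simp
  qed
  then have "map_diagram (relabel f) A = B"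
    by (rule pair_partitions_eqI[OF map_relabel_pp[OF f(1) A] B])
  then show ?thesis unfolding conj_orbit_eq using f(1) by blast
qed

section \<open>Spore classes and conjugation orbits\<close>

lemma filling_sim_refl: "s \<in> fillings n \<Longrightarrow> (s, s) \<in> filling_sim n"
  unfolding filling_sim_def using permutes_id[of "{..<length s}"]
  by (auto intro!: exI[of _ id] exI[of _ 0])

lemma count_list_rotate: "count_list (rotate k xs) y = count_list xs y"
  by (simp add: rotate_drop_take) (metis add.commute append_take_drop_id count_list_append)

lemma filling_sim_count:
  assumes "(s, t) \<in> filling_sim n"
  shows "count_list (concat t) y = count_list (concat s) y"
proof -
  obtain \<rho> where \<rho>: "\<rho> permutes {..<length s}" and len: "length s = length t"
    and rows: "\<And>i. i < length s \<Longrightarrow> \<exists>k. t ! \<rho> i = rotate k (s ! i) \<or> t ! \<rho> i = rotate k (rev (s ! i))"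
    using assms unfolding filling_sim_def by blast
  have "count_list (concat t) y = (\<Sum>i<length s. count_list (t ! i) y)" by (simp add: count_list_concat len)
  also have "\<dots> = (\<Sum>i<length s. count_list (t ! \<rho> i) y)"
    by (rule sum.permute[OF \<rho>, unfolded comp_def])
  also have "\<dots> = (\<Sum>i<length s. count_list (s ! i) y)"
  proof (rule sum.cong[OF refl])
    fix i assume "i \<in> {..<length s}"
    then obtain k where "t ! \<rho> i = rotate k (s ! i) \<or> t ! \<rho> i = rotate k (rev (s ! i))" using rows by auto
    then show "count_list (t ! \<rho> i) y = count_list (s ! i) y" by (auto simp: count_list_rotate)
  qed
  also have "\<dots> = count_list (concat s) y" by (simp add: count_list_concat)
  finally show ?thesis .
qed

definition some_filling :: "diagram \<Rightarrow> filling" where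
  "some_filling A = (SOME s. spore_filling A s)"

lemma some_filling: "A \<in> pp n \<Longrightarrow> spore_filling A (some_filling A)"
  unfolding some_filling_def using spore_filling_exists by (rule someI_ex)

lemma Sp_eq: "Sp n A = filling_sim n `` {some_filling A}"
  by (simp add: Sp_def some_filling_def)

text \<open>Equal classes make the two chosen fillings equivalent, and
  \<open>conjugate_of_spores\<close> applies to any fillings of the two diagrams.\<close>

lemma Sp_eq_conj:
  assumes A: "A \<in> pp n" and B: "B \<in> pp n" and eq: "Sp n A = Sp n B"
  shows "B \<in> conj_orbit n A"
proof -
  have "some_filling B \<in> Sp n B"
    unfolding Sp_eq using filling_sim_refl[OF spore_filling_props(1)[OF B some_filling[OF B]]] by blast
  then have "some_filling B \<in> Sp n A" using eq by simp
  then have "(some_filling A, some_filling B) \<in> filling_sim n" unfolding Sp_eq by simp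
  then show ?thesis by (rule conjugate_of_spores[OF A B some_filling[OF A] some_filling[OF B]])
qed

text \<open>The number of entries \<open>Propagating\<close> is constant on an equivalence class and
  equals the number of propagating lines.\<close>

lemma Sp_le_iff:
  assumes A: "A \<in> pp n"
  shows "Sp n A \<in> tableaux_le n l \<longleftrightarrow> A \<in> pair_partitions_le n l"
proof -
  note s = some_filling[OF A]
  note props = spore_filling_props[OF A s]
  have mem: "some_filling A \<in> Sp n A" unfolding Sp_eq using filling_sim_refl[OF props(1)] by blast
  have "Sp n A \<in> tableaux n" unfolding Sp_eq tableaux_def by (rule quotientI[OF props(1)])
  moreover have "(\<exists>s\<in>Sp n A. count_list (concat s) Propagating \<le> l) \<longleftrightarrow>
      count_list (concat (some_filling A)) Propagating \<le> l"
    using mem filling_sim_count unfolding Sp_eq by fastforce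
  ultimately show ?thesis using props(2) A unfolding tableaux_le_def pair_partitions_le_def by auto
qed

lemma spore_classes_eq: "spore_classes n l = Sp n ` pair_partitions_le n l"
  unfolding spore_classes_def using Sp_le_iff by (auto simp: pair_partitions_le_def)

section \<open>The splitting idempotent\<close>

theorem theorem14:
  fixes n l :: nat and A :: "filling set \<Rightarrow> diagram"
  assumes "2 \<le> n" and "l < n" and "even (n - l)"
    and "\<And>t. t \<in> spore_classes n l \<Longrightarrow> A t \<in> pair_partitions n \<and> Sp n (A t) = t"
  shows "(\<exists>c. (\<forall>t\<in>spore_classes n l. c t \<in> integral_scalars) \<and>
            u_bar_prod n l \<otimes>\<^bsub>brauer n\<^esub> X_elem n l A c = - u_bar_prod n l)
    \<and> (\<forall>c. (\<forall>t\<in>spore_classes n l. c t \<in> integral_scalars) \<longrightarrow>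
            u_bar_prod n l \<otimes>\<^bsub>brauer n\<^esub> X_elem n l A c = - u_bar_prod n l \<longrightarrow>
            splitting_idempotent (integral_brauer n) (integral_ideal n l)
              (\<one>\<^bsub>brauer n\<^esub> + X_elem n l A c))"
proof -
  define L where "L = pair_partitions_le n l"
  define T where "T = spore_classes n l"
  define U where "U = u_bar_prod n l"
  have l: "l \<le> n" "even (n - l)" using assms by auto
  interpret diagram_ideal n L unfolding L_def by (rule diagram_ideal_le[OF l])
  interpret R: ring "integral_brauer n" by (rule ring_integral_brauer)
  have T: "A t \<in> L" "A t \<in> pp n" "Sp n (A t) = t" if "t \<in> T" for t
  proof -
    show A: "A t \<in> pp n" "Sp n (A t) = t" using assms(4) that unfolding T_def by blast+
    have "t \<in> tableaux_le n l" using that unfolding T_def spore_classes_def by blast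
    then show "A t \<in> L" using Sp_le_iff[OF A(1)] A(2) unfolding L_def by simp
  qed
  have fin_T: "finite T" unfolding T_def spore_classes_eq using finite_L unfolding L_def by simp
  have orbit_L: "conj_orbit n B \<subseteq> L" if "B \<in> L" for B
    using that conj_orbit_pp[of B n] pair_partitions_le_iff[OF l] unfolding L_def by auto
  \<comment> \<open>\<open>B\<close> is conjugate to the representative chosen for its own spore, so
    the orbits of the representatives exhaust the ideal.\<close>
  have cover: "\<exists>t\<in>T. conj_orbit n (A t) = conj_orbit n B" if "B \<in> L" for B
  proof -
    have B: "B \<in> pp n" using that L_pp by blast
    have t: "Sp n B \<in> T" using that unfolding T_def spore_classes_eq L_def by blast
    have "A (Sp n B) \<in> conj_orbit n B" using Sp_eq_conj[OF B T(2)[OF t]] T(3)[OF t] by simp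
    then show ?thesis using conj_orbit_eqI t by blast
  qed
  obtain y where y: "\<forall>B\<in>L. y B \<in> integral_scalars"
    and unit: "\<And>x. x \<in> span_of L \<Longrightarrow> brauer_mult n (\<Sum>B\<in>L. scale (y B) (bar B)) x = x \<and>
      brauer_mult n x (\<Sum>B\<in>L. scale (y B) (bar B)) = x"
    using ideal_unit by blast
  define e where "e = (\<Sum>B\<in>L. scale (y B) (bar B))"
  have e_unit: "brauer_mult n e x = x \<and> brauer_mult n x e = x" if "x \<in> span_of L" for x
    unfolding e_def by (rule unit[OF that])
  have e_L: "e \<in> span_of L" unfolding e_def bar_eq by (intro span_of_sum span_of_scale) simp
  note e_pp = span_L_pp[OF e_L]
  have U_L: "U \<in> span_of L" unfolding U_def L_def by (rule u_bar_prod_ideal[OF l])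
  have X_eq: "X_elem n l A c = (\<Sum>t\<in>T. scale (c t) (orbit_sum n (A t)))" for c
    by (simp add: X_elem_def T_def)
  have X_L: "X_elem n l A c \<in> span_of L" for c
    unfolding X_eq orbit_sum_def
    by (intro span_of_sum span_of_scale) (use orbit_L T(1) in auto)
  have X_conj: "brauer_mult n (perm_elem n \<sigma>) (X_elem n l A c) = brauer_mult n (X_elem n l A c) (perm_elem n \<sigma>)"
    if \<sigma>: "\<sigma> permutes {1..n}" for \<sigma> c
  proof -
    have "conj_elem n \<sigma> (X_elem n l A c) = X_elem n l A c"
      unfolding X_eq conj_elem_sum conj_elem_linear
      by (intro sum.cong refl arg_cong2[where f = scale] conj_orbit_sum[OF \<sigma> T(2)])
    then show ?thesis using conj_elem_eq_iff[OF \<sigma> span_L_pp[OF X_L]] by simp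
  qed
  \<comment> \<open>All solutions of the equation therefore give the same element of the
    algebra.\<close>
  have unique: "X_elem n l A c = - e" if "brauer_mult n U (X_elem n l A c) = - U" for c
  proof -
    have "- X_elem n l A c = e"
    proof (rule unit_unique[OF l])
      show "e \<in> span_of (pair_partitions_le n l)" "- X_elem n l A c \<in> span_of (pair_partitions_le n l)"
        using e_L span_of_minus[OF X_L] unfolding L_def by blast+
      show "brauer_mult n e x = x" if "x \<in> span_of (pair_partitions_le n l)" for x
        using e_unit that unfolding L_def by blast
      show "brauer_mult n (u_bar_prod n l) (- X_elem n l A c) = u_bar_prod n l"
        using that unfolding U_def by (simp add: brauer_mult_minus)
      show "brauer_mult n (perm_elem n \<sigma>) (- X_elem n l A c) = brauer_mult n (- X_elem n l A c) (perm_elem n \<sigma>)"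
        if "\<sigma> permutes {1..n}" for \<sigma>
        using X_conj[OF that] by (simp add: brauer_mult_minus)
    qed
    then show ?thesis by (simp flip: minus_equation_iff)
  qed
  \<comment> \<open>The unit of the ideal is central, so its coefficients are constant on
    conjugation orbits.\<close>
  have e_inv: "Poly_Mapping.lookup e (map_diagram (relabel \<sigma>) B) = Poly_Mapping.lookup e B"
    if \<sigma>: "\<sigma> permutes {1..n}" for \<sigma> B
  proof -
    have "conj_elem n \<sigma> e = e"
      unfolding conj_elem_eq_iff[OF \<sigma> e_pp] by (rule unit_central[OF e_L e_unit perm_elem_span[OF \<sigma>]])
    then show ?thesis using lookup_conj_elem[OF \<sigma> e_pp, of B] by simp
  qed
  \<comment> \<open>Passing from \<open>bar B\<close> to the diagram \<open>B\<close> multiplies the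
    coefficient by a power of \<open>inverse delta\<close>, which is integral.\<close>
  have e_integral: "Poly_Mapping.lookup e B \<in> integral_scalars" for B
  proof -
    have "Poly_Mapping.lookup e B = (\<Sum>C\<in>L. y C * inverse delta ^ north C * of_bool (C = B))"
      unfolding e_def bar_eq by (simp add: lookup_sum mult.assoc)
    also have "\<dots> \<in> integral_scalars"
      unfolding integral_scalars_eq
      using y unfolding integral_scalars_eq
      by (intro filtration_sum filtration_mult_0(1) inverse_delta_power) auto
    finally show ?thesis .
  qed
  \<comment> \<open>One spore for each orbit. Should two spores have representatives in the same
    orbit, counting both would double its coefficients.\<close>
  obtain T0 where T0: "T0 \<subseteq> T" "inj_on (\<lambda>t. conj_orbit n (A t)) T0"
    "(\<lambda>t. conj_orbit n (A t)) ` T = (\<lambda>t. conj_orbit n (A t)) ` T0"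
    using subset_image_inj[of "(\<lambda>t. conj_orbit n (A t)) ` T" "\<lambda>t. conj_orbit n (A t)" T] by auto
  define c where "c t = (if t \<in> T0 then - Poly_Mapping.lookup e (A t) else 0)" for t
  have c_integral: "\<forall>t\<in>T. c t \<in> integral_scalars"
    using e_integral filtration_minus unfolding c_def integral_scalars_eq by auto
  have "X_elem n l A c = (\<Sum>t\<in>T0. scale (c t) (orbit_sum n (A t)))"
    unfolding X_eq by (rule sum.mono_neutral_right) (use fin_T T0(1) in \<open>auto simp: c_def\<close>)
  also have "\<dots> = (\<Sum>t\<in>T0. \<Sum>B\<in>conj_orbit n (A t). scale (- Poly_Mapping.lookup e B) (basis_elem B))"
  proof (rule sum.cong[OF refl])
    fix t assume t: "t \<in> T0"
    show "scale (c t) (orbit_sum n (A t)) =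
        (\<Sum>B\<in>conj_orbit n (A t). scale (- Poly_Mapping.lookup e B) (basis_elem B))"
      unfolding orbit_sum_def scale_sum_right
      by (intro sum.cong refl) (use t e_inv in \<open>auto simp: c_def conj_orbit_eq\<close>)
  qed
  also have "\<dots> = (\<Sum>B\<in>(\<Union>t\<in>T0. conj_orbit n (A t)). scale (- Poly_Mapping.lookup e B) (basis_elem B))"
  proof (rule sum.UNION_disjoint[symmetric])
    show "finite T0" using fin_T T0(1) finite_subset by blast
    show "\<forall>t\<in>T0. finite (conj_orbit n (A t))"
      using orbit_L T(1) T0(1) finite_subset[OF _ finite_L] by blast
    show "\<forall>t\<in>T0. \<forall>t'\<in>T0. t \<noteq> t' \<longrightarrow> conj_orbit n (A t) \<inter> conj_orbit n (A t') = {}"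
    proof (intro ballI impI)
      fix t t' assume t: "t \<in> T0" "t' \<in> T0" "t \<noteq> t'"
      show "conj_orbit n (A t) \<inter> conj_orbit n (A t') = {}"
      proof (rule ccontr)
        assume "conj_orbit n (A t) \<inter> conj_orbit n (A t') \<noteq> {}"
        then obtain B where "B \<in> conj_orbit n (A t)" "B \<in> conj_orbit n (A t')" by blast
        then have "conj_orbit n (A t) = conj_orbit n (A t')" using conj_orbit_eqI by metis
        then show False using T0(2) t by (auto simp: inj_on_def)
      qed
    qed
  qed
  also have "(\<Union>t\<in>T0. conj_orbit n (A t)) = L"
  proof
    show "(\<Union>t\<in>T0. conj_orbit n (A t)) \<subseteq> L" using orbit_L T(1) T0(1) by blast
    show "L \<subseteq> (\<Union>t\<in>T0. conj_orbit n (A t))"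
    proof
      fix B assume B: "B \<in> L"
      have "conj_orbit n B \<in> (\<lambda>t. conj_orbit n (A t)) ` T0" using cover[OF B] unfolding T0(3)[symmetric] by blast
      then show "B \<in> (\<Union>t\<in>T0. conj_orbit n (A t))" using conj_orbit_self[of B n] by auto
    qed
  qed
  also have "(\<Sum>B\<in>L. scale (- Poly_Mapping.lookup e B) (basis_elem B)) = - e"
  proof -
    have "Poly_Mapping.keys e \<subseteq> L" using e_L by (simp add: span_of_def)
    from basis_expansion[OF finite_L this] show ?thesis by (simp add: sum_negf)
  qed
  finally have "brauer_mult n U (X_elem n l A c) = - U" using e_unit[OF U_L] by (simp add: brauer_mult_minus)
  then have solvable: "\<exists>c. (\<forall>t\<in>T. c t \<in> integral_scalars) \<and> brauer_mult n U (X_elem n l A c) = - U"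
    using c_integral by blast
  define J where "J = integral_ideal n l"
  have bars: "bar ` L \<subseteq> integral_carrier n" using bar_integral L_pp by blast
  have J_ideal: "ideal J (integral_brauer n)"
    unfolding J_def integral_ideal_def using R.genideal_ideal bars unfolding L_def by simp
  have bars_J: "bar ` L \<subseteq> J"
    unfolding J_def integral_ideal_def using R.genideal_self bars unfolding L_def by simp
  interpret J: ideal J "integral_brauer n" by (rule J_ideal)
  have J_carrier: "x \<in> integral_carrier n" if "x \<in> J" for x using J.Icarr[OF that] by simp
  have J_add: "x + z \<in> J" if "x \<in> J" "z \<in> J" for x z using J.a_closed[OF that] by simp
  have J_0: "0 \<in> J" using J.zero_closed by simp
  \<comment> \<open>Scalars act through multiples of the identity, which belong to the integral
    form, so a ring ideal is closed under them.\<close>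
  have J_scale: "scale a x \<in> J" if a: "a \<in> integral_scalars" and x: "x \<in> J" for a x
  proof -
    have "scale a (basis_elem (id_diagram n)) \<in> integral_carrier n"
      by (rule integral_carrier_scale[OF a integral_carrier_one])
    then have "brauer_mult n (scale a (basis_elem (id_diagram n))) x \<in> J" using J.I_l_closed[OF x] by simp
    moreover have "x \<in> span_of (pp n)" using J_carrier[OF x] integral_carrier_span by blast
    ultimately show ?thesis by (simp add: brauer_mult_scale_left brauer_mult_one)
  qed
  have J_sum: "sum g S \<in> J" if "\<And>B. B \<in> S \<Longrightarrow> g B \<in> J" for g :: "diagram \<Rightarrow> brauer_elem" and S
    using that by (induction S rule: infinite_finite_induct) (auto intro: J_0 J_add)
  have e_J: "e \<in> J" unfolding e_def using bars_J y by (intro J_sum J_scale) auto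
  have minus_one: "- 1 \<in> integral_scalars"
    unfolding integral_scalars_eq by (rule filtration_minus[OF one_filtration])
  have neg_carrier: "- x \<in> integral_carrier n" if "x \<in> integral_carrier n" for x
    using integral_carrier_scale[OF minus_one that] by simp
  \<comment> \<open>An ideal that contains the generators; minimality bounds \<open>J\<close> by
    \<open>span_of L\<close>, where \<open>e\<close> acts as the unit.\<close>
  have "ideal (integral_carrier n \<inter> span_of L) (integral_brauer n)"
  proof (rule idealI[OF ring_integral_brauer])
    show "subgroup (integral_carrier n \<inter> span_of L) (add_monoid (integral_brauer n))"
    proof (rule R.add.subgroupI)
      show "integral_carrier n \<inter> span_of L \<subseteq> carrier (integral_brauer n)" by simp
      show "integral_carrier n \<inter> span_of L \<noteq> {}" using e_J J_carrier e_L by blast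
      fix a assume a: "a \<in> integral_carrier n \<inter> span_of L"
      have "\<ominus>\<^bsub>integral_brauer n\<^esub> a = - a" by (rule R.minus_equality) (use a neg_carrier in auto)
      then show "\<ominus>\<^bsub>integral_brauer n\<^esub> a \<in> integral_carrier n \<inter> span_of L"
        using a neg_carrier span_of_minus by auto
      fix b assume "b \<in> integral_carrier n \<inter> span_of L"
      then show "a \<oplus>\<^bsub>integral_brauer n\<^esub> b \<in> integral_carrier n \<inter> span_of L"
        using a integral_carrier_add span_of_add by simp
    qed
    fix a x assume "a \<in> integral_carrier n \<inter> span_of L" "x \<in> carrier (integral_brauer n)"
    then have *: "a \<in> integral_carrier n" "a \<in> span_of L" "x \<in> integral_carrier n" "x \<in> span_of (pp n)"
      using integral_carrier_span by auto
    then show "x \<otimes>\<^bsub>integral_brauer n\<^esub> a \<in> integral_carrier n \<inter> span_of L"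
      "a \<otimes>\<^bsub>integral_brauer n\<^esub> x \<in> integral_carrier n \<inter> span_of L"
      using integral_carrier_mult ideal_mult by simp_all
  qed
  moreover have "bar ` L \<subseteq> integral_carrier n \<inter> span_of L"
    using bars by (auto simp: bar_eq span_of_scale)
  ultimately have J_span: "J \<subseteq> span_of L"
    unfolding J_def integral_ideal_def using R.genideal_minimal unfolding L_def by blast
  have split: "splitting_idempotent (integral_brauer n) J (basis_elem (id_diagram n) + X_elem n l A c)"
    if "brauer_mult n U (X_elem n l A c) = - U" for c
  proof -
    have X: "X_elem n l A c = - e" by (rule unique[OF that])
    define one where "one = basis_elem (id_diagram n)"
    have X_J: "- e \<in> J" using J_scale[OF minus_one e_J] by simp
    have carr: "one \<in> integral_carrier n" "- e \<in> integral_carrier n"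
      unfolding one_def using integral_carrier_one J_carrier[OF X_J] by auto
    have one_eq: "\<one>\<^bsub>integral_brauer n\<^esub> = one" by (simp add: one_def)
    have diff: "(one + - e) \<ominus>\<^bsub>integral_brauer n\<^esub> one = - e"
    proof -
      have "\<ominus>\<^bsub>integral_brauer n\<^esub> one = - one" by (rule R.minus_equality) (use carr neg_carrier in auto)
      then show ?thesis by (simp add: a_minus_def)
    qed
    have "brauer_mult n (one + - e) x = 0 \<and> brauer_mult n x (one + - e) = 0" if "x \<in> J" for x
    proof -
      have x: "x \<in> span_of L" using that J_span by blast
      show ?thesis using e_unit[OF x] brauer_mult_one[OF span_L_pp[OF x]]
        unfolding one_def brauer_mult_add_left brauer_mult_add_right brauer_mult_minus by simp
    qed
    then show ?thesis
      unfolding splitting_idempotent_def X one_def[symmetric] one_eq diff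
      using J_ideal X_J integral_carrier_add[OF carr] by simp
  qed
  show ?thesis using solvable split unfolding T_def U_def J_def by simp
qed

end
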